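(* Let $r\ge 1$. The element $\mathbf m=\sum_{\lambda\in\mathcal P_r}a_\lambda[\mathbf b]^r_\lambda\in\bigwedge^rM_0$ (with $a_\lambda\in\mathbb Z$, all but finitely many zero) belongs to the Grassmann cone $\mathcal G_r$ if and only if the equality $$\mathrm{Res}_z\sum_{\lambda,\mu\in\mathcal P_r}a_\lambda a_\mu\,E_{r-1}(z)\,\Delta_\lambda(\sigma_-(z)H_{r-1})\otimes\frac{1}{E_{r+1}(z)}\,\overline\sigma_-(z)\Delta_\mu(H_{r+1})=0$$ holds in $B_{r-1}\otimes_{\mathbb Z}B_{r+1}$.
   Context: $M_0$ is a free abelian group with basis $(b_0,b_1,\ldots)$; $b_k=0$ for $k<0$. $\mathcal P_r$ is the set of partitions $\lambda=(\lambda_1\ge\cdots\ge\lambda_r\geq 0)$ of length at most $r$. For $\lambda\in\mathcal P_r$, $[\mathbf b]^r_\lambda=b_{\lambda_r}\wedge b_{1+\lambda_{r-1}}\wedge\cdots\wedge b_{r-1+\lambda_1}$; these form a $\mathbb Z$-basis of $\bigwedge^rM_0$. $\mathcal G_r$ is the set of all $m_1\wedge\cdots\wedge m_r$ with $m_i\in M_0$. $B_0=\mathbb Z$, $E_0(z)=1$; for $r\ge1$, $B_r=\mathbb Z[e_1,\ldots,e_r]$ and $E_r(z)=1-e_1z+\cdots+(-1)^re_rz^r$. The sequence $H_r=(h_j)_{j\in\mathbb Z}$ in $B_r$ is defined by $\sum_{j\in\mathbb Z}h_jz^j=1/E_r(z)$ (so $h_j=0$ for $j<0$, $h_0=1$).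 For a sequence $(c_j)_{j\in\mathbb Z}$ in a commutative ring and $\lambda\in\mathcal P_r$, the Schur determinant is $\Delta_\lambda((c_j))=\det(c_{\lambda_j-j+i})_{1\le i,j\le r}$. One has $B_r=\bigoplus_{\lambda\in\mathcal P_r}\mathbb Z\,\Delta_\lambda(H_r)$, and $\phi_r:B_r\to\bigwedge^rM_0$ is the isomorphism of abelian groups $\Delta_\lambda(H_r)\mapsto[\mathbf b]^r_\lambda$. On $\bigwedge M_0$, $\overline\sigma_-(z)$ is the unique homomorphism of $\wedge$-algebras $\bigwedge M_0\to\bigwedge M_0[[z^{-1}]]$ with $\overline\sigma_-(z)b_j=b_j-b_{j-1}z^{-1}$ for all $j\ge 0$; it is the inverse of the unique homomorphism of $\wedge$-algebras $\sigma_-(z)$ with $\sigma_-(z)b_j=\sum_{i\ge0}b_{j-i}z^{-i}$. For $r\geq 1$ they induce $\sigma_-(z),\overline\sigma_-(z):B_r\to B_r[z^{-1}]$ by $\sigma_-(z)\Delta_\lambda(H_r)=\phi_r^{-1}(\sigma_-(z)[\mathbf b]^r_\lambda)$ and $\overline\sigma_-(z)\Delta_\lambda(H_r)=\phi_r^{-1}(\overline\sigma_-(z)[\mathbf b]^r_\lambda)$, for $\lambda\in\mathcal P_r$ ($\phi_r^{-1}$ extended coefficientwise). $\sigma_-(z)H_{r-1}$ is the sequence in $B_{r-1}[z^{-1}]$ with $n$-th term $\sigma_-(z)h_n=\sum_{j=0}^nh_{n-j}z^{-j}$ ($0$ for $n<0$), where $h_j\in B_{r-1}$. In the displayed formula,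 with $\lambda\in\mathcal P_r$, $\Delta_\lambda(\sigma_-(z)H_{r-1})$ is an $r\times r$ determinant, and $\mu$ is viewed as an element of $\mathcal P_{r+1}$. $\mathrm{Res}_z$ is the coefficient of $z^{-1}$ of a formal Laurent series; for Laurent series, $(\sum f_iz^i)\otimes(\sum g_jz^j)=\sum(f_i\otimes g_j)z^{i+j}$. *)

theory Defs
  imports
    "HOL-Library.Poly_Mapping"
    "HOL-Library.FuncSet"
    "HOL-Computational_Algebra.Formal_Laurent_Series"
    "Jordan_Normal_Form.Determinant"
begin

section \<open>Exterior algebra of an abelian group\<close>

text \<open>
  The exterior algebra of an abelian group (i.e. \<open>\<int>\<close>-module) \<open>M\<close> is the free unital ring on
  the set \<open>M\<close> modulo the two-sided ideal generated by \<open>[m + n] - [m] - [n]\<close> (these relations alone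
  give the tensor algebra) and \<open>[m] [m]\<close>. The free ring is the monoid ring over \<open>\<int>\<close> of the monoid
  of words; the monoid is written additively, as the library's convolution product requires.
\<close>

datatype 'm fword = FWord (letters: "'m list")

instantiation fword :: (type) monoid_add
begin

definition zero_fword :: "'a fword" where
  "0 = FWord []"

definition plus_fword :: "'a fword \<Rightarrow> 'a fword \<Rightarrow> 'a fword" where
  "u + v = FWord (letters u @ letters v)"

instance
  by standard (auto simp: zero_fword_def plus_fword_def)

end

definition free_gen :: "'m \<Rightarrow> ('m fword \<Rightarrow>\<^sub>0 int)" where
  "free_gen m = frag_of (FWord [m])"

inductive_set ext_ideal :: "('m::ab_group_add fword \<Rightarrow>\<^sub>0 int) set" where
  additive: "free_gen (m + n) - free_gen m - free_gen n \<in> ext_ideal"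
| square: "free_gen m * free_gen m \<in> ext_ideal"
| plus: "x \<in> ext_ideal \<Longrightarrow> y \<in> ext_ideal \<Longrightarrow> x + y \<in> ext_ideal"
| left: "x \<in> ext_ideal \<Longrightarrow> y * x \<in> ext_ideal"
| right: "x \<in> ext_ideal \<Longrightarrow> x * y \<in> ext_ideal"

lemma ext_ideal_zero: "0 \<in> ext_ideal"
  using ext_ideal.left[OF ext_ideal.square, of 0] by simp

lemma ext_ideal_uminus: "x \<in> ext_ideal \<Longrightarrow> - x \<in> ext_ideal"
  using ext_ideal.left[of x "- 1"] by simp

lemma ext_ideal_diff: "x \<in> ext_ideal \<Longrightarrow> y \<in> ext_ideal \<Longrightarrow> x - y \<in> ext_ideal"
  using ext_ideal.plus[of x "- y"] ext_ideal_uminus by fastforce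

quotient_type (overloaded) 'm exterior = "'m::ab_group_add fword \<Rightarrow>\<^sub>0 int" /
  "\<lambda>x y. x - y \<in> ext_ideal"
proof (rule equivpI)
  show "reflp (\<lambda>x y :: 'm fword \<Rightarrow>\<^sub>0 int. x - y \<in> ext_ideal)"
    by (simp add: reflp_def ext_ideal_zero)
  show "symp (\<lambda>x y :: 'm fword \<Rightarrow>\<^sub>0 int. x - y \<in> ext_ideal)"
    unfolding symp_def by (metis ext_ideal_uminus minus_diff_eq)
  show "transp (\<lambda>x y :: 'm fword \<Rightarrow>\<^sub>0 int. x - y \<in> ext_ideal)"
    unfolding transp_def by (metis ext_ideal.plus diff_add_cancel add_diff_eq)
qed

lemma lookup_mult_zero_fword:
  fixes x y :: "'m fword \<Rightarrow>\<^sub>0 int"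
  shows "Poly_Mapping.lookup (x * y) 0 = Poly_Mapping.lookup x 0 * Poly_Mapping.lookup y 0"
proof -
  have eq: "u + v = 0 \<longleftrightarrow> u = 0 \<and> v = 0" for u v :: "'m fword"
    by (cases u; cases v) (auto simp: plus_fword_def zero_fword_def)
  have "Poly_Mapping.lookup (x * y) 0 = (\<Sum>u. Poly_Mapping.lookup x u * (\<Sum>v. Poly_Mapping.lookup y v when 0 = u + v))"
    by (simp add: lookup_mult)
  also have "\<dots> = (\<Sum>u. (Poly_Mapping.lookup x u * (\<Sum>v. Poly_Mapping.lookup y v when v = 0)) when u = 0)"
    by (rule Sum_any.cong) (auto simp: when_def eq)
  finally show ?thesis by simp
qed

lemma lookup_zero_ext_ideal: "x \<in> ext_ideal \<Longrightarrow> Poly_Mapping.lookup x 0 = 0"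
proof (induction rule: ext_ideal.induct)
  case (additive m n)
  then show ?case
    by (simp add: free_gen_def lookup_minus lookup_single zero_fword_def)
next
  case (square m)
  then show ?case
    unfolding lookup_mult_zero_fword by (simp add: free_gen_def zero_fword_def)
qed (simp_all add: lookup_add lookup_mult_zero_fword)

instantiation exterior :: (ab_group_add) ring_1
begin

lift_definition zero_exterior :: "'a exterior" is 0 .

lift_definition one_exterior :: "'a exterior" is 1 .

lift_definition plus_exterior :: "'a exterior \<Rightarrow> 'a exterior \<Rightarrow> 'a exterior" is "(+)"
  by (metis add_diff_add ext_ideal.plus)

lift_definition uminus_exterior :: "'a exterior \<Rightarrow> 'a exterior" is uminus
  by (metis ext_ideal_uminus minus_diff_minus)

lift_definition minus_exterior :: "'a exterior \<Rightarrow> 'a exterior \<Rightarrow> 'a exterior" is "(-)"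
  by (drule (1) ext_ideal_diff) (simp add: algebra_simps)

lift_definition times_exterior :: "'a exterior \<Rightarrow> 'a exterior \<Rightarrow> 'a exterior" is "(*)"
  by (metis mult_diff_mult ext_ideal.plus ext_ideal.left ext_ideal.right)

instance
proof
  fix a b c :: "'a exterior"
  show "a + b + c = a + (b + c)"
    by transfer (simp add: add.assoc ext_ideal_zero)
  show "a + b = b + a"
    by transfer (simp add: add.commute ext_ideal_zero)
  show "0 + a = a"
    by transfer (simp add: ext_ideal_zero)
  show "- a + a = 0"
    by transfer (simp add: ext_ideal_zero)
  show "a - b = a + - b"
    by transfer (simp add: ext_ideal_zero)
  show "a * b * c = a * (b * c)"
    by transfer (simp add: mult.assoc ext_ideal_zero)
  show "1 * a = a"
    by transfer (simp add: ext_ideal_zero)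
  show "a * 1 = a"
    by transfer (simp add: ext_ideal_zero)
  show "(a + b) * c = a * c + b * c"
    by transfer (simp add: distrib_right ext_ideal_zero)
  show "a * (b + c) = a * b + a * c"
    by transfer (simp add: distrib_left ext_ideal_zero)
  show "(0 :: 'a exterior) \<noteq> 1"
  proof transfer
    have "Poly_Mapping.lookup (0 - 1 :: 'a fword \<Rightarrow>\<^sub>0 int) 0 \<noteq> 0"
      by (simp add: lookup_minus)
    then show "0 - 1 \<notin> (ext_ideal :: ('a fword \<Rightarrow>\<^sub>0 int) set)"
      using lookup_zero_ext_ideal by blast
  qed
qed

end

lift_definition ext_incl :: "'m::ab_group_add \<Rightarrow> 'm exterior" is free_gen .

lemma ext_incl_add: "ext_incl (m + n) = ext_incl m + ext_incl n"
  by transfer (metis ext_ideal.additive diff_diff_eq)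

lemma ext_incl_square: "ext_incl m * ext_incl m = 0"
  by transfer (simp add: ext_ideal.square)

lemma ext_incl_zero: "ext_incl 0 = 0"
  using ext_incl_add[of 0 0] by simp

lemma ext_incl_diff: "ext_incl (m - n) = ext_incl m - ext_incl n"
  using ext_incl_add[of "m - n" n] by (simp add: algebra_simps)

lemma ext_incl_anticomm: "ext_incl m * ext_incl n + ext_incl n * ext_incl m = 0"
  using ext_incl_square[of "m + n"]
  by (simp add: ext_incl_add ext_incl_square distrib_left distrib_right add.commute)

text \<open>A homomorphism of \<open>\<and>\<close>-algebras is a unital ring homomorphism.\<close>

definition alg_hom :: "('a::ring_1 \<Rightarrow> 'b::ring_1) \<Rightarrow> bool" where
  "alg_hom f \<longleftrightarrow> f 1 = 1 \<and> (\<forall>x y. f (x + y) = f x + f y) \<and> (\<forall>x y. f (x * y) = f x * f y)"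


lemma alg_hom_diff: "alg_hom f \<Longrightarrow> f (x - y) = f x - f y"
  unfolding alg_hom_def by (metis add_diff_cancel diff_add_cancel)

lemma alg_hom_zero: "alg_hom f \<Longrightarrow> f 0 = 0"
  using alg_hom_diff[of f 0 0] by simp

lemma alg_hom_exterior_exists:
  fixes f :: "'m::ab_group_add \<Rightarrow> 'r::ring_1"
  assumes add: "\<And>m n. f (m + n) = f m + f n" and sq: "\<And>m. f m * f m = 0"
  shows "\<exists>F. alg_hom F \<and> (\<forall>m. F (ext_incl m) = f m)"
proof -
  define ev where "ev w = prod_list (map f (letters w))" for w
  define G :: "('m fword \<Rightarrow>\<^sub>0 int) \<Rightarrow> 'r" where
    "G x = (\<Sum>w\<in>Poly_Mapping.keys x. of_int (Poly_Mapping.lookup x w) * ev w)" for x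
  have G_sup: "G x = (\<Sum>w\<in>S. of_int (Poly_Mapping.lookup x w) * ev w)"
    if "finite S" "Poly_Mapping.keys x \<subseteq> S" for x S
    unfolding G_def using that by (intro sum.mono_neutral_left) (auto simp: in_keys_iff)
  have G_diff: "G (x - y) = G x - G y" for x y
  proof -
    let ?S = "Poly_Mapping.keys x \<union> Poly_Mapping.keys y"
    have "Poly_Mapping.keys (x - y) \<subseteq> ?S"
      by (auto simp: in_keys_iff lookup_minus)
    then show ?thesis
      by (simp add: G_sup[of ?S] lookup_minus left_diff_distrib sum_subtractf)
  qed
  have G_0: "G 0 = 0"
    by (simp add: G_def)
  have G_add: "G (x + y) = G x + G y" for x y
    using G_diff[of "x + y" y] by (simp add: algebra_simps)
  have G_of: "G (frag_of w) = ev w" for w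
    by (simp add: G_def)
  have G_mult1: "G (frag_of u * y) = ev u * G y" for u y
  proof (rule frag_induction[of y UNIV])
    show "G (frag_of u * frag_of v) = ev u * G (frag_of v)" for v
      by (simp add: mult_single G_of) (simp add: ev_def plus_fword_def)
  qed (simp_all add: G_0 G_diff right_diff_distrib)
  have G_mult: "G (x * y) = G x * G y" for x y
    by (rule frag_induction[of x UNIV])
      (simp_all add: G_0 G_diff left_diff_distrib G_mult1 G_of)
  have G_ideal: "G x = 0" if "x \<in> ext_ideal" for x
    using that
    by (induction rule: ext_ideal.induct)
      (simp_all add: G_add G_diff G_mult free_gen_def G_of ev_def add sq)
  define F where "F x = G (rep_exterior x)" for x
  have F_abs: "F (abs_exterior x) = G x" for x
  proof -
    have "rep_exterior (abs_exterior x) - x \<in> ext_ideal"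
      using Quotient3_rep_abs[OF Quotient3_exterior, of x] by (simp add: ext_ideal_zero)
    then show ?thesis
      unfolding F_def using G_ideal G_diff by fastforce
  qed
  have abs: "\<exists>u. x = abs_exterior u" for x :: "'m exterior"
    by (metis Quotient3_abs_rep[OF Quotient3_exterior])
  have "alg_hom F"
    unfolding alg_hom_def
  proof (intro conjI allI)
    show "F 1 = 1"
      by (simp add: one_exterior_def F_abs G_of ev_def zero_fword_def flip: single_one)
    fix x y :: "'m exterior"
    obtain u v where "x = abs_exterior u" "y = abs_exterior v"
      using abs by meson
    then show "F (x + y) = F x + F y" "F (x * y) = F x * F y"
      by (simp_all add: plus_exterior.abs_eq times_exterior.abs_eq F_abs G_add G_mult)
  qed
  moreover have "F (ext_incl m) = f m" for m
    by (simp add: ext_incl.abs_eq F_abs free_gen_def G_of ev_def)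
  ultimately show ?thesis by blast
qed

lemma alg_hom_exterior_unique:
  assumes F: "alg_hom F" and G: "alg_hom G"
    and eq: "\<And>m. F (ext_incl m) = G (ext_incl m)"
  shows "F = G"
proof
  fix x
  have "F (abs_exterior u) = G (abs_exterior u)" for u
  proof (rule frag_induction[of u UNIV])
    have "F 1 = G 1"
      using F G by (simp add: alg_hom_def)
    then show "F (abs_exterior (frag_of w)) = G (abs_exterior (frag_of w))" for w
    proof (induction "letters w" arbitrary: w)
      case Nil
      then have "w = 0"
        by (simp add: zero_fword_def fword.expand)
      then show ?case
        using Nil by (simp add: one_exterior_def)
    next
      case (Cons m ms)
      have "w = FWord [m] + FWord ms"
        using Cons.hyps(2) by (cases w) (simp add: plus_fword_def)
      then have "frag_of w = free_gen m * frag_of (FWord ms)"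
        by (simp add: free_gen_def mult_single)
      then have "abs_exterior (frag_of w) = ext_incl m * abs_exterior (frag_of (FWord ms))"
        by (simp add: ext_incl.abs_eq times_exterior.abs_eq)
      then show ?case
        using F G eq Cons by (simp add: alg_hom_def)
    qed
  qed (simp_all add: F G alg_hom_zero alg_hom_diff flip: zero_exterior_def minus_exterior.abs_eq)
  then show "F x = G x"
    by (metis Quotient3_abs_rep[OF Quotient3_exterior])
qed


section \<open>The module \<open>M\<^sub>0\<close> and the Grassmann cone\<close>

type_synonym M0 = "nat \<Rightarrow>\<^sub>0 int"

definition bvec :: "int \<Rightarrow> M0" where
  "bvec k = (if k < 0 then 0 else frag_of (nat k))"

text \<open>
  A partition is a function \<open>l\<close> with \<open>l i = \<lambda>\<^bsub>i+1\<^esub>\<close>, trailing zeros included, so that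
  \<open>parts r \<subseteq> parts (Suc r)\<close>.
\<close>

definition parts :: "nat \<Rightarrow> (nat \<Rightarrow> nat) set" where
  "parts r = {l. antimono l \<and> (\<forall>i\<ge>r. l i = 0)}"

definition bwedge :: "nat \<Rightarrow> (nat \<Rightarrow> nat) \<Rightarrow> M0 exterior" where
  "bwedge r l = prod_list (map (\<lambda>k. ext_incl (bvec (int (k + l (r - 1 - k))))) [0..<r])"

definition grassmann_cone :: "nat \<Rightarrow> M0 exterior set" where
  "grassmann_cone r = {prod_list (map ext_incl ms) | ms. length ms = r}"

text \<open>The power series variable is \<open>z\<^sup>-\<^sup>1\<close>.\<close>

definition sigma_bar :: "M0 exterior \<Rightarrow> M0 exterior fps" where
  "sigma_bar = (THE f. alg_hom f \<and>
     (\<forall>j\<ge>0. f (ext_incl (bvec j)) =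
        fps_const (ext_incl (bvec j)) - fps_const (ext_incl (bvec (j - 1))) * fps_X))"


lemma square_zero_aux:
  fixes x y X :: "'a::ring_1"
  assumes "X * x = x * X" "X * y = y * X" "x * x = 0" "y * y = 0" "x * y + y * x = 0"
  shows "(x - y * X) * (x - y * X) = 0"
proof -
  have "(x - y * X) * (x - y * X) = x * x - (x * y * X + y * (X * x)) + y * (X * y) * X"
    by (simp add: left_diff_distrib right_diff_distrib mult.assoc)
  also have "\<dots> = x * x - (x * y + y * x) * X + y * y * X * X"
    unfolding assms(1,2) by (simp only: distrib_right mult.assoc)
  finally show ?thesis
    using assms by simp
qed

lemma sigma_bar_ex1:
  "\<exists>!f. alg_hom f \<and>
     (\<forall>j\<ge>0. f (ext_incl (bvec j)) =
        fps_const (ext_incl (bvec j)) - fps_const (ext_incl (bvec (j - 1))) * fps_X)"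
proof (rule ex_ex1I)
  define s :: "M0 \<Rightarrow> M0" where "s = frag_extend (\<lambda>k. bvec (int k - 1))"
  define f where "f m = fps_const (ext_incl m) - fps_const (ext_incl (s m)) * fps_X" for m
  have s_add: "s (m + n) = s m + s n" for m n
    by (simp add: s_def frag_extend_add)
  have s_b: "s (bvec j) = bvec (j - 1)" if "j \<ge> 0" for j
    using that by (simp add: s_def bvec_def)
  have comm: "fps_X * fps_const c = fps_const c * fps_X" for c :: "M0 exterior"
    by (rule fps_mult_fps_X_commute)
  have "f (m + n) = f m + f n" for m n
    by (simp add: f_def s_add ext_incl_add distrib_right flip: fps_const_add)
  moreover have "f m * f m = 0" for m
  proof -
    have "fps_const (ext_incl m) * fps_const (ext_incl (s m)) +
        fps_const (ext_incl (s m)) * fps_const (ext_incl m) = 0"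
      by (simp add: ext_incl_anticomm)
    then show ?thesis
      unfolding f_def by (intro square_zero_aux comm) (simp_all add: ext_incl_square)
  qed
  ultimately obtain F where "alg_hom F" "\<And>m. F (ext_incl m) = f m"
    using alg_hom_exterior_exists by metis
  then show "\<exists>f. alg_hom f \<and>
     (\<forall>j\<ge>0. f (ext_incl (bvec j)) =
        fps_const (ext_incl (bvec j)) - fps_const (ext_incl (bvec (j - 1))) * fps_X)"
    by (intro exI[of _ F]) (simp add: f_def s_b)
next
  fix f g :: "M0 exterior \<Rightarrow> M0 exterior fps"
  let ?P = "\<lambda>f. alg_hom f \<and>
     (\<forall>j\<ge>0. f (ext_incl (bvec j)) =
        fps_const (ext_incl (bvec j)) - fps_const (ext_incl (bvec (j - 1))) * fps_X)"
  assume f: "?P f" and g: "?P g"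
  have "f (ext_incl m) = g (ext_incl m)" for m
  proof (rule frag_induction[of m UNIV])
    show "f (ext_incl (frag_of k)) = g (ext_incl (frag_of k))" for k
    proof -
      have "frag_of k = bvec (int k)"
        by (simp add: bvec_def)
      then show ?thesis
        using f g by simp
    qed
  qed (use f g in \<open>simp_all add: ext_incl_zero ext_incl_diff alg_hom_zero alg_hom_diff\<close>)
  then show "f = g"
    using alg_hom_exterior_unique f g by blast
qed


section \<open>The rings \<open>B\<^sub>r\<close>\<close>

text \<open>
  All \<open>B\<^sub>r\<close> are realised inside the polynomial ring \<open>\<int>[e\<^sub>0, e\<^sub>1, \<dots>]\<close> (\<open>e\<^sub>0\<close> being unused), a monomial
  being given by its exponent vector.
\<close>

type_synonym epoly = "(nat \<Rightarrow>\<^sub>0 nat) \<Rightarrow>\<^sub>0 int"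

definition evar :: "nat \<Rightarrow> epoly" where
  "evar i = Poly_Mapping.single (Poly_Mapping.single i 1) 1"

definition Bring :: "nat \<Rightarrow> epoly set" where
  "Bring r = {p. \<forall>m\<in>Poly_Mapping.keys p. Poly_Mapping.keys m \<subseteq> {1..r}}"

definition Eser :: "nat \<Rightarrow> epoly fps" where
  "Eser r = 1 + (\<Sum>i=1..r. fps_const ((- 1) ^ i * evar i) * fps_X ^ i)"

definition Eser_inv :: "nat \<Rightarrow> epoly fps" where
  "Eser_inv r = fps_right_inverse (Eser r) 1"

lemma Eser_mult_Eser_inv: "Eser r * Eser_inv r = 1"
  unfolding Eser_inv_def
  by (rule fps_right_inverse) (simp add: Eser_def fps_sum_nth fps_X_power_nth)

definition hseq :: "nat \<Rightarrow> int \<Rightarrow> epoly" where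
  "hseq r j = (if j < 0 then 0 else fps_nth (Eser_inv r) (nat j))"

text \<open>
  The \<open>r \<times> r\<close> Schur determinant; the indices in \<open>\<lambda>\<^sub>j - j + i\<close> are shifted to start at 0.
\<close>

definition schur :: "nat \<Rightarrow> (nat \<Rightarrow> nat) \<Rightarrow> (int \<Rightarrow> 'a::comm_ring_1) \<Rightarrow> 'a" where
  "schur r l c = det (mat r r (\<lambda>(i, j). c (int (l j) - int j + int i)))"

definition phi :: "nat \<Rightarrow> epoly \<Rightarrow> M0 exterior" where
  "phi r = (THE f. f \<in> extensional (Bring r) \<and>
     (\<forall>p\<in>Bring r. \<forall>q\<in>Bring r. f (p + q) = f p + f q) \<and>
     (\<forall>l\<in>parts r. f (schur r l (hseq r)) = bwedge r l))"

text \<open>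
  Elements of \<open>B\<^sub>r[z\<^sup>-\<^sup>1]\<close> are polynomials whose variable stands for \<open>z\<^sup>-\<^sup>1\<close>. The map induced on \<open>B\<^sub>r\<close> is
  prescribed on the basis of Schur determinants; its additive extension is
  \<open>\<phi>\<^sub>r\<^sup>-\<^sup>1 \<circ> sigma_bar \<circ> \<phi>\<^sub>r\<close>, with \<open>\<phi>\<^sub>r\<^sup>-\<^sup>1\<close> applied coefficientwise.
\<close>

definition sigma_bar_B :: "nat \<Rightarrow> epoly \<Rightarrow> epoly poly" where
  "sigma_bar_B r p =
     Abs_poly (\<lambda>n. inv_into (Bring r) (phi r) (fps_nth (sigma_bar (phi r p)) n))"

definition sigma_hseq :: "nat \<Rightarrow> int \<Rightarrow> epoly poly" where
  "sigma_hseq r n = (\<Sum>j\<in>{0..n}. monom (hseq r (n - j)) (nat j))"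

definition fls_of_zinv :: "'a::comm_ring_1 poly \<Rightarrow> 'a fls" where
  "fls_of_zinv p = poly (map_poly fls_const p) fls_X_inv"


section \<open>Tensor products\<close>

text \<open>
  For subgroups \<open>A\<close> and \<open>B\<close> of abelian groups, \<open>A \<otimes> B\<close> is the free abelian group on \<open>A \<times> B\<close> modulo
  the subgroup generated by the biadditivity relations. Its elements are represented by formal
  sums, and equality in \<open>A \<otimes> B\<close> is the congruence \<open>tensor_eq A B\<close>.
\<close>

inductive_set tensor_rel :: "'a::ab_group_add set \<Rightarrow> 'b::ab_group_add set \<Rightarrow> ('a \<times> 'b \<Rightarrow>\<^sub>0 int) set"
  for A B where
  zero: "0 \<in> tensor_rel A B"
| left: "x \<in> A \<Longrightarrow> x' \<in> A \<Longrightarrow> y \<in> B \<Longrightarrow>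
    frag_of (x + x', y) - frag_of (x, y) - frag_of (x', y) \<in> tensor_rel A B"
| right: "x \<in> A \<Longrightarrow> y \<in> B \<Longrightarrow> y' \<in> B \<Longrightarrow>
    frag_of (x, y + y') - frag_of (x, y) - frag_of (x, y') \<in> tensor_rel A B"
| diff: "u \<in> tensor_rel A B \<Longrightarrow> v \<in> tensor_rel A B \<Longrightarrow> u - v \<in> tensor_rel A B"

definition tensor_eq ::
    "'a::ab_group_add set \<Rightarrow> 'b::ab_group_add set \<Rightarrow> ('a \<times> 'b \<Rightarrow>\<^sub>0 int) \<Rightarrow> ('a \<times> 'b \<Rightarrow>\<^sub>0 int) \<Rightarrow> bool" where
  "tensor_eq A B u v \<longleftrightarrow> u - v \<in> tensor_rel A B"

text \<open>
  The coefficient of \<open>z\<^sup>k\<close> is the sum of all \<open>f\<^sub>i \<otimes> g\<^bsub>k-i\<^esub>\<close>; outside the range of summation one of the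
  two factors vanishes.
\<close>

definition fls_tensor :: "'a::zero fls \<Rightarrow> 'b::zero fls \<Rightarrow> ('a \<times> 'b \<Rightarrow>\<^sub>0 int) fls" where
  "fls_tensor f g = Abs_fls (\<lambda>k.
     \<Sum>i\<in>{fls_subdegree f..k - fls_subdegree g}. frag_of (fls_nth f i, fls_nth g (k - i)))"

lemma fls_nth_fls_tensor:
  "fls_nth (fls_tensor f g) k =
     (\<Sum>i\<in>{fls_subdegree f..k - fls_subdegree g}. frag_of (fls_nth f i, fls_nth g (k - i)))"
  unfolding fls_tensor_def
  by (rule nth_Abs_fls_lower_bound[of "fls_subdegree f + fls_subdegree g"]) auto

end

theory Submission
  imports Defs
begin

text \<open>
  Put \<open>x = \<Sum> a\<^sub>\<lambda> [b]\<^sub>\<lambda>\<close>, and let \<open>\<beta>\<^sub>k\<close> be the contraction with the \<open>k\<close>-th coordinate function of \<open>M\<^sub>0\<close>.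
  The residue is, up to sign and the isomorphisms \<open>\<phi>\<close>, the Pluecker tensor \<open>\<Sum>\<^sub>k \<beta>\<^sub>k x \<otimes> (b\<^sub>k \<and> x)\<close>, because
  \<open>E\<^bsub>r-1\<^esub>(z) \<Delta>\<^sub>\<lambda>(\<sigma>\<^sub>-(z) H\<^bsub>r-1\<^esub>) = (-z)\<^bsup>r-1\<^esup> \<Sum>\<^sub>k z\<^bsup>-k\<^esup> \<beta>\<^sub>k [b]\<^sub>\<lambda>\<close> and
  \<open>E\<^bsub>r+1\<^esub>(z)\<^bsup>-1\<^esup> \<sigma>\<^sub>-(z)\<^bsup>-1\<^esup> \<Delta>\<^sub>\<mu>(H\<^bsub>r+1\<^esub>) = (-z)\<^bsup>-r\<^esup> \<Sum>\<^sub>k z\<^bsup>k\<^esup> b\<^sub>k \<and> [b]\<^sub>\<mu>\<close>.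
  Both identities are column operations on Schur determinants, since the vectors \<open>(h\<^sub>k, h\<^bsub>k-1\<^esub>, \<dots>)\<close> are
  moved to the next one by a companion matrix \<open>C\<close> with \<open>det (1 - z C) = E(z)\<close>.

  The tensor vanishes iff \<open>v \<and> x = 0\<close> for all vectors \<open>v = \<Sum>\<^sub>k \<eta>(\<beta>\<^sub>k x) b\<^sub>k\<close>, \<open>\<eta>\<close> an additive functional. If
  \<open>x \<noteq> 0\<close>, some such \<open>v\<close> is nonzero by Euler's identity \<open>\<Sum>\<^sub>k b\<^sub>k \<and> \<beta>\<^sub>k x = r x\<close>. Dividing \<open>v\<close> by its
  content gives a vector \<open>w\<close> and a functional \<open>\<alpha>\<close> with \<open>\<alpha>(w) = 1\<close> and \<open>w \<and> x = 0\<close>; hence \<open>x = w \<and> x'\<close>,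
  where \<open>x'\<close> is the contraction of \<open>x\<close> with \<open>\<alpha>\<close>. As \<open>x'\<close> satisfies the same condition, \<open>x\<close> is
  decomposable by induction on \<open>r\<close>.
\<close>

section \<open>Additive maps\<close>

lemma additive_compose: "additive f \<Longrightarrow> additive g \<Longrightarrow> additive (\<lambda>x. f (g x))"
  by (simp add: additive_def)

text \<open>Additive extension with values in an arbitrary ring, where \<open>frag_extend\<close>
  would only give formal sums; integers act through \<open>of_int\<close>.\<close>

definition frag_eval :: "('k \<Rightarrow> 'r::ring_1) \<Rightarrow> ('k \<Rightarrow>\<^sub>0 int) \<Rightarrow> 'r" where
  "frag_eval f c = (\<Sum>k\<in>Poly_Mapping.keys c. of_int (Poly_Mapping.lookup c k) * f k)"

lemma frag_eval_superset:
  assumes "finite S" "Poly_Mapping.keys c \<subseteq> S"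
  shows "frag_eval f c = (\<Sum>k\<in>S. of_int (Poly_Mapping.lookup c k) * f k)"
  unfolding frag_eval_def using assms by (intro sum.mono_neutral_left) (auto simp: in_keys_iff)

lemma additive_frag_eval: "additive (frag_eval f)"
proof
  fix c d :: "'a \<Rightarrow>\<^sub>0 int"
  let ?S = "Poly_Mapping.keys c \<union> Poly_Mapping.keys d"
  have "Poly_Mapping.keys (c + d) \<subseteq> ?S"
    by (rule keys_add)
  then show "frag_eval f (c + d) = frag_eval f c + frag_eval f d"
    by (simp add: frag_eval_superset[of ?S] lookup_add distrib_right sum.distrib)
qed

lemmas frag_eval_add = additive.add[OF additive_frag_eval]
  and frag_eval_diff = additive.diff[OF additive_frag_eval]
  and frag_eval_zero [simp] = additive.zero[OF additive_frag_eval]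

lemma frag_eval_of [simp]: "frag_eval f (frag_of k) = f k"
  by (simp add: frag_eval_def)

lemma frag_eval_mult:
  fixes f :: "'k::monoid_add \<Rightarrow> 'r::ring_1"
  assumes f: "\<And>a b. f (a + b) = f a * f b"
  shows "frag_eval f (c * d) = frag_eval f c * frag_eval f d"
proof (rule frag_induction[of c UNIV])
  show "frag_eval f (frag_of a * d) = frag_eval f (frag_of a) * frag_eval f d" for a
    by (rule frag_induction[of d UNIV])
      (simp_all add: mult_single f frag_eval_diff right_diff_distrib)
qed (simp_all add: frag_eval_diff left_diff_distrib)

lemma additive_of_int_mult:
  fixes f :: "'a::ring_1 \<Rightarrow> 'b::ring_1"
  assumes f: "additive f"
  shows "f (of_int n * x) = of_int n * f x"
  by (induction n rule: int_induct[where k = 0])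
    (simp_all add: additive.zero[OF f] additive.add[OF f] additive.diff[OF f] distrib_right left_diff_distrib)

lemma additive_frag_eval_commute:
  "additive g \<Longrightarrow> g (frag_eval f c) = frag_eval (\<lambda>k. g (f k)) c"
  by (simp add: frag_eval_def additive.sum additive_of_int_mult)

section \<open>Contractions in the exterior algebra\<close>

definition wedge :: "'m::ab_group_add list \<Rightarrow> 'm exterior" where
  "wedge ms = prod_list (map ext_incl ms)"

lemma wedge_simps [simp]:
  "wedge [] = 1" "wedge (m # ms) = ext_incl m * wedge ms" "wedge (ms @ ns) = wedge ms * wedge ns"
  by (simp_all add: wedge_def)

lemma wedge_letters: "wedge (letters w) = abs_exterior (frag_of w)"
proof (induction "letters w" arbitrary: w)
  case Nil
  then have "w = 0"
    by (simp add: zero_fword_def fword.expand)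
  then show ?case
    by (simp add: one_exterior_def zero_fword_def flip: single_one)
next
  case (Cons m ms)
  have w: "w = FWord (m # ms)"
    using Cons.hyps(2) by (cases w) simp
  have "frag_of w = free_gen m * frag_of (FWord ms)"
    by (simp add: w free_gen_def mult_single plus_fword_def)
  then have "abs_exterior (frag_of w) = ext_incl m * abs_exterior (frag_of (FWord ms))"
    by (simp add: ext_incl.abs_eq times_exterior.abs_eq)
  then show ?case
    using Cons.hyps(1)[of "FWord ms"] by (simp add: w)
qed

text \<open>Wedges are the classes of the words, which form a basis of the free ring. This induction
  suits maps that are additive without being multiplicative.\<close>

lemma exterior_induct [case_names wedge diff]:
  assumes wedge: "\<And>ms. P (wedge ms)" and diff: "\<And>x y. P x \<Longrightarrow> P y \<Longrightarrow> P (x - y)"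
  shows "P x"
proof -
  have "P (abs_exterior u)" for u
  proof (rule frag_induction[of u UNIV])
    show "P (abs_exterior 0)"
      using diff[OF wedge wedge, of "[]" "[]"] by (simp flip: zero_exterior_def)
    show "P (abs_exterior (frag_of w))" for w
      using wedge[of "letters w"] by (simp add: wedge_letters)
    show "P (abs_exterior (a - b))" if "P (abs_exterior a)" "P (abs_exterior b)" for a b
      using diff[OF that] by (simp flip: minus_exterior.abs_eq)
  qed simp
  then show ?thesis
    by (metis Quotient3_abs_rep[OF Quotient3_exterior])
qed

definition multi_alt :: "('m::ab_group_add list \<Rightarrow> 'r::ab_group_add) \<Rightarrow> bool" where
  "multi_alt D \<longleftrightarrow> (\<forall>u m n v. D (u @ (m + n) # v) = D (u @ m # v) + D (u @ n # v)) \<and>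
     (\<forall>u m v. D (u @ m # m # v) = 0)"

definition ext_lift :: "('m::ab_group_add list \<Rightarrow> 'r::ring_1) \<Rightarrow> 'm exterior \<Rightarrow> 'r" where
  "ext_lift D = (SOME F. additive F \<and> (\<forall>ms. F (wedge ms) = D ms))"

text \<open>The additive counterpart of \<open>alg_hom_exterior_exists\<close>, for maps such as
  contractions that are not ring homomorphisms. The extension \<open>G\<close> to the free ring
  kills the ideal because it kills each generator placed between two words.\<close>

lemma ext_lift_exists:
  fixes D :: "'m::ab_group_add list \<Rightarrow> 'r::ring_1"
  assumes D: "multi_alt D"
  shows "\<exists>F. additive F \<and> (\<forall>ms. F (wedge ms) = D ms)"
proof -
  define G where "G = frag_eval (\<lambda>w. D (letters w))"
  have G_simps [simp]: "G 0 = 0" "G (x + y) = G x + G y" "G (x - y) = G x - G y"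
    "G (frag_of w) = D (letters w)" for x y w
    by (simp_all add: G_def frag_eval_add frag_eval_diff)
  have G_sandwich: "G (a * t * b) = 0"
    if t: "\<And>u v. G (frag_of u * t * frag_of v) = 0" for a b t
  proof (rule frag_induction[of a UNIV])
    show "G (frag_of u * t * b) = 0" for u
      by (rule frag_induction[of b UNIV]) (simp_all add: t right_diff_distrib)
  qed (simp_all add: left_diff_distrib)
  \<comment> \<open>The induction carries arbitrary outer factors, into which the factors from
    \<open>left\<close> and \<open>right\<close> are absorbed.\<close>
  have G_ideal: "G (a * x * b) = 0" if "x \<in> ext_ideal" for x a b
    using that
  proof (induction arbitrary: a b rule: ext_ideal.induct)
    case (additive m n)
    show ?case
    proof (rule G_sandwich)
      fix u v
      have "D (letters u @ (m + n) # letters v) =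
          D (letters u @ m # letters v) + D (letters u @ n # letters v)"
        using D by (simp add: multi_alt_def)
      then show "G (frag_of u * (free_gen (m + n) - free_gen m - free_gen n) * frag_of v) = 0"
        by (simp add: left_diff_distrib right_diff_distrib free_gen_def mult_single plus_fword_def)
    qed
  next
    case (square m)
    show ?case
    proof (rule G_sandwich)
      fix u v
      have "D (letters u @ m # m # letters v) = 0"
        using D by (simp add: multi_alt_def)
      then show "G (frag_of u * (free_gen m * free_gen m) * frag_of v) = 0"
        by (simp add: free_gen_def mult_single plus_fword_def)
    qed
  next
    case (plus x y)
    then show ?case by (simp add: distrib_left distrib_right)
  next
    case (left x y)
    from left.IH[of "a * y" b] show ?case by (simp add: mult.assoc)
  next
    case (right x y)
    from right.IH[of a "y * b"] show ?case by (simp add: mult.assoc)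
  qed
  define F where "F x = G (rep_exterior x)" for x
  have F_abs: "F (abs_exterior x) = G x" for x
  proof -
    have "rep_exterior (abs_exterior x) - x \<in> ext_ideal"
      using Quotient3_rep_abs[OF Quotient3_exterior, of x] by (simp add: ext_ideal_zero)
    from G_ideal[OF this, of 1 1] show ?thesis
      by (simp add: F_def)
  qed
  have "F (x + y) = F x + F y" for x y
  proof -
    obtain u v where "x = abs_exterior u" "y = abs_exterior v"
      by (metis Quotient3_abs_rep[OF Quotient3_exterior])
    then show ?thesis
      by (simp add: plus_exterior.abs_eq F_abs)
  qed
  moreover have "F (wedge ms) = D ms" for ms
    using F_abs[of "frag_of (FWord ms)"] by (simp flip: wedge_letters)
  ultimately show ?thesis
    by (intro exI[of _ F]) (simp add: additive_def)
qed

lemma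
  assumes "multi_alt D"
  shows additive_ext_lift: "additive (ext_lift D)" and ext_lift_wedge: "ext_lift D (wedge ms) = D ms"
  using someI_ex[OF ext_lift_exists[OF assms]] by (simp_all add: ext_lift_def)

section \<open>Interior products\<close>

lemma ext_incl_mult_of_int: "ext_incl m * (of_int n * x) = of_int n * (ext_incl m * x)"
  by (metis mult.assoc mult_of_int_commute)

lemma ext_incl_mult_mult:
  "ext_incl m * (ext_incl m * x) = 0" "ext_incl m * (ext_incl n * x) = - (ext_incl n * (ext_incl m * x))"
proof -
  show "ext_incl m * (ext_incl m * x) = 0"
    by (simp add: ext_incl_square flip: mult.assoc)
  have "ext_incl m * ext_incl n = - (ext_incl n * ext_incl m)"
    using ext_incl_anticomm[of m n] by (simp add: eq_neg_iff_add_eq_0)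
  from arg_cong[OF this, of "\<lambda>y. y * x"]
  show "ext_incl m * (ext_incl n * x) = - (ext_incl n * (ext_incl m * x))"
    by (simp add: mult.assoc)
qed

lemma ext_incl_mult_wedge_eq_0: "m \<in> set ms \<Longrightarrow> ext_incl m * wedge ms = 0"
proof (induction ms)
  case (Cons a ms)
  then show ?case
    by (cases "m = a") (simp_all add: ext_incl_mult_mult(1) ext_incl_mult_mult(2)[of m a])
qed simp

lemma additive_ext_incl: "additive ext_incl"
  by (simp add: additive_def ext_incl_add)

text \<open>The recursion is the antiderivation rule of the interior product with
  \<open>\<alpha>\<close>.\<close>

fun contr_list :: "('m::ab_group_add \<Rightarrow> int) \<Rightarrow> 'm list \<Rightarrow> 'm exterior" where
  "contr_list \<alpha> [] = 0"
| "contr_list \<alpha> (m # ms) = of_int (\<alpha> m) * wedge ms - ext_incl m * contr_list \<alpha> ms"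

lemma multi_alt_contr_list:
  assumes \<alpha>: "additive \<alpha>"
  shows "multi_alt (contr_list \<alpha>)"
proof -
  have "contr_list \<alpha> (u @ (m + n) # v) = contr_list \<alpha> (u @ m # v) + contr_list \<alpha> (u @ n # v)" for u m n v
    by (induction u)
      (simp_all add: additive.add[OF \<alpha>] ext_incl_add algebra_simps)
  moreover have "contr_list \<alpha> (u @ m # m # v) = 0" for u m v
    by (induction u) (simp_all add: right_diff_distrib ext_incl_mult_mult(1) ext_incl_mult_of_int)
  ultimately show ?thesis
    by (simp add: multi_alt_def)
qed

definition contr :: "('m::ab_group_add \<Rightarrow> int) \<Rightarrow> 'm exterior \<Rightarrow> 'm exterior" where
  "contr \<alpha> = ext_lift (contr_list \<alpha>)"

lemma additive_contr: "additive \<alpha> \<Longrightarrow> additive (contr \<alpha>)"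
  and contr_wedge: "additive \<alpha> \<Longrightarrow> contr \<alpha> (wedge ms) = contr_list \<alpha> ms"
  by (simp_all add: contr_def additive_ext_lift ext_lift_wedge multi_alt_contr_list)

lemma contr_ext_incl_mult:
  assumes \<alpha>: "additive \<alpha>"
  shows "contr \<alpha> (ext_incl m * x) = of_int (\<alpha> m) * x - ext_incl m * contr \<alpha> x"
proof (induction x rule: exterior_induct)
  case (wedge ms)
  then show ?case
    using contr_wedge[OF \<alpha>, of "m # ms"] by (simp add: contr_wedge[OF \<alpha>])
next
  case (diff x y)
  then show ?case
    by (simp add: right_diff_distrib additive.diff[OF additive_contr[OF \<alpha>]])
qed

lemma contr_one: "additive \<alpha> \<Longrightarrow> contr \<alpha> 1 = 0"
  using contr_wedge[of \<alpha> "[]"] by simp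

lemma contr_anticommute:
  assumes \<alpha>: "additive \<alpha>" and \<beta>: "additive \<beta>"
  shows "contr \<alpha> (contr \<beta> x) = - contr \<beta> (contr \<alpha> x)"
proof (induction x rule: exterior_induct)
  case (wedge ms)
  show ?case
    by (induction ms)
      (simp_all add: \<alpha> \<beta> right_diff_distrib additive.diff additive.zero additive_contr contr_one
        contr_ext_incl_mult additive_of_int_mult)
next
  case (diff x y)
  then show ?case
    by (simp add: \<alpha> \<beta> additive.diff additive_contr)
qed

text \<open>Anticommutativity with equal functionals would only make twice this element vanish, so
  the induction is carried out separately.\<close>

lemma contr_contr:
  assumes \<alpha>: "additive \<alpha>"
  shows "contr \<alpha> (contr \<alpha> x) = 0"
proof (induction x rule: exterior_induct)
  case (wedge ms)
  show ?case
    by (induction ms)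
      (simp_all add: \<alpha> additive.diff additive.zero additive_contr contr_one contr_ext_incl_mult
        additive_of_int_mult)
next
  case (diff x y)
  then show ?case
    by (simp add: \<alpha> additive.diff additive_contr)
qed

text \<open>Unfolded, the j-th entry receives (-1)^j times the value of \<open>\<eta>\<close> at the
  wedge of the other entries; the entries already passed are absorbed into the functional.\<close>

fun covec_list :: "(M0 exterior \<Rightarrow> int) \<Rightarrow> M0 list \<Rightarrow> M0" where
  "covec_list \<eta> [] = 0"
| "covec_list \<eta> (m # ms) = frag_cmul (\<eta> (wedge ms)) m - covec_list (\<lambda>x. \<eta> (ext_incl m * x)) ms"

lemma multi_alt_covec_list:
  assumes \<eta>: "additive \<eta>"
  shows "multi_alt (covec_list \<eta>)"
proof -
  \<comment> \<open>The recursion changes the functional, so additivity in the functional is used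
    along with additivity in the list.\<close>
  have plus: "covec_list (\<lambda>x. \<eta> x + \<theta> x) ms = covec_list \<eta> ms + covec_list \<theta> ms" for \<eta> \<theta> ms
    by (induction ms arbitrary: \<eta> \<theta>) (simp_all add: frag_cmul_distrib)
  have uminus: "covec_list (\<lambda>x. - \<eta> x) ms = - covec_list \<eta> ms" for \<eta> ms
    by (induction ms arbitrary: \<eta>) (simp_all)
  have zero: "covec_list (\<lambda>x. 0) ms = 0" for ms
    by (induction ms) (simp_all)
  have "additive \<eta> \<Longrightarrow> covec_list \<eta> (u @ (m + n) # v) = covec_list \<eta> (u @ m # v) + covec_list \<eta> (u @ n # v)" for u m n v
  proof (induction u arbitrary: \<eta>)
    case Nil
    then show ?case
      by (simp add: additive.add[OF Nil] distrib_right ext_incl_add plus frag_cmul_distrib2)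
  next
    case (Cons a u)
    have "additive (\<lambda>x. \<eta> (ext_incl a * x))"
      using Cons.prems by (simp add: additive_def distrib_left)
    from Cons.IH[OF this] show ?case
      by (simp add: additive.add[OF Cons.prems] ext_incl_add distrib_left distrib_right frag_cmul_distrib)
  qed
  moreover have "additive \<eta> \<Longrightarrow> covec_list \<eta> (u @ m # m # v) = 0" for u m v
  proof (induction u arbitrary: \<eta>)
    case Nil
    then show ?case
      by (simp add: ext_incl_mult_mult(1) additive.zero zero)
  next
    case (Cons a u)
    have "additive (\<lambda>x. \<eta> (ext_incl a * x))"
      using Cons.prems by (simp add: additive_def distrib_left)
    from Cons.IH[OF this] show ?case
      by (simp add: ext_incl_mult_mult(1) additive.zero[OF Cons.prems])
  qed
  ultimately show ?thesis
    using \<eta> by (simp add: multi_alt_def)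
qed

text \<open>\<open>ext_lift\<close> applies because \<open>M0\<close>, as a type of finitely
  supported functions on the natural numbers, is a ring under convolution.\<close>

definition covec :: "(M0 exterior \<Rightarrow> int) \<Rightarrow> M0 exterior \<Rightarrow> M0" where
  "covec \<eta> = ext_lift (covec_list \<eta>)"

lemma additive_covec: "additive \<eta> \<Longrightarrow> additive (covec \<eta>)"
  and covec_wedge: "additive \<eta> \<Longrightarrow> covec \<eta> (wedge ms) = covec_list \<eta> ms"
  by (simp_all add: covec_def additive_ext_lift ext_lift_wedge multi_alt_covec_list)

lemma additive_frag_cmul:
  fixes f :: "('a \<Rightarrow>\<^sub>0 int) \<Rightarrow> 'b::ring_1"
  assumes f: "additive f"
  shows "f (frag_cmul n m) = of_int n * f m"
  by (induction n rule: int_induct[where k = 0])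
    (simp_all add: frag_cmul_distrib frag_cmul_diff_distrib additive.zero[OF f] additive.add[OF f]
      additive.diff[OF f] distrib_right left_diff_distrib)

text \<open>The recursions of \<open>covec_list\<close> and \<open>contr_list\<close> correspond
  term by term. With coordinate functionals for \<open>\<alpha>\<close>, identities between
  covectors reduce to identities between contractions.\<close>

lemma covec_pairing:
  assumes \<alpha>: "additive \<alpha>" and \<eta>: "additive \<eta>"
  shows "\<alpha> (covec \<eta> x) = \<eta> (contr \<alpha> x)"
proof (induction x rule: exterior_induct)
  case (wedge ms)
  show ?case
    unfolding covec_wedge[OF \<eta>] contr_wedge[OF \<alpha>]
    using \<eta>
  proof (induction ms arbitrary: \<eta>)
    case Nil
    then show ?case
      using \<alpha> by (simp add: additive.zero)
  next
    case (Cons m ms)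
    have "additive (\<lambda>x. \<eta> (ext_incl m * x))"
      using Cons.prems by (simp add: additive_def distrib_left)
    from Cons.IH[OF this] show ?case
      using \<alpha> Cons.prems by (simp add: additive.diff additive_frag_cmul additive_of_int_mult)
  qed
next
  case (diff x y)
  then show ?case
    using assms by (simp add: additive.diff additive_contr additive_covec)
qed

lemma additive_lookup: "additive (\<lambda>m. Poly_Mapping.lookup m k)"
  by (simp add: additive_def lookup_add)

text \<open>
  \<open>covec \<eta> x\<close> is the image of \<open>\<Sum>\<^sub>k \<beta>\<^sub>k x \<otimes> b\<^sub>k\<close> under \<open>\<eta> \<otimes> id\<close>.
\<close>

definition plucker :: "M0 exterior \<Rightarrow> bool" where
  "plucker x \<longleftrightarrow> (\<forall>\<eta>. additive \<eta> \<longrightarrow> ext_incl (covec \<eta> x) * x = 0)"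

text \<open>The covector of a wedge is an integral combination of its entries, and each entry
  annihilates the wedge. The induction keeps the annihilated element fixed while the list
  shrinks.\<close>

lemma plucker_wedge: "plucker (wedge ms)"
proof -
  have "ext_incl (covec_list \<eta> ns) * x = 0" if "additive \<eta>" "\<And>m. m \<in> set ns \<Longrightarrow> ext_incl m * x = 0" for \<eta> ns x
    using that
  proof (induction ns arbitrary: \<eta>)
    case Nil
    then show ?case
      by (simp add: ext_incl_zero)
  next
    case (Cons m ns)
    have "additive (\<lambda>x. \<eta> (ext_incl m * x))"
      using Cons.prems by (simp add: additive_def distrib_left)
    then show ?case
      using Cons by (simp add: ext_incl_diff additive_frag_cmul[OF additive_ext_incl] left_diff_distrib mult.assoc)
  qed
  then show ?thesis
    by (simp add: plucker_def covec_wedge ext_incl_mult_wedge_eq_0)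
qed

text \<open>Contracting v \<and> x = 0 with \<open>\<alpha>\<close> gives the factorization. For the
  second claim, anticommutativity identifies the covector w of the contraction with minus a covector
  of x, so w \<and> x = 0. Contracting this with \<open>\<alpha>\<close> leaves only the desired
  product, since \<open>\<alpha>\<close> applied twice is 0 and hence takes w to 0.\<close>

lemma plucker_contr:
  assumes x: "plucker x" and v: "ext_incl v * x = 0" and \<alpha>: "additive \<alpha>" "\<alpha> v = 1"
  shows "x = ext_incl v * contr \<alpha> x" and "plucker (contr \<alpha> x)"
proof -
  show "x = ext_incl v * contr \<alpha> x"
    using contr_ext_incl_mult[OF \<alpha>(1), of v x] v \<alpha> by (simp add: additive.zero[OF additive_contr])
  show "plucker (contr \<alpha> x)"
    unfolding plucker_def
  proof (intro allI impI)
    fix \<eta> :: "M0 exterior \<Rightarrow> int"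
    assume \<eta>: "additive \<eta>"
    let ?w = "covec \<eta> (contr \<alpha> x)"
    have \<eta>\<alpha>: "additive (\<lambda>x. \<eta> (contr \<alpha> x))"
      by (rule additive_compose[OF \<eta> additive_contr[OF \<alpha>(1)]])
    have "?w = - covec (\<lambda>x. \<eta> (contr \<alpha> x)) x"
    proof (rule poly_mapping_eqI)
      fix k
      let ?l = "\<lambda>m :: M0. Poly_Mapping.lookup m k"
      have "?l ?w = \<eta> (contr ?l (contr \<alpha> x))"
        by (rule covec_pairing[OF additive_lookup \<eta>])
      also have "\<dots> = - \<eta> (contr \<alpha> (contr ?l x))"
        by (subst contr_anticommute[OF additive_lookup \<alpha>(1)]) (simp add: additive.minus[OF \<eta>])
      also have "\<dots> = - ?l (covec (\<lambda>x. \<eta> (contr \<alpha> x)) x)"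
        using covec_pairing[OF additive_lookup \<eta>\<alpha>] by simp
      finally show "?l ?w = ?l (- covec (\<lambda>x. \<eta> (contr \<alpha> x)) x)"
        by simp
    qed
    then have "ext_incl ?w * x = 0"
      using x \<eta>\<alpha> by (simp add: plucker_def additive.minus[OF additive_ext_incl])
    then have "of_int (\<alpha> ?w) * x - ext_incl ?w * contr \<alpha> x = 0"
      using contr_ext_incl_mult[OF \<alpha>(1), of ?w x] by (simp add: additive.zero[OF additive_contr[OF \<alpha>(1)]])
    moreover have "\<alpha> ?w = 0"
      by (simp add: covec_pairing[OF \<alpha>(1) \<eta>] contr_contr[OF \<alpha>(1)] additive.zero[OF \<eta>])
    ultimately show "ext_incl ?w * contr \<alpha> x = 0"
      by simp
  qed
qed

text \<open>Let d be the least positive value at v of an additive functional. If d failed to divide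
  a coordinate, subtracting a multiple of the minimal functional from that coordinate would produce
  the smaller positive remainder. So v is d times a vector on which the minimal functional is
  1.\<close>

lemma primitive_vector:
  fixes v :: M0
  assumes "v \<noteq> 0"
  obtains g v0 and \<alpha> :: "M0 \<Rightarrow> int" where "g \<noteq> 0" "v = frag_cmul g v0" "additive \<alpha>" "\<alpha> v0 = 1"
proof -
  define P where "P d \<longleftrightarrow> d > 0 \<and> (\<exists>\<alpha>. additive \<alpha> \<and> \<alpha> v = int d)" for d
  obtain k where k: "Poly_Mapping.lookup v k \<noteq> 0"
    using assms by (metis poly_mapping_eqI lookup_zero)
  \<comment> \<open>A nonzero coordinate, corrected by its sign, is a functional with a positive
    value, so a least one exists.\<close>
  have "additive (\<lambda>m. sgn (Poly_Mapping.lookup v k) * Poly_Mapping.lookup m k)"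
    by (simp add: additive_def lookup_add distrib_left)
  moreover have "sgn (Poly_Mapping.lookup v k) * Poly_Mapping.lookup v k = int (nat \<bar>Poly_Mapping.lookup v k\<bar>)"
    by (cases "Poly_Mapping.lookup v k" "0 :: int" rule: linorder_cases) simp_all
  ultimately have "P (nat \<bar>Poly_Mapping.lookup v k\<bar>)"
    unfolding P_def using k
    by (intro conjI exI[of _ "\<lambda>m. sgn (Poly_Mapping.lookup v k) * Poly_Mapping.lookup m k"]) simp_all
  then have Pd: "P (LEAST d. P d)"
    by (rule LeastI)
  have min: "(LEAST d. P d) \<le> d" if "P d" for d
    using that by (rule Least_le)
  define d where "d = (LEAST d. P d)"
  obtain \<alpha> where \<alpha>: "additive \<alpha>" "\<alpha> v = int d" and d: "d > 0"
    using Pd by (auto simp: P_def d_def)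
  have dvd: "int d dvd Poly_Mapping.lookup v k" for k
  proof (rule ccontr)
    assume *: "\<not> ?thesis"
    let ?q = "Poly_Mapping.lookup v k div int d"
    have "additive (\<lambda>m. Poly_Mapping.lookup m k - ?q * \<alpha> m)"
      by (simp add: additive_def lookup_add distrib_left additive.add[OF \<alpha>(1)])
    moreover have "Poly_Mapping.lookup v k - ?q * \<alpha> v = int (nat (Poly_Mapping.lookup v k mod int d))"
      using d by (simp add: \<alpha> minus_div_mult_eq_mod)
    moreover have "Poly_Mapping.lookup v k mod int d > 0"
      using * d by (metis dvd_eq_mod_eq_0 of_nat_0_less_iff pos_mod_sign order_le_less)
    ultimately have "P (nat (Poly_Mapping.lookup v k mod int d))"
      unfolding P_def
      by (intro conjI exI[of _ "\<lambda>m. Poly_Mapping.lookup m k - ?q * \<alpha> m"]) simp_all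
    then have "d \<le> nat (Poly_Mapping.lookup v k mod int d)"
      using min d_def by simp
    moreover have "Poly_Mapping.lookup v k mod int d < int d"
      using d by simp
    ultimately show False
      using d by linarith
  qed
  define v0 where "v0 = Poly_Mapping.map (\<lambda>c. c div int d) v"
  have v: "v = frag_cmul (int d) v0"
    using dvd by (intro poly_mapping_eqI) (simp add: v0_def map.rep_eq when_def)
  have "int d * \<alpha> v0 = int d"
    using \<alpha>(2) by (subst (asm) v) (simp add: additive_frag_cmul[OF \<alpha>(1)])
  then have "\<alpha> v0 = 1"
    using d by simp
  then show thesis
    using that[of "int d" v0 \<alpha>] v \<alpha> d by simp
qed

text \<open>The exterior power of degree r as a subgroup of the whole algebra. Closure under
  differences makes it a subgroup and matches the induction rules.\<close>

inductive_set ext_pow :: "nat \<Rightarrow> M0 exterior set" for r where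
  wedge: "length ms = r \<Longrightarrow> wedge ms \<in> ext_pow r"
| diff: "x \<in> ext_pow r \<Longrightarrow> y \<in> ext_pow r \<Longrightarrow> x - y \<in> ext_pow r"

lemma ext_pow_zero: "0 \<in> ext_pow r"
  using ext_pow.diff[OF ext_pow.wedge ext_pow.wedge, of "replicate r 0" r "replicate r 0"] by simp

lemma ext_pow_uminus: "x \<in> ext_pow r \<Longrightarrow> - x \<in> ext_pow r"
  using ext_pow.diff[OF ext_pow_zero, of x r] by simp

lemma ext_pow_add: "x \<in> ext_pow r \<Longrightarrow> y \<in> ext_pow r \<Longrightarrow> x + y \<in> ext_pow r"
  using ext_pow.diff[of x r "- y"] ext_pow_uminus by fastforce

lemma ext_pow_sum: "(\<And>i. i \<in> S \<Longrightarrow> f i \<in> ext_pow r) \<Longrightarrow> sum f S \<in> ext_pow r"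
  by (induction S rule: infinite_finite_induct) (auto intro: ext_pow_zero ext_pow_add)

lemma ext_pow_of_int_mult: "x \<in> ext_pow r \<Longrightarrow> of_int n * x \<in> ext_pow r"
proof (induction n rule: int_induct[where k = 0])
  case base
  then show ?case by (simp add: ext_pow_zero)
qed (simp_all add: distrib_right left_diff_distrib ext_pow_add ext_pow.diff)

lemma ext_incl_mult_ext_pow: "x \<in> ext_pow r \<Longrightarrow> ext_incl m * x \<in> ext_pow (Suc r)"
proof (induction rule: ext_pow.induct)
  case (wedge ms)
  then show ?case
    using ext_pow.wedge[of "m # ms" "Suc r"] by simp
qed (simp add: right_diff_distrib ext_pow.diff)

lemma contr_ext_pow:
  assumes \<alpha>: "additive \<alpha>" and "x \<in> ext_pow (Suc r)"
  shows "contr \<alpha> x \<in> ext_pow r"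
  using assms(2)
proof (induction rule: ext_pow.induct)
  case (wedge ms)
  then show ?case
    unfolding contr_wedge[OF \<alpha>]
  proof (induction r arbitrary: ms)
    case 0
    then obtain m where "ms = [m]"
      by (auto simp: length_Suc_conv)
    then show ?case
      using ext_pow_of_int_mult[OF ext_pow.wedge, of "[]" 0 "\<alpha> m"] by simp
  next
    case (Suc r)
    then obtain m ns where ms: "ms = m # ns" "length ns = Suc r"
      by (auto simp: length_Suc_conv)
    then show ?case
      using Suc.IH[OF ms(2)]
      by (simp add: ext_pow.diff ext_pow_of_int_mult ext_pow.wedge ext_incl_mult_ext_pow)
  qed
qed (simp add: additive.diff[OF additive_contr[OF \<alpha>]] ext_pow.diff)

lemma ext_incl_eq_sum:
  fixes m :: M0
  assumes "Poly_Mapping.keys m \<subseteq> {..<n}"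
  shows "ext_incl m = (\<Sum>k<n. of_int (Poly_Mapping.lookup m k) * ext_incl (frag_of k))"
proof -
  have "m = (\<Sum>k\<in>Poly_Mapping.keys m. frag_cmul (Poly_Mapping.lookup m k) (frag_of k))"
    using frag_expansion[of m] by (simp add: frag_extend_def)
  also have "\<dots> = (\<Sum>k<n. frag_cmul (Poly_Mapping.lookup m k) (frag_of k))"
    using assms by (intro sum.mono_neutral_left) (auto simp: in_keys_iff)
  finally show ?thesis
    by (metis (no_types, lifting) additive.sum[OF additive_ext_incl] additive_frag_cmul[OF additive_ext_incl] sum.cong)
qed

abbreviation contr_basis :: "nat \<Rightarrow> M0 exterior \<Rightarrow> M0 exterior" where
  "contr_basis k \<equiv> contr (\<lambda>m. Poly_Mapping.lookup m k)"

text \<open>The sum over all k has finite support and is expressed by its eventually constant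
  partial sums. Prefixing a vector m adds one copy of the wedge, from the terms with the coordinates
  of m, and moves past the other terms with two cancelling signs.\<close>

lemma euler_identity:
  assumes "x \<in> ext_pow r"
  shows "\<exists>N. \<forall>n\<ge>N. (\<Sum>k<n. ext_incl (frag_of k) * contr_basis k x) = of_nat r * x"
  using assms
proof (induction rule: ext_pow.induct)
  case (wedge ms)
  then show ?case
  proof (induction ms arbitrary: r)
    case Nil
    then show ?case
      by (simp add: contr_one[OF additive_lookup])
  next
    case (Cons m ms)
    then obtain N where N: "\<And>n. n \<ge> N \<Longrightarrow>
        (\<Sum>k<n. ext_incl (frag_of k) * contr_basis k (wedge ms)) = of_nat (length ms) * wedge ms"
      by blast
    obtain N' where N': "Poly_Mapping.keys m \<subseteq> {..<N'}"
      using finite_nat_iff_bounded[of "Poly_Mapping.keys m"] by auto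
    have "(\<Sum>k<n. ext_incl (frag_of k) * contr_basis k (wedge (m # ms))) = of_nat r * wedge (m # ms)"
      if n: "n \<ge> max N N'" for n
    proof -
      have "ext_incl (frag_of k) * contr_basis k (wedge (m # ms)) =
          of_int (Poly_Mapping.lookup m k) * ext_incl (frag_of k) * wedge ms +
          ext_incl m * (ext_incl (frag_of k) * contr_basis k (wedge ms))" for k
        by (simp add: contr_ext_incl_mult[OF additive_lookup] right_diff_distrib
            ext_incl_mult_mult(2)[of "frag_of k" m] ext_incl_mult_of_int mult.assoc)
      then have "(\<Sum>k<n. ext_incl (frag_of k) * contr_basis k (wedge (m # ms))) =
          (\<Sum>k<n. of_int (Poly_Mapping.lookup m k) * ext_incl (frag_of k)) * wedge ms +
          ext_incl m * (\<Sum>k<n. ext_incl (frag_of k) * contr_basis k (wedge ms))"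
        by (simp add: sum_distrib_left sum_distrib_right sum.distrib)
      also have "(\<Sum>k<n. of_int (Poly_Mapping.lookup m k) * ext_incl (frag_of k)) = ext_incl m"
        using N' n by (intro ext_incl_eq_sum[symmetric]) auto
      also have "(\<Sum>k<n. ext_incl (frag_of k) * contr_basis k (wedge ms)) = of_nat (length ms) * wedge ms"
        using N n by simp
      finally show ?thesis
        using Cons.prems ext_incl_mult_of_int[of m "int (length ms)"] by (auto simp: distrib_right)
    qed
    then show ?case by blast
  qed
next
  case (diff x y)
  then obtain N N' where
    "\<And>n. n \<ge> N \<Longrightarrow> (\<Sum>k<n. ext_incl (frag_of k) * contr_basis k x) = of_nat r * x"
    "\<And>n. n \<ge> N' \<Longrightarrow> (\<Sum>k<n. ext_incl (frag_of k) * contr_basis k y) = of_nat r * y"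
    by blast
  then have "\<forall>n\<ge>max N N'. (\<Sum>k<n. ext_incl (frag_of k) * contr_basis k (x - y)) = of_nat r * (x - y)"
    by (simp add: additive.diff[OF additive_contr[OF additive_lookup]] right_diff_distrib sum_subtractf)
  then show ?case by blast
qed

section \<open>Determinants given by their rows\<close>

text \<open>Lists of rows parallel the lists of vectors in \<open>wedge\<close>. Rows are infinite
  sequences, truncated to the size of the list.\<close>

definition rdet :: "(nat \<Rightarrow> 'a::comm_ring_1) list \<Rightarrow> 'a" where
  "rdet cs = det (mat (length cs) (length cs) (\<lambda>(i, j). (cs ! i) j))"

lemma rdet_cong:
  assumes "length cs = length ds"
    "\<And>i j. i < length cs \<Longrightarrow> j < length cs \<Longrightarrow> (cs ! i) j = (ds ! i) j"
  shows "rdet cs = rdet ds"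
  unfolding rdet_def using assms by (intro arg_cong[of _ _ det] eq_matI) auto

lemma rdet_Nil [simp]: "rdet [] = 1"
  by (simp add: rdet_def)

text \<open>Laplace expansion along one row, with each cofactor written as the determinant whose row
  is a unit vector, so that the formula stays within \<open>rdet\<close>.\<close>

lemma rdet_row_expand:
  "rdet (u @ x # v) =
     (\<Sum>j<Suc (length u + length v). x j * rdet (u @ (\<lambda>i. if i = j then 1 else 0) # v))"
proof -
  define n where "n = Suc (length u + length v)"
  define M where "M x = mat n n (\<lambda>(i, j). ((u @ x # v) ! i) j)" for x :: "nat \<Rightarrow> 'a"
  define C where "C j = cofactor (M (\<lambda>_. 0)) (length u) j" for j
  have M: "M x \<in> carrier_mat n n" for x
    by (simp add: M_def)
  have rdet: "rdet (u @ x # v) = det (M x)" for x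
    by (simp add: rdet_def M_def n_def)
  have len: "length u < n"
    by (simp add: n_def)
  have entry: "M x $$ (i, j) = M (\<lambda>_. 0) $$ (i, j)" if "i < n" "j < n" "i \<noteq> length u" for x i j
    using that by (auto simp: M_def nth_append nth_Cons split: nat.split)
  have row: "M x $$ (length u, j) = x j" if "j < n" for x j
    using that len by (simp add: M_def)
  have cof: "cofactor (M x) (length u) j = C j" if "j < n" for x j
    unfolding C_def cofactor_def mat_delete_def
    using that len M carrier_matD[OF M]
    by (intro arg_cong2[of _ _ _ _ "(*)"] refl arg_cong[of _ _ det] cong_mat) (auto intro!: entry)
  have expand: "det (M x) = (\<Sum>j<n. x j * C j)" for x
    using laplace_expansion_row[OF M len] by (simp add: row cof)
  have "C j = rdet (u @ (\<lambda>i. if i = j then 1 else 0) # v)" if "j < n" for j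
  proof -
    have "det (M (\<lambda>i. if i = j then 1 else 0)) = (\<Sum>k<n. if k = j then C k else 0)"
      unfolding expand by (rule sum.cong) auto
    then show ?thesis
      using that by (simp add: rdet)
  qed
  then show ?thesis
    by (simp add: rdet expand flip: n_def)
qed

lemma rdet_row_linear:
  "rdet (u @ (\<lambda>i. a * x i + b * y i) # v) = a * rdet (u @ x # v) + b * rdet (u @ y # v)"
  by (subst (1 2 3) rdet_row_expand)
    (simp only: sum_distrib_left distrib_right mult.assoc sum.distrib)

lemma rdet_identical_rows: "rdet (u @ x # x # v) = 0"
proof -
  define n where "n = Suc (Suc (length u + length v))"
  let ?M = "mat n n (\<lambda>(i, j). ((u @ x # x # v) ! i) j)"
  have "det ?M = 0"
    by (rule det_identical_rows[of _ n "length u" "Suc (length u)"])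
      (auto simp: n_def nth_append intro!: eq_vecI)
  then show ?thesis
    by (simp add: rdet_def n_def)
qed

lemma rdet_mult:
  assumes n: "length cs = n"
  shows "rdet (map (\<lambda>c i. \<Sum>j<n. c j * A j i) cs) = rdet cs * det (mat n n (\<lambda>(j, i). A j i))"
proof -
  let ?M = "mat n n (\<lambda>(i, j). (cs ! i) j)" and ?A = "mat n n (\<lambda>(j, i). A j i)"
  have "mat n n (\<lambda>(i, j). (map (\<lambda>c i. \<Sum>j<n. c j * A j i) cs ! i) j) = ?M * ?A"
    using n by (intro eq_matI) (auto simp: scalar_prod_def lessThan_atLeast0)
  then show ?thesis
    using det_mult[of ?M n ?A] n by (simp add: rdet_def)
qed

lemma rdet_scale_rows: "rdet (u @ map (\<lambda>c i. a * c i) cs) = a ^ length cs * rdet (u @ cs)"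
proof (induction cs arbitrary: u)
  case (Cons c cs)
  have "rdet (u @ map (\<lambda>c i. a * c i) (c # cs)) = a * rdet (u @ c # map (\<lambda>c i. a * c i) cs)"
    using rdet_row_linear[of u a c 0 c] by simp
  also have "rdet (u @ c # map (\<lambda>c i. a * c i) cs) = a ^ length cs * rdet (u @ c # cs)"
    using Cons.IH[of "u @ [c]"] by simp
  finally show ?case
    by (simp add: mult.assoc)
qed simp

lemma rdet_hom:
  assumes "comm_ring_hom h"
  shows "rdet (map (\<lambda>c i. h (c i)) cs) = h (rdet cs)"
proof -
  let ?n = "length cs"
  have "mat ?n ?n (\<lambda>(i, j). (map (\<lambda>c i. h (c i)) cs ! i) j) = map_mat h (mat ?n ?n (\<lambda>(i, j). (cs ! i) j))"
    by (intro eq_matI) auto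
  then show ?thesis
    by (simp add: rdet_def comm_ring_hom.hom_det[OF assms])
qed

lemma rdet_laplace_column:
  assumes "cs \<noteq> []"
  shows "rdet cs = (\<Sum>j<length cs. (- 1) ^ j * (cs ! j) 0 *
     rdet (map (\<lambda>c i. c (Suc i)) (take j cs @ drop (Suc j) cs)))"
proof -
  let ?n = "length cs" and ?M = "mat (length cs) (length cs) (\<lambda>(i, j). (cs ! i) j)"
  have n: "0 < ?n"
    using assms by simp
  have "?M $$ (j, 0) * cofactor ?M j 0 =
      (- 1) ^ j * (cs ! j) 0 * rdet (map (\<lambda>c i. c (Suc i)) (take j cs @ drop (Suc j) cs))"
    if j: "j < ?n" for j
  proof -
    have len: "length (map (\<lambda>c i. c (Suc i)) (take j cs @ drop (Suc j) cs)) = ?n - 1"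
      using j by simp
    have "mat_delete ?M j 0 = mat (?n - 1) (?n - 1)
        (\<lambda>(i, k). (map (\<lambda>c i. c (Suc i)) (take j cs @ drop (Suc j) cs) ! i) k)"
      using j by (intro eq_matI) (auto simp: mat_delete_def nth_append min_def)
    then show ?thesis
      using j n by (simp add: cofactor_def rdet_def min_def)
  qed
  then show ?thesis
    using laplace_expansion_column[of ?M ?n 0] n by (simp add: rdet_def)
qed

text \<open>Multiplying from the left by the unitriangular matrix of powers of w makes the matrix
  lower triangular. The diagonal then consists of the claimed sum followed by ones.\<close>

lemma det_companion:
  fixes w :: "'a::comm_ring_1"
  assumes n: "n > 0"
  shows "det (mat n n (\<lambda>(j, i). if i = 0 then x j else if j = i then 1 else if Suc j = i then - w else 0)) =
    (\<Sum>j<n. x j * w ^ j)"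
    (is "det ?A = _")
proof -
  define U where "U = mat n n (\<lambda>(i, j). if i \<le> j then w ^ (j - i) else 0)"
  have U: "U \<in> carrier_mat n n"
    by (simp add: U_def)
  have "det U = prod_list (diag_mat U)"
    using U by (intro det_upper_triangular) (auto simp: U_def)
  also have "diag_mat U = replicate n 1"
    by (intro nth_equalityI) (auto simp: diag_mat_def U_def)
  finally have det_U: "det U = 1"
    by simp
  have UA: "(U * ?A) $$ (i, k) =
      (if k = 0 then \<Sum>j<n. if i \<le> j then w ^ (j - i) * x j else 0 else if i = k then 1 else 0)"
    if ik: "i < n" "k < n" for i k
  proof -
    have "(U * ?A) $$ (i, k) = (\<Sum>j<n. U $$ (i, j) * ?A $$ (j, k))"
      using ik by (simp add: U_def scalar_prod_def lessThan_atLeast0)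
    also have "\<dots> = (if k = 0 then \<Sum>j<n. if i \<le> j then w ^ (j - i) * x j else 0 else if i = k then 1 else 0)"
    proof (cases k)
      case 0
      then show ?thesis
        using ik by (auto simp: U_def intro!: sum.cong)
    next
      case (Suc k')
      have "(\<Sum>j<n. U $$ (i, j) * ?A $$ (j, k)) =
          (\<Sum>j<n. (if j = k then U $$ (i, k) else 0) + (if j = k' then - (w * U $$ (i, k')) else 0))"
        using ik Suc by (intro sum.cong) auto
      also have "\<dots> = U $$ (i, k) - w * U $$ (i, k')"
        using ik Suc by (simp add: sum.distrib)
      also have "\<dots> = (if i = k then 1 else 0)"
        using ik Suc by (auto simp: U_def Suc_diff_le simp flip: power_Suc)
      finally show ?thesis
        using Suc by simp
    qed
    finally show ?thesis .
  qed
  have "det (U * ?A) = prod_list (diag_mat (U * ?A))"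
    using U by (intro det_lower_triangular[of n]) (auto simp: UA simp del: index_mult_mat(1))
  also have "diag_mat (U * ?A) = (\<Sum>j<n. w ^ j * x j) # replicate (n - 1) 1"
    using n U by (intro nth_equalityI) (auto simp: diag_mat_def UA nth_Cons simp del: index_mult_mat(1) split: nat.split)
  finally show ?thesis
    using det_mult[OF U, of ?A] det_U by (simp add: mult.commute)
qed

text \<open>Rows and columns are both reversed, so the two signs cancel; a transposition then labels
  the rows by the indices of the basis vectors in \<open>bwedge\<close>.\<close>

lemma schur_eq_rdet:
  "schur r l c = rdet (map (\<lambda>j i. c (int (j + l (r - 1 - j)) - int i)) [0..<r])"
proof -
  define p where "p i = (if i < r then r - 1 - i else i)" for i
  have pp: "p (p i) = i" for i
    by (auto simp: p_def)
  have p: "p permutes {0..<r}"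
    unfolding permutes_def
  proof (intro conjI allI)
    show "\<exists>!x. p x = y" for y
      by (metis pp)
  qed (simp add: p_def)
  have sq: "signof p * (signof p * x) = x" for x :: 'a
    by (simp add: sign_def flip: mult.assoc)
  let ?M = "mat r r (\<lambda>(i, j). c (int (l j) - int j + int i))"
  let ?N = "mat r r (\<lambda>(i, j). ?M $$ (p i, j))"
  let ?T = "transpose_mat ?N"
  have "schur r l c = signof p * (signof p * det ?M)"
    by (simp only: sq schur_def)
  also have "\<dots> = signof p * det ?T"
    by (simp add: det_transpose[of ?N r] det_permute_rows[of ?M r, OF _ p])
  also have "\<dots> = det (mat r r (\<lambda>(i, j). ?T $$ (p i, j)))"
    by (rule det_permute_rows[symmetric, OF _ p]) simp
  also have "mat r r (\<lambda>(i, j). ?T $$ (p i, j)) =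
      mat r r (\<lambda>(i, j). (map (\<lambda>j i. c (int (j + l (r - 1 - j)) - int i)) [0..<r] ! i) j)"
    by (intro eq_matI) (auto simp: p_def of_nat_diff algebra_simps)
  finally show ?thesis
    by (simp add: rdet_def)
qed

section \<open>Schur determinants and exterior powers\<close>

lemma Bring_iff_keys: "p \<in> Bring r \<longleftrightarrow> Poly_Mapping.keys p \<subseteq> {m. Poly_Mapping.keys m \<subseteq> {1..r}}"
  by (auto simp: Bring_def)

lemma Bring_zero [simp]: "0 \<in> Bring r"
  by (simp add: Bring_def)

lemma Bring_one [simp]: "1 \<in> Bring r"
  by (simp add: Bring_def)

lemma Bring_add: "p \<in> Bring r \<Longrightarrow> q \<in> Bring r \<Longrightarrow> p + q \<in> Bring r"
  using keys_add[of p q] by (auto simp: Bring_def)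

lemma Bring_uminus: "p \<in> Bring r \<Longrightarrow> - p \<in> Bring r"
  by (simp add: Bring_def)

lemma Bring_diff: "p \<in> Bring r \<Longrightarrow> q \<in> Bring r \<Longrightarrow> p - q \<in> Bring r"
  using Bring_add[of p r "- q"] by (simp add: Bring_uminus)

lemma Bring_mult:
  assumes "p \<in> Bring r" "q \<in> Bring r"
  shows "p * q \<in> Bring r"
  unfolding Bring_def
proof safe
  fix m i
  assume "m \<in> Poly_Mapping.keys (p * q)" and i: "i \<in> Poly_Mapping.keys m"
  then obtain a b where "m = a + b" "a \<in> Poly_Mapping.keys p" "b \<in> Poly_Mapping.keys q"
    using keys_mult[of p q] by auto
  moreover have "Poly_Mapping.keys (a + b) \<subseteq> Poly_Mapping.keys a \<union> Poly_Mapping.keys b"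
    by (rule keys_add)
  ultimately show "i \<in> {1..r}"
    using assms i unfolding Bring_def by blast
qed

lemma Bring_sum: "(\<And>i. i \<in> S \<Longrightarrow> f i \<in> Bring r) \<Longrightarrow> sum f S \<in> Bring r"
  by (induction S rule: infinite_finite_induct) (auto intro: Bring_add)

lemma Bring_prod: "(\<And>i. i \<in> S \<Longrightarrow> f i \<in> Bring r) \<Longrightarrow> prod f S \<in> Bring r"
  by (induction S rule: infinite_finite_induct) (auto intro: Bring_mult)

lemma Bring_of_int: "of_int n \<in> Bring r"
  by (induction n rule: int_induct[where k = 0]) (auto intro: Bring_add Bring_diff)

lemma Bring_evar: "i \<in> {1..r} \<Longrightarrow> evar i \<in> Bring r"
  by (auto simp: Bring_def evar_def)

lemma Bring_rdet:
  assumes "\<And>c i. c \<in> set cs \<Longrightarrow> c i \<in> Bring r"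
  shows "rdet cs \<in> Bring r"
  using assms by (auto simp: rdet_def det_def intro!: Bring_sum Bring_mult Bring_prod Bring_of_int)

section \<open>Coefficients of E_r and of its inverse\<close>

definition ecoef :: "nat \<Rightarrow> nat \<Rightarrow> epoly" where
  "ecoef r t = fps_nth (Eser r) t"

lemma ecoef_eq: "ecoef r t = (if t = 0 then 1 else if t \<le> r then (- 1) ^ t * evar t else 0)"
proof -
  have "fps_nth (fps_const ((- 1) ^ i * evar i) * fps_X ^ i) t = (if i = t then (- 1) ^ t * evar t else 0)" for i
    by (simp add: fps_X_power_nth)
  then show ?thesis
    by (auto simp: ecoef_def Eser_def fps_sum_nth)
qed

lemma ecoef_0 [simp]: "ecoef r 0 = 1"
  by (simp add: ecoef_eq)

lemma Bring_ecoef: "ecoef r t \<in> Bring r"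
proof -
  have "(- 1) ^ t \<in> Bring r"
    using Bring_of_int[of "(- 1) ^ t"] by simp
  then show ?thesis
    by (auto simp: ecoef_eq intro!: Bring_mult Bring_evar)
qed

lemma hseq_recurrence: "(\<Sum>t\<le>r. ecoef r t * hseq r (n - int t)) = (if n = 0 then 1 else 0)"
proof (cases "n < 0")
  case True
  then show ?thesis
    by (simp add: hseq_def)
next
  case False
  define N where "N = nat n"
  have n: "n = int N"
    using False by (simp add: N_def)
  \<comment> \<open>The ranges up to r and up to N are compared through r + N: \<open>ecoef\<close>
    vanishes beyond r, \<open>hseq\<close> beyond N.\<close>
  have "(\<Sum>t\<le>r. ecoef r t * hseq r (n - int t)) = (\<Sum>t\<le>r + N. ecoef r t * hseq r (n - int t))"
    by (rule sum.mono_neutral_left) (auto simp: ecoef_eq)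
  also have "\<dots> = (\<Sum>t\<le>N. ecoef r t * hseq r (n - int t))"
    by (rule sum.mono_neutral_right) (auto simp: n hseq_def)
  also have "\<dots> = fps_nth (Eser r * Eser_inv r) N"
    by (auto simp: fps_mult_nth ecoef_def hseq_def n atLeast0AtMost nat_diff_distrib intro!: sum.cong)
  finally show ?thesis
    by (simp add: Eser_mult_Eser_inv n)
qed

lemma hseq_0 [simp]: "hseq r 0 = 1"
  using hseq_recurrence[of r 0] sum.mono_neutral_right[of "{..r}" "{0}" "\<lambda>t. ecoef r t * hseq r (0 - int t)"]
  by (simp add: hseq_def)

lemma hseq_neg: "n < 0 \<Longrightarrow> hseq r n = 0"
  by (simp add: hseq_def)

lemma sum_ecoef_Suc: "(\<Sum>j<r. ecoef r (Suc j) * f (Suc j)) = (\<Sum>t\<le>r. ecoef r t * f t) - f 0"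
proof -
  have "(\<Sum>t\<le>r. ecoef r t * f t) = (\<Sum>t<Suc r. ecoef r t * f t)"
    by (simp add: lessThan_Suc_atMost)
  then show ?thesis
    by (simp only: sum.lessThan_Suc_shift) simp
qed

lemma Bring_hseq: "hseq r n \<in> Bring r"
proof (induction "nat n" arbitrary: n rule: less_induct)
  case less
  show ?case
  proof (cases "n > 0")
    case True
    have "hseq r n = - (\<Sum>j<r. ecoef r (Suc j) * hseq r (n - int (Suc j)))"
      using sum_ecoef_Suc[of r "\<lambda>t. hseq r (n - int t)"] hseq_recurrence[of r n] True by simp
    also have "\<dots> \<in> Bring r"
    proof (intro Bring_uminus Bring_sum Bring_mult Bring_ecoef)
      show "hseq r (n - int (Suc j)) \<in> Bring r" for j
        using True by (intro less) auto
    qed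
    finally show ?thesis .
  next
    case False
    then show ?thesis
      by (cases "n = 0") (simp_all add: hseq_neg)
  qed
qed

text \<open>At a basis vector this is the row that occurs in \<open>schur_eq_rdet\<close>;
  additivity extends it to all of \<open>M0\<close>.\<close>

definition hvec :: "nat \<Rightarrow> M0 \<Rightarrow> nat \<Rightarrow> epoly" where
  "hvec r m i = frag_eval (\<lambda>k. hseq r (int k - int i)) m"

lemma hvec_add: "hvec r (m + n) = (\<lambda>i. hvec r m i + hvec r n i)"
  by (simp add: hvec_def frag_eval_add fun_eq_iff)

lemma hvec_frag_of [simp]: "hvec r (frag_of k) = (\<lambda>i. hseq r (int k - int i))"
  by (simp add: hvec_def fun_eq_iff)

lemma Bring_frag_eval: "(\<And>k. f k \<in> Bring r) \<Longrightarrow> frag_eval f c \<in> Bring r"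
  unfolding frag_eval_def by (intro Bring_sum Bring_mult Bring_of_int)

lemma Bring_hvec: "hvec r m i \<in> Bring r"
  unfolding hvec_def by (intro Bring_frag_eval Bring_hseq)

text \<open>
  \<open>psi r\<close> is the inverse of \<open>\<phi>\<^sub>r\<close>, extended by 0 to the other exterior powers.
\<close>

definition psi_list :: "nat \<Rightarrow> M0 list \<Rightarrow> epoly" where
  "psi_list r ms = (if length ms = r then rdet (map (hvec r) ms) else 0)"

definition psi :: "nat \<Rightarrow> M0 exterior \<Rightarrow> epoly" where
  "psi r = ext_lift (psi_list r)"

lemma multi_alt_psi_list: "multi_alt (psi_list r)"
  unfolding multi_alt_def
proof (intro conjI allI)
  fix u v :: "M0 list" and m n :: M0
  show "psi_list r (u @ (m + n) # v) = psi_list r (u @ m # v) + psi_list r (u @ n # v)"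
    using rdet_row_linear[of "map (hvec r) u" 1 "hvec r m" 1 "hvec r n" "map (hvec r) v"]
    by (simp add: psi_list_def hvec_add)
  show "psi_list r (u @ m # m # v) = 0"
    by (simp add: psi_list_def rdet_identical_rows)
qed

lemmas additive_psi = additive_ext_lift[OF multi_alt_psi_list, folded psi_def]
  and psi_wedge_list = ext_lift_wedge[OF multi_alt_psi_list, folded psi_def]
lemmas psi_add = additive.add[OF additive_psi]
  and psi_diff = additive.diff[OF additive_psi]
  and psi_zero [simp] = additive.zero[OF additive_psi]
  and psi_sum = additive.sum[OF additive_psi]

lemma psi_wedge: "length ms = r \<Longrightarrow> psi r (wedge ms) = rdet (map (hvec r) ms)"
  by (simp add: psi_wedge_list psi_list_def)

lemma bvec_int [simp]: "bvec (int k) = frag_of k"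
  by (simp add: bvec_def)

abbreviation basis_wedge :: "nat list \<Rightarrow> M0 exterior" where
  "basis_wedge ks \<equiv> wedge (map frag_of ks)"

lemma bwedge_eq: "bwedge r l = basis_wedge (map (\<lambda>k. k + l (r - 1 - k)) [0..<r])"
  by (simp add: bwedge_def wedge_def comp_def flip: bvec_int)

lemma bwedge_ext_pow: "bwedge r l \<in> ext_pow r"
  by (simp add: bwedge_eq ext_pow.wedge)

lemma psi_bwedge: "psi r (bwedge r l) = schur r l (hseq r)"
  by (simp add: bwedge_eq psi_wedge schur_eq_rdet comp_def)

lemma psi_Bring: "psi r x \<in> Bring r"
proof (induction x rule: exterior_induct)
  case (wedge ms)
  then show ?case
    by (auto simp: psi_wedge_list psi_list_def Bring_hvec intro!: Bring_rdet)
qed (simp add: psi_diff Bring_diff)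

section \<open>Bases of exterior powers\<close>

text \<open>The entries of a wedge are expanded from left to right, behind a prefix that already
  consists of basis vectors.\<close>

lemma ext_pow_basis_induct:
  assumes x: "x \<in> ext_pow r"
    and basis: "\<And>ks. length ks = r \<Longrightarrow> P (basis_wedge ks)"
    and diff: "\<And>x y. P x \<Longrightarrow> P y \<Longrightarrow> P (x - y)"
  shows "P x"
proof -
  have zero: "P 0"
    using diff[OF basis basis, of "replicate r 0" "replicate r 0"] by simp
  have "P (basis_wedge ks * wedge ms)" if "length ks + length ms = r" for ks ms
    using that
  proof (induction ms arbitrary: ks)
    case Nil
    then show ?case
      by (simp add: basis)
  next
    case (Cons m ms)
    show ?case
    proof (rule frag_induction[of m UNIV])
      show "P (basis_wedge ks * wedge (frag_of k # ms))" for k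
        using Cons.IH[of "ks @ [k]"] Cons.prems by (simp add: mult.assoc)
      show "P (basis_wedge ks * wedge ((a - b) # ms))"
        if "P (basis_wedge ks * wedge (a # ms))" "P (basis_wedge ks * wedge (b # ms))" for a b
        using diff[OF that] by (simp add: ext_incl_diff left_diff_distrib right_diff_distrib)
    qed (simp_all add: ext_incl_zero zero)
  qed
  from this[of "[]"] have "P (wedge ms)" if "length ms = r" for ms
    using that by simp
  with x show ?thesis
    by (induction rule: ext_pow.induct) (auto intro: diff)
qed

text \<open>One step of insertion sort. The set of the new list is recorded so that the old head is
  known to stay below every entry after the insertion.\<close>

lemma ext_incl_mult_sorted_wedge:
  assumes "sorted_wrt (<) ks"
  shows "ext_incl (frag_of k) * basis_wedge ks = 0 \<or>
    (\<exists>ks'. sorted_wrt (<) ks' \<and> length ks' = Suc (length ks) \<and> set ks' = insert k (set ks) \<and>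
      (ext_incl (frag_of k) * basis_wedge ks = basis_wedge ks' \<or>
       ext_incl (frag_of k) * basis_wedge ks = - basis_wedge ks'))"
  using assms
proof (induction ks)
  case Nil
  show ?case
    by (intro disjI2 exI[of _ "[k]"]) simp
next
  case (Cons a ks)
  consider "k < a" | "k = a" | "k > a"
    by linarith
  then show ?case
  proof cases
    case 1
    with Cons.prems have "sorted_wrt (<) (k # a # ks)"
      by auto
    then show ?thesis
      by (intro disjI2 exI[of _ "k # a # ks"]) simp
  next
    case 2
    then show ?thesis
      by (simp add: ext_incl_mult_mult(1))
  next
    case 3
    have eq: "ext_incl (frag_of k) * basis_wedge (a # ks) =
        - (ext_incl (frag_of a) * (ext_incl (frag_of k) * basis_wedge ks))"
      by (simp add: ext_incl_mult_mult(2)[of "frag_of k"])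
    from Cons consider "ext_incl (frag_of k) * basis_wedge ks = 0"
      | ks' where "sorted_wrt (<) ks'" "length ks' = Suc (length ks)" "set ks' = insert k (set ks)"
        "ext_incl (frag_of k) * basis_wedge ks = basis_wedge ks' \<or>
         ext_incl (frag_of k) * basis_wedge ks = - basis_wedge ks'"
      by auto
    then show ?thesis
    proof cases
      case 1
      then show ?thesis
        unfolding eq by simp
    next
      case (2 ks')
      then have "sorted_wrt (<) (a # ks')"
        using Cons.prems 3 by auto
      with 2 show ?thesis
        unfolding eq by (intro disjI2 exI[of _ "a # ks'"]) auto
    qed
  qed
qed

lemma basis_wedge_sort:
  "basis_wedge ks = 0 \<or> (\<exists>ks'. sorted_wrt (<) ks' \<and> length ks' = length ks \<and>
     (basis_wedge ks = basis_wedge ks' \<or> basis_wedge ks = - basis_wedge ks'))"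
proof (induction ks)
  case Nil
  show ?case
    by (intro disjI2 exI[of _ "[]"]) simp
next
  case (Cons k ks)
  then consider "basis_wedge ks = 0"
    | ks' where "sorted_wrt (<) ks'" "length ks' = length ks"
      "basis_wedge ks = basis_wedge ks' \<or> basis_wedge ks = - basis_wedge ks'"
    by blast
  then show ?case
  proof cases
    case 1
    then show ?thesis
      by simp
  next
    case (2 ks')
    from ext_incl_mult_sorted_wedge[OF 2(1), of k] 2(2,3) show ?thesis
      by fastforce
  qed
qed

lemma ext_pow_sorted_induct [consumes 1, case_names basis diff]:
  assumes x: "x \<in> ext_pow r"
    and basis: "\<And>ks. sorted_wrt (<) ks \<Longrightarrow> length ks = r \<Longrightarrow> P (basis_wedge ks)"
    and diff: "\<And>x y. P x \<Longrightarrow> P y \<Longrightarrow> P (x - y)"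
  shows "P x"
  using x
proof (rule ext_pow_basis_induct)
  have zero: "P 0"
    using diff[OF basis basis, of "[0..<r]" "[0..<r]"] by simp
  show "P (basis_wedge ks)" if "length ks = r" for ks
    using basis_wedge_sort[of ks] that diff[OF zero] zero basis by fastforce
qed (rule diff)

section \<open>Determinants with shifted rows\<close>

text \<open>Two products of this form occur: \<open>sigma_bar\<close> of a basis wedge, which lowers
  indices, and the expansion of E_r times a Schur determinant, which raises them.\<close>

definition pair_prod :: "(M0 \<times> M0) list \<Rightarrow> M0 exterior fps" where
  "pair_prod ps = prod_list (map (\<lambda>(x, y). fps_const (ext_incl x) + fps_const (ext_incl y) * fps_X) ps)"

lemma pair_prod_Nil [simp]: "pair_prod [] = 1"
  by (simp add: pair_prod_def)

lemma pair_prod_Cons_nth: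
  "fps_nth (pair_prod ((x, y) # ps)) n = ext_incl x * fps_nth (pair_prod ps) n +
     (if n = 0 then 0 else ext_incl y * fps_nth (pair_prod ps) (n - 1))"
proof -
  have "pair_prod ((x, y) # ps) =
      fps_const (ext_incl x) * pair_prod ps + fps_const (ext_incl y) * (fps_X * pair_prod ps)"
    by (simp add: pair_prod_def distrib_right mult.assoc)
  then show ?thesis
    by simp
qed

lemma pair_prod_ext_pow: "fps_nth (pair_prod ps) n \<in> ext_pow (length ps)"
proof (induction ps arbitrary: n)
  case Nil
  then show ?case
    using ext_pow.wedge[of "[]" 0] by (simp add: ext_pow_zero)
next
  case (Cons p ps)
  then show ?case
    by (cases p) (auto simp: pair_prod_Cons_nth intro!: ext_pow_add ext_incl_mult_ext_pow ext_pow_zero)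
qed

lemma pair_prod_nth_eq_0: "n > length ps \<Longrightarrow> fps_nth (pair_prod ps) n = 0"
proof (induction ps arbitrary: n)
  case (Cons p ps)
  then show ?case
    by (cases p) (simp add: pair_prod_Cons_nth)
qed simp

text \<open>Row linearity, one factor at a time, with a prefix \<open>u\<close> of factors already
  expanded. The homomorphism and \<open>w\<close> are left general to serve both polynomials in
  \<open>w\<close> and Laurent series with \<open>w\<close> the inverse of z.\<close>

lemma psi_pair_prod:
  fixes c :: "epoly \<Rightarrow> 'a::comm_ring_1"
  assumes c: "comm_ring_hom c" and "length u + length ps = r"
  shows "(\<Sum>n\<le>length ps. c (psi r (wedge u * fps_nth (pair_prod ps) n)) * w ^ n) =
    rdet (map (\<lambda>m i. c (hvec r m i)) u @
      map (\<lambda>(x, y) i. c (hvec r x i) + w * c (hvec r y i)) ps)"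
  using assms(2)
proof (induction ps arbitrary: u)
  case Nil
  interpret comm_ring_hom c by fact
  show ?case
    using Nil rdet_hom[OF c, of "map (hvec r) u"] by (simp add: psi_wedge comp_def)
next
  case (Cons p ps)
  interpret comm_ring_hom c by fact
  obtain x y where p: "p = (x, y)"
    by fastforce
  define f where "f z n = c (psi r (wedge (u @ [z]) * fps_nth (pair_prod ps) n))" for z n
  let ?L = "length ps"
  have f_gt: "f z (Suc ?L) = 0" for z
    by (simp add: f_def pair_prod_nth_eq_0)
  have "(\<Sum>n\<le>length (p # ps). c (psi r (wedge u * fps_nth (pair_prod (p # ps)) n)) * w ^ n) =
      (\<Sum>n\<le>Suc ?L. f x n * w ^ n + (if n = 0 then 0 else f y (n - 1) * w ^ n))"
    by (intro sum.cong)
      (auto simp: p pair_prod_Cons_nth f_def distrib_left psi_add hom_add distrib_right mult.assoc)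
  also have "\<dots> = (\<Sum>n\<le>Suc ?L. f x n * w ^ n) + (\<Sum>n\<le>?L. f y n * w ^ Suc n)"
    by (subst sum.distrib) (subst (2) sum.atMost_Suc_shift, simp)
  also have "\<dots> = (\<Sum>n\<le>?L. f x n * w ^ n) + w * (\<Sum>n\<le>?L. f y n * w ^ n)"
    by (simp add: f_gt sum_distrib_left mult_ac)
  also have "\<dots> = rdet (map (\<lambda>m i. c (hvec r m i)) (u @ [x]) @
        map (\<lambda>(x, y) i. c (hvec r x i) + w * c (hvec r y i)) ps) +
      w * rdet (map (\<lambda>m i. c (hvec r m i)) (u @ [y]) @
        map (\<lambda>(x, y) i. c (hvec r x i) + w * c (hvec r y i)) ps)"
    unfolding f_def using Cons.prems by (intro arg_cong2[of _ _ _ _ "\<lambda>a b. a + w * b"] Cons.IH) simp_all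
  also have "\<dots> = rdet (map (\<lambda>m i. c (hvec r m i)) u @
      map (\<lambda>(x, y) i. c (hvec r x i) + w * c (hvec r y i)) (p # ps))"
    using rdet_row_linear[of "map (\<lambda>m i. c (hvec r m i)) u" 1 "\<lambda>i. c (hvec r x i)" w "\<lambda>i. c (hvec r y i)"
        "map (\<lambda>(x, y) i. c (hvec r x i) + w * c (hvec r y i)) ps"]
    by (simp add: p)
  finally show ?case .
qed

text \<open>The column operation is right multiplication by the matrix of
  \<open>det_companion\<close>.\<close>

lemma rdet_column_step:
  assumes r: "length cs = r" and "r > 0"
  shows "rdet (map (\<lambda>v i. if i = 0 then \<Sum>j<r. x j * v j else v i - w * v (i - 1)) cs) =
    (\<Sum>j<r. x j * w ^ j) * rdet cs"
proof -
  define A where "A j i = (if i = 0 then x j else if j = i then 1 else if Suc j = i then - w else 0)" for j i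
  have step: "(if i = 0 then \<Sum>j<r. x j * v j else v i - w * v (i - 1)) = (\<Sum>j<r. v j * A j i)"
    if "i < r" for v i
  proof (cases i)
    case 0
    then show ?thesis
      by (simp add: A_def mult.commute)
  next
    case (Suc i')
    have "(\<Sum>j<r. v j * A j i) = (\<Sum>j<r. (if j = i then v j else 0) + (if j = i' then - (w * v j) else 0))"
      using Suc by (intro sum.cong) (auto simp: A_def)
    then show ?thesis
      using that Suc by (simp add: sum.distrib)
  qed
  have "rdet (map (\<lambda>v i. if i = 0 then \<Sum>j<r. x j * v j else v i - w * v (i - 1)) cs) =
      rdet (map (\<lambda>c i. \<Sum>j<r. c j * A j i) cs)"
    using r by (intro rdet_cong) (simp_all add: step)
  also have "\<dots> = rdet cs * (\<Sum>j<r. x j * w ^ j)"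
    unfolding rdet_mult[OF r] A_def using det_companion[of r x w] assms(2) by simp
  finally show ?thesis
    by (simp add: mult.commute)
qed

text \<open>
  The map \<open>1 - w C\<close>, where \<open>C\<close> is the companion matrix of the recurrence with coefficients \<open>e\<close>.
\<close>

definition companion_step :: "nat \<Rightarrow> (nat \<Rightarrow> 'a::comm_ring_1) \<Rightarrow> 'a \<Rightarrow> (nat \<Rightarrow> 'a) \<Rightarrow> nat \<Rightarrow> 'a" where
  "companion_step r e w v i = (if i = 0 then v 0 + w * (\<Sum>j<r. e (Suc j) * v j) else v i - w * v (i - 1))"

lemma rdet_companion_step:
  assumes r: "length cs = r" and e: "e 0 = 1"
  shows "rdet (map (companion_step r e w) cs) = (\<Sum>t\<le>r. e t * w ^ t) * rdet cs"
proof (cases "r = 0")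
  case True
  then show ?thesis
    using assms by simp
next
  case False
  \<comment> \<open>These weights turn the first column of \<open>rdet_column_step\<close> into that
    of \<open>companion_step\<close>, and their generating sum at \<open>w\<close> is the full sum
    of the e_t w^t because e_0 = 1.\<close>
  define x where "x j = (if j = 0 then 1 else 0) + w * e (Suc j)" for j
  have sum_x: "(\<Sum>j<r. x j * v j) = v 0 + w * (\<Sum>j<r. e (Suc j) * v j)" for v
  proof -
    have "(\<Sum>j<r. x j * v j) = (\<Sum>j<r. if j = 0 then v j else 0) + w * (\<Sum>j<r. e (Suc j) * v j)"
      unfolding sum_distrib_left sum.distrib[symmetric]
      by (intro sum.cong) (auto simp: x_def algebra_simps)
    then show ?thesis
      using False by simp
  qed
  have "companion_step r e w =
      (\<lambda>v i. if i = 0 then \<Sum>j<r. x j * v j else v i - w * v (i - 1))"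
    by (intro ext) (simp add: companion_step_def sum_x)
  then have "rdet (map (companion_step r e w) cs) = (\<Sum>j<r. x j * w ^ j) * rdet cs"
    using rdet_column_step[OF r, of x w] False by simp
  also have "(\<Sum>j<r. x j * w ^ j) = (\<Sum>t<Suc r. e t * w ^ t)"
    using sum_x[of "\<lambda>j. w ^ j"] e by (subst sum.lessThan_Suc_shift) (simp add: sum_distrib_left mult_ac)
  finally show ?thesis
    by (simp add: lessThan_Suc_atMost)
qed

text \<open>In the first entry this is the recurrence at k + 1, an index where its right side is 0;
  the other entries are a mere shift.\<close>

lemma companion_step_hseq:
  assumes c: "comm_ring_hom c"
  shows "companion_step r (\<lambda>t. c (ecoef r t)) w (\<lambda>i. c (hseq r (int k - int i))) i =
    c (hseq r (int k - int i)) - w * c (hseq r (int (Suc k) - int i))"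
proof -
  interpret comm_ring_hom c by fact
  have "(\<Sum>j<r. ecoef r (Suc j) * hseq r (int (Suc k) - int (Suc j))) = - hseq r (int (Suc k))"
    using sum_ecoef_Suc[of r "\<lambda>t. hseq r (int (Suc k) - int t)"] hseq_recurrence[of r "int (Suc k)"] by simp
  then have "(\<Sum>j<r. c (ecoef r (Suc j)) * c (hseq r (int k - int j))) = - c (hseq r (int (Suc k)))"
    by (simp flip: hom_mult hom_sum hom_uminus)
  then show ?thesis
    by (simp add: companion_step_def of_nat_diff algebra_simps)
qed

text \<open>The dual Pieri rule up to sign: the coefficient of w^n in det(1 - w C) times the
  determinant of the rows v_k, which is the determinant of the rows v_k - w v_(k+1).\<close>

lemma ecoef_mult_psi:
  assumes "length ks = r" "n \<le> r"
  shows "ecoef r n * psi r (basis_wedge ks) =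
    psi r (fps_nth (pair_prod (map (\<lambda>k. (frag_of k, - frag_of (Suc k))) ks)) n)"
proof -
  let ?c = "\<lambda>p :: epoly. [:p:]" and ?w = "[:0, 1:] :: epoly poly"
  let ?P = "pair_prod (map (\<lambda>k. (frag_of k, - frag_of (Suc k))) ks)"
  have c: "comm_ring_hom ?c"
    by standard (simp_all add: one_pCons mult.commute)
  have neg: "hvec r (- m) i = - hvec r m i" for m i
    by (simp add: hvec_def additive.minus[OF additive_frag_eval])
  have "(\<Sum>n\<le>r. [:psi r (fps_nth ?P n):] * ?w ^ n) =
      rdet (map (\<lambda>k i. [:hseq r (int k - int i):] + ?w * [:hvec r (- frag_of (Suc k)) i:]) ks)"
    using psi_pair_prod[OF c, of "[]" "map (\<lambda>k. (frag_of k, - frag_of (Suc k))) ks" r ?w] assms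
    by (simp add: comp_def case_prod_beta)
  also have "\<dots> = rdet (map (companion_step r (\<lambda>t. ?c (ecoef r t)) ?w)
      (map (\<lambda>k i. ?c (hseq r (int k - int i))) ks))"
    by (intro rdet_cong) (simp_all add: companion_step_hseq[OF c] neg del: of_nat_Suc)
  also have "\<dots> = (\<Sum>t\<le>r. ?c (ecoef r t) * ?w ^ t) * ?c (psi r (basis_wedge ks))"
    using rdet_companion_step[of "map (\<lambda>k i. ?c (hseq r (int k - int i))) ks" r "\<lambda>t. ?c (ecoef r t)" ?w]
      rdet_hom[OF c, of "map (hvec r \<circ> frag_of) ks"] assms
    by (simp add: psi_wedge comp_def one_pCons)
  finally have eq: "(\<Sum>n\<le>r. monom (psi r (fps_nth ?P n)) n) = (\<Sum>t\<le>r. monom (ecoef r t) t) * [:psi r (basis_wedge ks):]"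
    by (simp add: monom_altdef)
  from arg_cong[OF this, of "\<lambda>p. coeff p n"] show ?thesis
    using assms(2) by (simp add: coeff_sum mult.commute)
qed

lemma ecoef_mult_psi_range:
  assumes "x \<in> ext_pow r" "n \<le> r"
  shows "\<exists>y\<in>ext_pow r. psi r y = ecoef r n * psi r x"
  using assms(1)
proof (induction rule: ext_pow_sorted_induct)
  case (basis ks)
  then show ?case
    using pair_prod_ext_pow[of "map (\<lambda>k. (frag_of k, - frag_of (Suc k))) ks" n]
      ecoef_mult_psi[of ks r n] assms(2) by auto
next
  case (diff x y)
  then show ?case
    using ext_pow.diff by (metis psi_diff right_diff_distrib)
qed

lemma psi_basis_0: "psi r (basis_wedge [0..<r]) = 1"
proof -
  let ?A = "mat r r (\<lambda>(i, j). hseq r (int i - int j))"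
  have "det ?A = prod_list (diag_mat ?A)"
    by (rule det_lower_triangular[of r]) (auto simp: hseq_neg)
  also have "diag_mat ?A = replicate r 1"
    by (intro nth_equalityI) (auto simp: diag_mat_def)
  also have "det ?A = psi r (basis_wedge [0..<r])"
    by (auto simp: psi_wedge rdet_def comp_def intro!: arg_cong[of _ _ det] eq_matI)
  finally show ?thesis
    by simp
qed

text \<open>The image contains 1, coming from the first r basis vectors, and is stable under
  multiplication by e_1, ..., e_r by the Pieri rule. Induction on the total degree reaches every
  monomial.\<close>

lemma psi_surj:
  assumes "p \<in> Bring r"
  shows "\<exists>x\<in>ext_pow r. psi r x = p"
proof -
  have closed: "\<exists>y\<in>ext_pow r. psi r y = evar i * p" if p: "\<exists>x\<in>ext_pow r. psi r x = p" and i: "i \<in> {1..r}" for i p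
  proof -
    obtain x where x: "x \<in> ext_pow r" "psi r x = p"
      using p by blast
    then obtain y where y: "y \<in> ext_pow r" "psi r y = (- 1) ^ i * evar i * p"
      using ecoef_mult_psi_range[of x r i] i by (auto simp: ecoef_eq)
    show ?thesis
    proof (cases "even i")
      case True
      then show ?thesis
        using y by auto
    next
      case False
      then show ?thesis
        using y ext_pow_uminus[OF y(1)] by (auto simp: additive.minus[OF additive_psi] intro!: bexI[of _ "- y"])
    qed
  qed
  have mono: "\<exists>x\<in>ext_pow r. psi r x = frag_of m" if "Poly_Mapping.keys m \<subseteq> {1..r}" for m :: "nat \<Rightarrow>\<^sub>0 nat"
    using that
  proof (induction "\<Sum>i\<in>{1..r}. Poly_Mapping.lookup m i" arbitrary: m rule: less_induct)
    case less
    show ?case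
    proof (cases "m = 0")
      case True
      then show ?thesis
        using psi_basis_0[of r] ext_pow.wedge[of "map frag_of [0..<r]" r] by auto
    next
      case False
      then obtain i where i: "i \<in> Poly_Mapping.keys m"
        by fastforce
      define m' where "m' = m - Poly_Mapping.single i 1"
      have m: "m = Poly_Mapping.single i 1 + m'"
        using i by (intro poly_mapping_eqI) (auto simp: m'_def lookup_add lookup_minus lookup_single when_def in_keys_iff)
      have i': "i \<in> {1..r}"
        using i less.prems by blast
      have "Poly_Mapping.lookup m j = (if j = i then 1 else 0) + Poly_Mapping.lookup m' j" for j
        by (simp add: m lookup_add lookup_single when_def)
      then have "(\<Sum>j\<in>{1..r}. Poly_Mapping.lookup m j) = Suc (\<Sum>j\<in>{1..r}. Poly_Mapping.lookup m' j)"
        using i' by (simp add: sum.distrib)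
      moreover have "Poly_Mapping.keys m' \<subseteq> {1..r}"
        using less.prems by (auto simp: m'_def in_keys_iff lookup_minus)
      ultimately have "\<exists>x\<in>ext_pow r. psi r x = frag_of m'"
        by (intro less.hyps) simp_all
      from closed[OF this i'] show ?thesis
        by (simp add: evar_def mult_single m)
    qed
  qed
  from assms show ?thesis
    unfolding Bring_iff_keys
  proof (induction p rule: frag_induction)
    case zero
    show ?case
      by (rule bexI[of _ 0]) (simp_all add: ext_pow_zero)
  next
    case (one m)
    then show ?case
      by (simp add: mono)
  next
    case (diff a b)
    then show ?case
      using ext_pow.diff psi_diff by metis
  qed
qed

section \<open>Linear independence of Schur determinants\<close>

definition poly_eval :: "(nat \<Rightarrow> 'a::comm_ring_1) \<Rightarrow> epoly \<Rightarrow> 'a" where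
  "poly_eval y = frag_eval (\<lambda>m. \<Prod>i\<in>Poly_Mapping.keys m. y i ^ Poly_Mapping.lookup m i)"

lemma comm_ring_hom_poly_eval: "comm_ring_hom (poly_eval y)"
proof
  let ?f = "\<lambda>m. \<Prod>i\<in>Poly_Mapping.keys m. y i ^ Poly_Mapping.lookup m i"
  have sup: "?f m = (\<Prod>i\<in>S. y i ^ Poly_Mapping.lookup m i)"
    if "finite S" "Poly_Mapping.keys m \<subseteq> S" for m S
    using that by (intro prod.mono_neutral_left) (auto simp: in_keys_iff)
  have mult: "?f (a + b) = ?f a * ?f b" for a b
  proof -
    let ?S = "Poly_Mapping.keys a \<union> Poly_Mapping.keys b"
    have "Poly_Mapping.keys (a + b) \<subseteq> ?S"
      by (rule keys_add)
    then have "?f (a + b) = (\<Prod>i\<in>?S. y i ^ Poly_Mapping.lookup a i) * (\<Prod>i\<in>?S. y i ^ Poly_Mapping.lookup b i)"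
      by (subst sup[of ?S]) (simp_all add: lookup_add power_add prod.distrib)
    then show ?thesis
      using sup[of ?S a] sup[of ?S b] by simp
  qed
  show "poly_eval y (p * q) = poly_eval y p * poly_eval y q" for p q
    unfolding poly_eval_def by (rule frag_eval_mult) (rule mult)
  show "poly_eval y 1 = 1"
    using frag_eval_of[of ?f 0] by (simp add: poly_eval_def)
qed (simp_all add: poly_eval_def frag_eval_add)

lemma poly_eval_evar [simp]: "poly_eval y (evar i) = y i"
  by (simp add: poly_eval_def evar_def)

definition linprod :: "nat set \<Rightarrow> epoly fps" where
  "linprod S = (\<Prod>l\<in>S. 1 - fps_const (evar l) * fps_X)"

lemma linprod_nth_eq_0:
  assumes "finite S"
  shows "card S < n \<Longrightarrow> fps_nth (linprod S) n = 0"
  using assms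
proof (induction S arbitrary: n rule: finite_induct)
  case empty
  then show ?case
    by (simp add: linprod_def)
next
  case (insert l S)
  have "linprod (insert l S) = linprod S - fps_const (evar l) * (fps_X * linprod S)"
    using insert.hyps by (simp add: linprod_def algebra_simps)
  moreover have "card S < n" "card S < n - 1"
    using insert.hyps insert.prems by simp_all
  ultimately show ?case
    by (simp add: insert.IH)
qed

lemma linprod_nth_0: "fps_nth (linprod S) 0 = 1"
  by (induction S rule: infinite_finite_induct) (simp_all add: linprod_def)

definition alternant :: "nat list \<Rightarrow> epoly" where
  "alternant ks = rdet (map (\<lambda>k l. evar l ^ k) ks)"

text \<open>
  Jacobi's bialternant formula: \<open>h\<close> sends \<open>e\<^sub>i\<close> to the \<open>i\<close>-th elementary symmetric polynomial in
  \<open>x\<^sub>0, \<dots>, x\<^bsub>r-1\<^esub>\<close>, the variables \<open>evar l\<close> playing the role of the \<open>x\<^sub>l\<close>. Only independence is needed, so the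
  value of \<open>v\<close> (the Vandermonde determinant) is irrelevant.
\<close>

lemma schur_alternant:
  "\<exists>h v. comm_ring_hom h \<and> (\<forall>ks. length ks = r \<longrightarrow> alternant ks = h (psi r (basis_wedge ks)) * v)"
proof -
  let ?Q = "linprod {..<r}"
  \<comment> \<open>The sign compensates the one in E_r, so that E_r is sent to the product of the
    factors 1 - x_l X.\<close>
  define h where "h = poly_eval (\<lambda>i. (- 1) ^ i * fps_nth ?Q i)"
  interpret h: comm_ring_hom h
    unfolding h_def by (rule comm_ring_hom_poly_eval)
  have h_ecoef: "h (ecoef r t) = fps_nth ?Q t" for t
  proof -
    have "h (evar t) = (- 1) ^ t * fps_nth ?Q t"
      by (simp add: h_def)
    then show ?thesis
      by (simp add: ecoef_eq linprod_nth_0 linprod_nth_eq_0 h.hom_mult h.hom_power h.hom_uminus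
          flip: mult.assoc power_mult_distrib)
  qed
  define G where "G = Abs_fps (\<lambda>n. h (hseq r (int n)))"
  have QG: "?Q * G = 1"
  proof (rule fps_ext)
    fix n
    have "fps_nth (?Q * G) n = h (fps_nth (Eser r * Eser_inv r) n)"
      by (simp add: fps_mult_nth G_def h.hom_sum h.hom_mult hseq_def flip: h_ecoef ecoef_def)
    then show "fps_nth (?Q * G) n = fps_nth 1 n"
      by (simp add: Eser_mult_Eser_inv)
  qed
  define p where "p l i = fps_nth (linprod ({..<r} - {l})) i" for l i
  \<comment> \<open>The geometric series of x_l is the image of 1/E_r times the product of the
    factors other than the l-th; this reads off its k-th coefficient.\<close>
  have power_eq: "evar l ^ k = (\<Sum>i<r. h (hseq r (int k - int i)) * p l i)" if l: "l < r" for k l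
  proof -
    let ?p = "linprod ({..<r} - {l})" and ?x = "1 - fps_const (evar l) * fps_X" and ?g = "Abs_fps (\<lambda>n. evar l ^ n)"
    have "?Q = ?x * ?p"
      unfolding linprod_def using l by (intro prod.remove) auto
    then have xpG: "?x * (?p * G) = 1"
      using QG by (simp add: mult.assoc)
    have xg: "?x * ?g = 1"
    proof (rule fps_ext)
      show "fps_nth (?x * ?g) n = fps_nth 1 n" for n
        by (cases n) (simp_all add: left_diff_distrib mult.assoc)
    qed
    have "?p * G = ?x * ?g * (?p * G)"
      by (simp only: xg mult_1_left)
    also have "\<dots> = ?x * (?p * G) * ?g"
      by (simp only: mult_ac)
    also have "\<dots> = ?g"
      by (simp only: xpG mult_1_left)
    finally have pG: "?p * G = ?g" .
    then have "evar l ^ k = fps_nth (?p * G) k"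
      by simp
    also have "\<dots> = (\<Sum>i\<le>k. p l i * h (hseq r (int k - int i)))"
      by (auto simp: fps_mult_nth p_def G_def atLeast0AtMost of_nat_diff intro!: sum.cong)
    also have "\<dots> = (\<Sum>i\<le>k. h (hseq r (int k - int i)) * p l i)"
      by (simp only: mult.commute)
    \<comment> \<open>Beyond k the terms vanish because of \<open>hseq\<close>, and from r on
      because the product of the other factors has degree at most r - 1.\<close>
    also have "\<dots> = (\<Sum>i<r + Suc k. h (hseq r (int k - int i)) * p l i)"
      by (rule sum.mono_neutral_left) (auto simp: hseq_neg)
    also have "\<dots> = (\<Sum>i<r. h (hseq r (int k - int i)) * p l i)"
      using l by (intro sum.mono_neutral_right) (auto simp: p_def linprod_nth_eq_0)
    finally show ?thesis .
  qed
  have "alternant ks = h (psi r (basis_wedge ks)) * det (mat r r (\<lambda>(i, l). p l i))" if ks: "length ks = r" for ks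
  proof -
    have "alternant ks = rdet (map (\<lambda>c l. \<Sum>i<r. c i * p l i) (map (\<lambda>k i. h (hseq r (int k - int i))) ks))"
      unfolding alternant_def using ks by (intro rdet_cong) (simp_all add: power_eq)
    also have "\<dots> = rdet (map (\<lambda>k i. h (hseq r (int k - int i))) ks) * det (mat r r (\<lambda>(i, l). p l i))"
      by (rule rdet_mult) (simp add: ks)
    also have "rdet (map (\<lambda>k i. h (hseq r (int k - int i))) ks) = h (psi r (basis_wedge ks))"
      using rdet_hom[OF h.comm_ring_hom_axioms, of "map (hvec r) (map frag_of ks)"] ks
      by (simp add: psi_wedge comp_def)
    finally show ?thesis .
  qed
  then show ?thesis
    using h.comm_ring_hom_axioms by blast
qed

lemma evar_power: "evar l ^ k = frag_of (Poly_Mapping.single l k)"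
proof (induction k)
  case (Suc k)
  then show ?case
    by (simp add: evar_def mult_single flip: single_add)
qed simp

lemma prod_frag_of: "(\<Prod>i\<in>S. frag_of (f i)) = (frag_of (\<Sum>i\<in>S. f i) :: 'a::comm_monoid_add \<Rightarrow>\<^sub>0 int)"
  by (induction S rule: infinite_finite_induct) (simp_all add: mult_single)

lemma increasing_permutation_eq_id:
  fixes p :: "nat \<Rightarrow> nat"
  assumes p: "p permutes {0..<r}" and inc: "\<And>i j. i < j \<Longrightarrow> j < r \<Longrightarrow> p i < p j"
  shows "p = id"
proof -
  have "sorted_wrt (<) (map p [0..<r])"
    using inc by (simp add: sorted_wrt_iff_nth_less)
  moreover have "set (map p [0..<r]) = set [0..<r]"
    using permutes_image[OF p] by simp
  ultimately have "map p [0..<r] = [0..<r]"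
    by (intro strict_sorted_equal) simp_all
  then have "p i = i" if "i < r" for i
    using that by (metis add_0 length_upt minus_nat.diff_0 nth_map nth_upt)
  moreover have "p i = i" if "\<not> i < r" for i
    using p that by (auto simp: permutes_def)
  ultimately show ?thesis
    by (auto simp: fun_eq_iff)
qed

text \<open>If the term of a permutation p is the given monomial, then the i-th entry of
  \<open>ks\<close> is the entry of \<open>js\<close> at p(i). Both lists increase, so p increases
  and is the identity; only the diagonal term counts.\<close>

lemma lookup_alternant:
  assumes ks: "sorted_wrt (<) ks" "length ks = r" and js: "sorted_wrt (<) js" "length js = r"
  shows "Poly_Mapping.lookup (alternant ks) (\<Sum>i<r. Poly_Mapping.single i (js ! i)) = (if ks = js then 1 else 0)"
proof -
  let ?m = "\<Sum>i<r. Poly_Mapping.single i (js ! i)"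
  let ?t = "\<lambda>p. \<Sum>i<r. Poly_Mapping.single (p i) (ks ! i)"
  let ?P = "{p. p permutes {0..<r}}"
  have eq: "?t p = ?m \<longleftrightarrow> p = id \<and> ks = js" if p: "p permutes {0..<r}" for p
  proof
    assume t: "?t p = ?m"
    have kj: "ks ! i = js ! p i" if i: "i < r" for i
    proof -
      have pi: "p i < r"
        using permutes_in_image[OF p, of i] i by simp
      have "Poly_Mapping.lookup (?t p) (p i) = (\<Sum>j<r. if j = i then ks ! j else 0)"
        unfolding lookup_sum lookup_single
        using permutes_inj[OF p] by (intro sum.cong) (auto simp: when_def inj_eq)
      moreover have "Poly_Mapping.lookup ?m (p i) = (\<Sum>j<r. if j = p i then js ! j else 0)"
        unfolding lookup_sum lookup_single by (intro sum.cong) (auto simp: when_def)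
      ultimately show ?thesis
        using t i pi by simp
    qed
    have "p = id"
    proof (rule increasing_permutation_eq_id[OF p])
      fix i j assume ij: "i < j" "j < r"
      have less: "js ! p i < js ! p j"
        using sorted_wrt_nth_less[OF ks(1), of i j] ks(2) kj[of i] kj[of j] ij by simp
      have "p i < r"
        using permutes_in_image[OF p, of i] ij by simp
      then have "js ! p j < js ! p i" if "p j < p i"
        using sorted_wrt_nth_less[OF js(1) that] js(2) by simp
      with less show "p i < p j"
        by (cases "p i" "p j" rule: linorder_cases) auto
    qed
    with kj show "p = id \<and> ks = js"
      using ks js by (auto intro: nth_equalityI)
  next
    assume "p = id \<and> ks = js"
    then show "?t p = ?m" by simp
  qed
  have "alternant ks = (\<Sum>p\<in>?P. signof p * (\<Prod>i=0..<r. evar (p i) ^ (ks ! i)))"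
    unfolding alternant_def rdet_def using ks(2)
    by (auto simp: det_def intro!: sum.cong prod.cong arg_cong2[of _ _ _ _ "(*)"] dest: permutes_in_image)
  also have "\<dots> = (\<Sum>p\<in>?P. signof p * frag_of (?t p))"
    by (simp add: evar_power prod_frag_of lessThan_atLeast0)
  finally have "Poly_Mapping.lookup (alternant ks) ?m =
      (\<Sum>p\<in>?P. Poly_Mapping.lookup (signof p * frag_of (?t p)) ?m)"
    by (simp add: lookup_sum)
  also have "\<dots> = (\<Sum>p\<in>?P. if p = id then if ks = js then 1 else 0 else 0)"
  proof (intro sum.cong refl)
    fix p assume "p \<in> ?P"
    then have p: "p permutes {0..<r}" by simp
    have "Poly_Mapping.lookup (signof p * frag_of (?t p)) ?m = (if ?t p = ?m then sign p else 0)"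
      by (cases "sign p = 1") (auto simp: sign_def lookup_single when_def)
    also have "\<dots> = (if p = id then if ks = js then 1 else 0 else 0)"
      unfolding eq[OF p] by (simp add: sign_id)
    finally show "Poly_Mapping.lookup (signof p * frag_of (?t p)) ?m =
        (if p = id then if ks = js then 1 else 0 else 0)" .
  qed
  also have "\<dots> = (if ks = js then 1 else 0)"
    by (simp add: sum.delta finite_permutations permutes_id)
  finally show ?thesis .
qed

lemma ext_pow_expand:
  assumes "x \<in> ext_pow r"
  shows "\<exists>c. Poly_Mapping.keys c \<subseteq> {ks. sorted_wrt (<) ks \<and> length ks = r} \<and> x = frag_eval basis_wedge c"
  using assms
proof (induction rule: ext_pow_sorted_induct)
  case (basis ks)
  then show ?case
    by (intro exI[of _ "frag_of ks"]) simp
next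
  case (diff x y)
  then obtain c d where
    "Poly_Mapping.keys c \<subseteq> {ks. sorted_wrt (<) ks \<and> length ks = r}" "x = frag_eval basis_wedge c"
    "Poly_Mapping.keys d \<subseteq> {ks. sorted_wrt (<) ks \<and> length ks = r}" "y = frag_eval basis_wedge d"
    by blast
  moreover have "Poly_Mapping.keys (c - d) \<subseteq> Poly_Mapping.keys c \<union> Poly_Mapping.keys d"
    by (rule keys_diff)
  ultimately show ?case
    by (intro exI[of _ "c - d"]) (auto simp: frag_eval_diff)
qed

text \<open>Expand x in sorted basis wedges and pass to alternants. The monomial with exponents
  \<open>js\<close> occurs only in the alternant of \<open>js\<close>, so every coefficient can be
  read off and is 0.\<close>

lemma psi_eq_0_imp:
  assumes x: "x \<in> ext_pow r" and 0: "psi r x = 0"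
  shows "x = 0"
proof -
  obtain c where c: "Poly_Mapping.keys c \<subseteq> {ks. sorted_wrt (<) ks \<and> length ks = r}"
    and x: "x = frag_eval basis_wedge c"
    using ext_pow_expand[OF x] by blast
  obtain h v where h: "comm_ring_hom h"
    and alt: "\<And>ks. length ks = r \<Longrightarrow> alternant ks = h (psi r (basis_wedge ks)) * v"
    using schur_alternant by blast
  interpret comm_ring_hom h by fact
  have "additive (\<lambda>x. h (psi r x) * v)"
    by (simp add: additive_def psi_add hom_add distrib_right)
  from additive_frag_eval_commute[OF this, of basis_wedge c]
  have "0 = frag_eval (\<lambda>ks. h (psi r (basis_wedge ks)) * v) c"
    using 0 by (simp flip: x)
  also have "\<dots> = (\<Sum>ks\<in>Poly_Mapping.keys c. of_int (Poly_Mapping.lookup c ks) * alternant ks)"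
    using c unfolding frag_eval_def by (intro sum.cong) (auto simp: alt)
  finally have sum0: "(\<Sum>ks\<in>Poly_Mapping.keys c. of_int (Poly_Mapping.lookup c ks) * alternant ks) = 0"
    by simp
  have "Poly_Mapping.keys c = {}"
  proof (rule ccontr)
    assume "Poly_Mapping.keys c \<noteq> {}"
    then obtain js where js: "js \<in> Poly_Mapping.keys c"
      by blast
    let ?l = "\<lambda>p :: epoly. Poly_Mapping.lookup p (\<Sum>i<r. Poly_Mapping.single i (js ! i))"
    have "?l (\<Sum>ks\<in>Poly_Mapping.keys c. of_int (Poly_Mapping.lookup c ks) * alternant ks) =
        (\<Sum>ks\<in>Poly_Mapping.keys c. Poly_Mapping.lookup c ks * ?l (alternant ks))"
      by (simp add: lookup_sum additive_of_int_mult[OF additive_lookup])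
    also have "\<dots> = (\<Sum>ks\<in>Poly_Mapping.keys c. if ks = js then Poly_Mapping.lookup c ks else 0)"
      using c js by (intro sum.cong refl, subst lookup_alternant) auto
    also have "\<dots> = Poly_Mapping.lookup c js"
      using js by simp
    finally show False
      using js unfolding sum0 by (simp add: in_keys_iff)
  qed
  then show ?thesis
    by (simp add: x frag_eval_def)
qed

lemma psi_inj_on: "inj_on (psi r) (ext_pow r)"
  using psi_eq_0_imp[OF ext_pow.diff] by (fastforce intro!: inj_onI simp: psi_diff)

section \<open>The isomorphism \<open>\<phi>\<^sub>r\<close>\<close>

text \<open>The partition is the list of indices minus the staircase 0, 1, ..., r - 1. The truncated
  subtraction is exact because the i-th entry is at least i.\<close>

lemma sorted_wedge_eq_bwedge:
  assumes ks: "sorted_wrt (<) ks" "length ks = r"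
  obtains l where "l \<in> parts r" "basis_wedge ks = bwedge r l"
proof
  define l where "l i = (if i < r then ks ! (r - 1 - i) - (r - 1 - i) else 0)" for i
  have ge: "i \<le> ks ! i" if "i < r" for i
    using that
  proof (induction i)
    case (Suc i)
    then show ?case
      using sorted_wrt_nth_less[OF ks(1), of i "Suc i"] ks(2) by simp
  qed simp
  have step: "ks ! i - i \<le> ks ! j - j" if "i \<le> j" "j < r" for i j
    using that
  proof (induction j rule: dec_induct)
    case (step j)
    have "ks ! j < ks ! Suc j"
      using sorted_wrt_nth_less[OF ks(1), of j "Suc j"] step.prems ks(2) by simp
    then show ?case
      using step by simp
  qed simp
  have "l j \<le> l i" if "i \<le> j" for i j
    using step[of "r - 1 - j" "r - 1 - i"] that by (auto simp: l_def)
  then show "l \<in> parts r"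
    by (auto simp: parts_def l_def[of "_ + _"] antimono_def) (simp add: l_def)
  have "map (\<lambda>k. k + l (r - 1 - k)) [0..<r] = ks"
    using ks(2) ge by (intro nth_equalityI) (auto simp: l_def)
  then show "basis_wedge ks = bwedge r l"
    by (simp add: bwedge_eq)
qed

text \<open>Any map with the defining properties of \<open>phi\<close> inverts \<open>psi r\<close>,
  by induction on sorted wedges. The inverse of \<open>psi r\<close> has these properties, and by
  surjectivity it is the only such map, which resolves the definite description.\<close>

lemma phi_psi:
  assumes "x \<in> ext_pow r"
  shows "phi r (psi r x) = x"
proof -
  define P where "P f \<longleftrightarrow> f \<in> extensional (Bring r) \<and>
     (\<forall>p\<in>Bring r. \<forall>q\<in>Bring r. f (p + q) = f p + f q) \<and>
     (\<forall>l\<in>parts r. f (schur r l (hseq r)) = bwedge r l)" for f :: "epoly \<Rightarrow> M0 exterior"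
  have unique: "f (psi r x) = x" if f: "P f" and "x \<in> ext_pow r" for f x
    using that(2)
  proof (induction rule: ext_pow_sorted_induct)
    case (basis ks)
    then show ?case
      using f by (auto simp: P_def psi_bwedge elim!: sorted_wedge_eq_bwedge)
  next
    case (diff x y)
    \<comment> \<open>Additivity is given for sums only, so the difference is recovered by adding
      the subtrahend back.\<close>
    have "f (psi r x - psi r y + psi r y) = f (psi r x - psi r y) + f (psi r y)"
      using f unfolding P_def by (blast intro: psi_Bring Bring_diff)
    then show ?case
      using diff by (simp add: psi_diff eq_diff_eq)
  qed
  define f where "f = restrict (inv_into (ext_pow r) (psi r)) (Bring r)"
  have f_psi: "f (psi r x) = x" if "x \<in> ext_pow r" for x
    using that psi_Bring inv_into_f_f[OF psi_inj_on] by (simp add: f_def)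
  have "P f"
    unfolding P_def
  proof (intro conjI ballI)
    show "f \<in> extensional (Bring r)"
      by (simp add: f_def)
    show "f (p + q) = f p + f q" if "p \<in> Bring r" "q \<in> Bring r" for p q
    proof -
      obtain x where "x \<in> ext_pow r" "psi r x = p"
        using psi_surj[OF \<open>p \<in> Bring r\<close>] by blast
      moreover obtain y where "y \<in> ext_pow r" "psi r y = q"
        using psi_surj[OF \<open>q \<in> Bring r\<close>] by blast
      ultimately show ?thesis
        using f_psi[of "x + y"] by (auto simp: f_psi psi_add ext_pow_add)
    qed
    show "f (schur r l (hseq r)) = bwedge r l" for l
      using f_psi[OF bwedge_ext_pow] by (simp add: psi_bwedge)
  qed
  moreover have "g = f" if "P g" for g
  proof
    fix p
    show "g p = f p"
    proof (cases "p \<in> Bring r")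
      case True
      then obtain x where "x \<in> ext_pow r" "psi r x = p"
        using psi_surj by meson
      then show ?thesis
        using unique[OF that] f_psi by auto
    next
      case False
      then show ?thesis
        using that \<open>P f\<close> by (simp add: P_def extensional_def)
    qed
  qed
  ultimately have "phi r = f"
    unfolding phi_def P_def[symmetric] by (rule the_equality)
  then show ?thesis
    using f_psi assms by simp
qed

lemma phi_schur: "phi r (schur r l (hseq r)) = bwedge r l"
  using phi_psi[OF bwedge_ext_pow] by (simp add: psi_bwedge)

lemma inv_phi:
  assumes "x \<in> ext_pow r"
  shows "inv_into (Bring r) (phi r) x = psi r x"
proof -
  have "inj_on (phi r) (Bring r)"
    by (metis (no_types, opaque_lifting) inj_onI phi_psi psi_surj)
  then show ?thesis
    using assms phi_psi psi_Bring by (metis inv_into_f_f)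
qed

lemma phi_add: "p \<in> Bring r \<Longrightarrow> q \<in> Bring r \<Longrightarrow> phi r (p + q) = phi r p + phi r q"
  by (metis ext_pow_add phi_psi psi_add psi_surj)

text \<open>\<open>psi r\<close> embeds the exterior power into integral polynomials, where
  torsion-freeness is seen on coefficients.\<close>

lemma ext_pow_torsion_free:
  assumes x: "x \<in> ext_pow r" and "n \<noteq> 0" "of_int n * x = 0"
  shows "x = 0"
proof -
  have "of_int n * psi r x = 0"
    using assms(3) by (simp flip: additive_of_int_mult[OF additive_psi])
  moreover have "Poly_Mapping.lookup (of_int n * psi r x) m = n * Poly_Mapping.lookup (psi r x) m" for m
    by (simp add: additive_of_int_mult[OF additive_lookup])
  ultimately have "psi r x = 0"
    using assms(2) by (intro poly_mapping_eqI) (metis lookup_zero mult_eq_0_iff)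
  then show ?thesis
    by (rule psi_eq_0_imp[OF x])
qed

section \<open>Decomposability\<close>

lemma covec_nonzero:
  assumes x: "x \<in> ext_pow (Suc r)" "x \<noteq> 0"
  obtains \<eta> :: "M0 exterior \<Rightarrow> int" where "additive \<eta>" "covec \<eta> x \<noteq> 0"
proof -
  have "\<exists>k. contr_basis k x \<noteq> 0"
  proof (rule ccontr)
    assume "\<not> ?thesis"
    then have "of_int (int (Suc r)) * x = 0"
      using euler_identity[OF x(1)] by (auto simp del: of_nat_Suc)
    then show False
      using ext_pow_torsion_free[OF x(1), of "int (Suc r)"] x(2) by simp
  qed
  then obtain k where "contr_basis k x \<noteq> 0"
    by blast
  then have "psi r (contr_basis k x) \<noteq> 0"
    using psi_eq_0_imp contr_ext_pow[OF additive_lookup x(1)] by blast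
  \<comment> \<open>As \<open>psi r\<close> is injective in degree r, some monomial coefficient of
    the image is nonzero; taking this coefficient is the functional sought.\<close>
  then obtain m where m: "Poly_Mapping.lookup (psi r (contr_basis k x)) m \<noteq> 0"
    by (metis lookup_zero poly_mapping_eqI)
  define \<eta> where "\<eta> y = Poly_Mapping.lookup (psi r y) m" for y
  have \<eta>: "additive \<eta>"
    by (simp add: additive_def \<eta>_def psi_add lookup_add)
  have "Poly_Mapping.lookup (covec \<eta> x) k \<noteq> 0"
    using m covec_pairing[OF additive_lookup \<eta>] by (simp add: \<eta>_def)
  then show thesis
    using \<eta> that by (metis lookup_zero)
qed

lemma plucker_imp_decomposable:
  assumes "r \<ge> 1" "x \<in> ext_pow r" "plucker x"
  shows "\<exists>ms. length ms = r \<and> x = wedge ms"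
  using assms
proof (induction r arbitrary: x rule: dec_induct)
  case base
  \<comment> \<open>The induction starts in degree 1, where every element is a vector. In degree 0
    every integer satisfies the condition, while 1 is the only wedge.\<close>
  have "\<exists>m. x = ext_incl m"
    using base(1)
  proof (induction rule: ext_pow.induct)
    case (wedge ms)
    then show ?case
      by (auto simp: length_Suc_conv)
  next
    case (diff x y)
    then show ?case
      by (metis ext_incl_diff)
  qed
  then obtain m where "x = wedge [m]"
    by auto
  then show ?case
    by (intro exI[of _ "[m]"]) simp
next
  case (step r)
  show ?case
  proof (cases "x = 0")
    case True
    then show ?thesis
      by (intro exI[of _ "replicate (Suc r) 0"]) (simp add: ext_incl_zero)
  next
    case False
    then obtain \<eta> where \<eta>: "additive \<eta>" "covec \<eta> x \<noteq> 0"
      using covec_nonzero[OF step.prems(1)] by blast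
    from primitive_vector[OF this(2)] obtain g v and \<alpha> :: "M0 \<Rightarrow> int"
      where v: "g \<noteq> 0" "covec \<eta> x = frag_cmul g v" "additive \<alpha>" "\<alpha> v = 1" .
    \<comment> \<open>Replacing the covector by its primitive part divides the relation by g, which
      torsion-freeness permits.\<close>
    have "of_int g * (ext_incl v * x) = ext_incl (covec \<eta> x) * x"
      by (simp add: v additive_frag_cmul[OF additive_ext_incl] mult.assoc)
    also have "\<dots> = 0"
      using step.prems(2) \<eta>(1) by (simp add: plucker_def)
    finally have "ext_incl v * x = 0"
      using ext_pow_torsion_free[OF ext_incl_mult_ext_pow[OF step.prems(1)] v(1)] by simp
    note * = plucker_contr[OF step.prems(2) this v(3,4)]
    obtain ms where "length ms = r" "contr \<alpha> x = wedge ms"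
      using step.IH[OF contr_ext_pow[OF v(3) step.prems(1)] *(2)] by blast
    then show ?thesis
      using *(1) by (intro exI[of _ "v # ms"]) simp
  qed
qed

lemma grassmann_cone_iff_plucker:
  assumes "r \<ge> 1" "x \<in> ext_pow r"
  shows "x \<in> grassmann_cone r \<longleftrightarrow> plucker x"
  using plucker_imp_decomposable[OF assms] plucker_wedge
  by (auto simp: grassmann_cone_def wedge_def)

section \<open>Tensor products\<close>

context
  fixes A :: "'a::ab_group_add set" and B :: "'b::ab_group_add set"
  assumes A_zero: "0 \<in> A" and A_diff: "\<And>x y. x \<in> A \<Longrightarrow> y \<in> A \<Longrightarrow> x - y \<in> A"
    and B_zero: "0 \<in> B" and B_diff: "\<And>x y. x \<in> B \<Longrightarrow> y \<in> B \<Longrightarrow> x - y \<in> B"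
begin

lemma tensor_eq_refl: "tensor_eq A B u u"
  by (simp add: tensor_eq_def tensor_rel.zero)

lemma tensor_eq_diff:
  "tensor_eq A B u u' \<Longrightarrow> tensor_eq A B v v' \<Longrightarrow> tensor_eq A B (u - v) (u' - v')"
  using tensor_rel.diff[of "u - u'" A B "v - v'"] by (simp add: tensor_eq_def algebra_simps)

lemma tensor_eq_sym: "tensor_eq A B u v \<Longrightarrow> tensor_eq A B v u"
  using tensor_eq_diff[OF tensor_eq_refl[of u], of u v] tensor_rel.diff[OF tensor_rel.zero, of "u - v"]
  by (simp add: tensor_eq_def)

lemma tensor_eq_trans [trans]: "tensor_eq A B u v \<Longrightarrow> tensor_eq A B v w \<Longrightarrow> tensor_eq A B u w"
  using tensor_eq_sym[of v w] tensor_rel.diff[of "u - v" A B "w - v"]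
  by (simp add: tensor_eq_def)

lemma tensor_eq_sum:
  "(\<And>i. i \<in> S \<Longrightarrow> tensor_eq A B (f i) (g i)) \<Longrightarrow> tensor_eq A B (sum f S) (sum g S)"
proof (induction S rule: infinite_finite_induct)
  case (insert i S)
  \<comment> \<open>The sum is written as a double difference, since the congruence is established
    for differences.\<close>
  have "tensor_eq A B (f i - (0 - sum f S)) (g i - (0 - sum g S))"
    using insert by (intro tensor_eq_diff tensor_eq_refl) auto
  then show ?case
    using insert by simp
qed (simp_all add: tensor_eq_refl)

lemma tensor_diff_left:
  assumes "x \<in> A" "x' \<in> A" "y \<in> B"
  shows "tensor_eq A B (frag_of (x - x', y)) (frag_of (x, y) - frag_of (x', y))"
proof -
  have "frag_of (x - x' + x', y) - frag_of (x - x', y) - frag_of (x', y) \<in> tensor_rel A B"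
    using assms A_diff by (intro tensor_rel.left) auto
  then have "tensor_eq A B (frag_of (x, y) - frag_of (x', y)) (frag_of (x - x', y))"
    by (simp add: tensor_eq_def algebra_simps)
  then show ?thesis
    by (rule tensor_eq_sym)
qed

lemma tensor_diff_right:
  assumes "x \<in> A" "y \<in> B" "y' \<in> B"
  shows "tensor_eq A B (frag_of (x, y - y')) (frag_of (x, y) - frag_of (x, y'))"
proof -
  have "frag_of (x, y - y' + y') - frag_of (x, y - y') - frag_of (x, y') \<in> tensor_rel A B"
    using assms B_diff by (intro tensor_rel.right) auto
  then have "tensor_eq A B (frag_of (x, y) - frag_of (x, y')) (frag_of (x, y - y'))"
    by (simp add: tensor_eq_def algebra_simps)
  then show ?thesis
    by (rule tensor_eq_sym)
qed

lemma tensor_zero_left: "y \<in> B \<Longrightarrow> tensor_eq A B (frag_of (0, y)) 0"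
  using tensor_diff_left[OF A_zero A_zero] by simp

lemma tensor_zero_right: "x \<in> A \<Longrightarrow> tensor_eq A B (frag_of (x, 0)) 0"
  using tensor_diff_right[OF _ B_zero B_zero] by simp

end

text \<open>On representatives, this is the map from A \<otimes> B to B induced by the functional on
  the left factor.\<close>

definition tensor_apply :: "('a \<Rightarrow> int) \<Rightarrow> ('a \<times> 'b::ring_1 \<Rightarrow>\<^sub>0 int) \<Rightarrow> 'b" where
  "tensor_apply \<eta> = frag_eval (\<lambda>(x, y). of_int (\<eta> x) * y)"

lemma tensor_apply_rel:
  assumes \<eta>: "\<And>x y. x \<in> A \<Longrightarrow> y \<in> A \<Longrightarrow> \<eta> (x + y) = \<eta> x + \<eta> y" and "u \<in> tensor_rel A B"
  shows "tensor_apply \<eta> u = 0"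
  using assms(2)
  by (induction rule: tensor_rel.induct)
    (simp_all add: tensor_apply_def frag_eval_diff frag_eval_add \<eta> algebra_simps)

text \<open>Expanding left factors in the finite set M of basis elements and moving integers to the
  right leaves one summand for each basis element. Its right factor is obtained by applying the
  corresponding coordinate to the left factors.\<close>

lemma tensor_normal_form:
  fixes B :: "epoly set" and M :: "'m set"
  assumes M: "finite M" and A_zero: "0 \<in> A" and A_diff: "\<And>x y. x \<in> A \<Longrightarrow> y \<in> A \<Longrightarrow> x - y \<in> A"
    and B_zero: "0 \<in> B" and B_diff: "\<And>x y. x \<in> B \<Longrightarrow> y \<in> B \<Longrightarrow> x - y \<in> B"
    and mono: "\<And>m. m \<in> M \<Longrightarrow> frag_of m \<in> A"
    and u: "Poly_Mapping.keys u \<subseteq> {x. Poly_Mapping.keys x \<subseteq> M} \<times> B"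
  shows "tensor_eq A B u (\<Sum>m\<in>M. frag_of (frag_of m, tensor_apply (\<lambda>x. Poly_Mapping.lookup x m) u))"
proof -
  note rules = A_zero A_diff B_zero B_diff
  have B_uminus: "- y \<in> B" if "y \<in> B" for y
    using B_diff[OF B_zero that] by simp
  have B_add: "x + y \<in> B" if "x \<in> B" "y \<in> B" for x y
    using B_diff[OF that(1) B_uminus[OF that(2)]] by simp
  have B_scale: "of_int n * y \<in> B" if "y \<in> B" for n y
    by (induction n rule: int_induct[where k = 0])
      (simp_all add: B_zero distrib_right left_diff_distrib B_add B_diff that)
  define N where "N g = (\<Sum>m\<in>M. frag_of (frag_of m, g m))" for g :: "'m \<Rightarrow> epoly"
  have N_zero: "tensor_eq A B (N (\<lambda>_. 0)) 0"
    using tensor_eq_sum[OF rules tensor_zero_right[OF rules mono]] by (simp add: N_def)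
  have N_diff: "tensor_eq A B (N (\<lambda>m. g m - h m)) (N g - N h)"
    if "\<And>m. m \<in> M \<Longrightarrow> g m \<in> B" "\<And>m. m \<in> M \<Longrightarrow> h m \<in> B" for g h
    unfolding N_def sum_subtractf[symmetric]
    by (intro tensor_eq_sum[OF rules] tensor_diff_right[OF rules] mono that)
  have combine: "tensor_eq A B (u - v) (N (\<lambda>m. g m - h m))"
    if "tensor_eq A B u (N g)" "tensor_eq A B v (N h)"
      "\<And>m. m \<in> M \<Longrightarrow> g m \<in> B" "\<And>m. m \<in> M \<Longrightarrow> h m \<in> B" for u v g h
    using tensor_eq_trans[OF rules tensor_eq_diff[OF rules that(1,2)] tensor_eq_sym[OF rules N_diff[OF that(3,4)]]] .
  have A_mono: "x \<in> A" if "Poly_Mapping.keys x \<subseteq> M" for x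
    using that by (induction x rule: frag_induction) (auto intro: A_zero A_diff mono)
  have gen: "tensor_eq A B (frag_of (x, y)) (N (\<lambda>m. of_int (Poly_Mapping.lookup x m) * y))"
    if "Poly_Mapping.keys x \<subseteq> M" and y: "y \<in> B" for x y
  proof -
    \<comment> \<open>Membership in A is carried along, as the biadditivity relations hold for
      members of A and B.\<close>
    have "x \<in> A \<and> tensor_eq A B (frag_of (x, y)) (N (\<lambda>m. of_int (Poly_Mapping.lookup x m) * y))"
      using that(1)
    proof (induction x rule: frag_induction)
      case zero
      show ?case
        using tensor_eq_trans[OF rules tensor_zero_left[OF rules y] tensor_eq_sym[OF rules N_zero]]
        by (simp add: A_zero)
    next
      case (one m)
      have "N (\<lambda>m'. of_int (Poly_Mapping.lookup (frag_of m) m') * y) =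
          frag_of (frag_of m, y) + (\<Sum>m'\<in>M - {m}. frag_of (frag_of m', 0))"
        unfolding N_def using one M by (subst sum.remove[of M m]) auto
      moreover have "tensor_eq A B (frag_of (frag_of m, y) - (0 - (\<Sum>m'\<in>M - {m}. frag_of (frag_of m', 0))))
          (frag_of (frag_of m, y) - (0 - (\<Sum>m'\<in>M - {m}. 0)))"
        by (intro tensor_eq_diff[OF rules] tensor_eq_refl[OF rules] tensor_eq_sum[OF rules]
            tensor_zero_right[OF rules] mono) auto
      ultimately show ?case
        using tensor_eq_sym[OF rules] mono one by simp
    next
      case (diff x x')
      have "tensor_eq A B (frag_of (x - x', y))
          (N (\<lambda>m. of_int (Poly_Mapping.lookup x m) * y - of_int (Poly_Mapping.lookup x' m) * y))"
        using diff y
        by (intro tensor_eq_trans[OF rules tensor_diff_left[OF rules]] combine B_scale) auto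
      then show ?case
        using diff A_diff by (simp add: lookup_minus left_diff_distrib)
    qed
    then show ?thesis ..
  qed
  have "(\<forall>m. tensor_apply (\<lambda>x. Poly_Mapping.lookup x m) u \<in> B) \<and>
      tensor_eq A B u (N (\<lambda>m. tensor_apply (\<lambda>x. Poly_Mapping.lookup x m) u))"
    using u
  proof (induction u rule: frag_induction)
    case zero
    show ?case
      using tensor_eq_sym[OF rules N_zero] by (simp add: tensor_apply_def B_zero)
  next
    case (one p)
    then show ?case
      using gen[of "fst p" "snd p"] by (cases p) (auto simp: tensor_apply_def intro: B_scale)
  next
    case (diff u v)
    then show ?case
      using combine by (simp add: tensor_apply_def frag_eval_diff B_diff)
  qed
  then show ?thesis
    by (simp add: N_def)
qed

text \<open>B_s is free on its monomials, so the monomial coordinates already detect zero through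
  the normal form. Additivity is asked on B_s only, because \<open>phi s\<close> is additive
  there.\<close>

lemma tensor_eq_zero_iff:
  assumes u: "Poly_Mapping.keys u \<subseteq> Bring s \<times> Bring t"
  shows "tensor_eq (Bring s) (Bring t) u 0 \<longleftrightarrow>
    (\<forall>\<eta>. (\<forall>x\<in>Bring s. \<forall>y\<in>Bring s. \<eta> (x + y) = \<eta> x + \<eta> y) \<longrightarrow> tensor_apply \<eta> u = 0)"
    (is "_ \<longleftrightarrow> ?R")
proof
  assume "tensor_eq (Bring s) (Bring t) u 0"
  then have "u \<in> tensor_rel (Bring s) (Bring t)"
    by (simp add: tensor_eq_def)
  then show ?R
    using tensor_apply_rel[of "Bring s" _ u "Bring t"] by blast
next
  assume ?R
  define M where "M = (\<Union>p\<in>Poly_Mapping.keys u. Poly_Mapping.keys (fst p))"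
  have mono: "frag_of m \<in> Bring s" if m: "m \<in> M" for m
  proof -
    obtain p where p: "p \<in> Poly_Mapping.keys u" "m \<in> Poly_Mapping.keys (fst p)"
      using m by (auto simp: M_def)
    then have "fst p \<in> Bring s"
      using u by auto
    then show ?thesis
      using p(2) by (simp add: Bring_def)
  qed
  have fin: "finite M"
    by (simp add: M_def)
  have keys: "Poly_Mapping.keys u \<subseteq> {x. Poly_Mapping.keys x \<subseteq> M} \<times> Bring t"
    using u by (force simp: M_def)
  have "tensor_apply (\<lambda>x. Poly_Mapping.lookup x m) u = 0" for m
    using \<open>?R\<close> by (simp add: lookup_add)
  then have 1: "tensor_eq (Bring s) (Bring t) u (\<Sum>m\<in>M. frag_of (frag_of m, 0))"
    using tensor_normal_form[OF fin Bring_zero Bring_diff Bring_zero Bring_diff mono keys] by simp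
  have 2: "tensor_eq (Bring s) (Bring t) (\<Sum>m\<in>M. frag_of (frag_of m, 0 :: epoly)) (\<Sum>m\<in>M. 0)"
    by (intro tensor_eq_sum tensor_zero_right Bring_zero Bring_diff mono)
  show "tensor_eq (Bring s) (Bring t) u 0"
    using tensor_eq_trans[OF Bring_zero Bring_diff Bring_zero Bring_diff 1 2] by simp
qed

section \<open>Laurent series\<close>

lemma comm_ring_hom_fls_const: "comm_ring_hom (fls_const :: 'a::comm_ring_1 \<Rightarrow> 'a fls)"
  by standard (simp_all add: fls_plus_const)

lemma fls_nth_fls_of_zinv:
  "fls_nth (fls_of_zinv p) i = (if i \<le> 0 then coeff p (nat (- i)) else 0)"
proof -
  have "fls_nth (fls_of_zinv p) i =
      (\<Sum>j\<le>degree (map_poly fls_const p). if i = - int j then coeff p j else 0)"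
    by (auto simp: fls_of_zinv_def poly_altdef fls_nth_sum coeff_map_poly intro!: sum.cong)
  also have "\<dots> = (\<Sum>j\<le>degree p. if i = - int j then coeff p j else 0)"
    by (intro sum.cong) (simp_all add: degree_map_poly)
  also have "\<dots> = (if i \<le> 0 then coeff p (nat (- i)) else 0)"
  proof (cases "i \<le> 0")
    case True
    then have "(\<Sum>j\<le>degree p. if i = - int j then coeff p j else 0) =
        (\<Sum>j\<le>degree p. if j = nat (- i) then coeff p j else 0)"
      by (intro sum.cong) auto
    then show ?thesis
      using True by (auto simp: coeff_eq_0)
  qed (auto intro: sum.neutral)
  finally show ?thesis .
qed

lemma fls_of_zinv_pCons: "fls_of_zinv (pCons c p) = fls_const c + fls_X_inv * fls_of_zinv p"
  by (simp add: fls_of_zinv_def map_poly_pCons)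

lemma comm_ring_hom_fls_of_zinv: "comm_ring_hom (fls_of_zinv :: 'a::comm_ring_1 poly \<Rightarrow> 'a fls)"
proof
  have add: "fls_of_zinv (p + q) = fls_of_zinv p + fls_of_zinv q" for p q :: "'a poly"
    by (intro fls_eqI) (simp add: fls_nth_fls_of_zinv)
  have smult: "fls_of_zinv (Polynomial.smult c p) = fls_const c * fls_of_zinv p" for c and p :: "'a poly"
    by (intro fls_eqI) (simp add: fls_nth_fls_of_zinv)
  have zero: "fls_of_zinv 0 = (0 :: 'a fls)"
    by (intro fls_eqI) (simp add: fls_nth_fls_of_zinv)
  show "fls_of_zinv (p + q) = fls_of_zinv p + fls_of_zinv q" for p q :: "'a poly"
    by (rule add)
  show "fls_of_zinv (p * q) = fls_of_zinv p * fls_of_zinv q" for p q :: "'a poly"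
    by (induction p) (simp_all add: zero add smult fls_of_zinv_pCons distrib_right mult.assoc)
  show "fls_of_zinv 1 = (1 :: 'a fls)"
    by (simp add: one_pCons fls_of_zinv_pCons zero)
qed (simp add: fls_of_zinv_def)

lemma Eser_fls: "fps_to_fls (Eser s) = (\<Sum>j<Suc s. fls_const (ecoef s j) * fls_X ^ j)"
proof (rule fls_eqI)
  fix i
  have "fls_nth (\<Sum>j<Suc s. fls_const (ecoef s j) * fls_X ^ j) i =
      (\<Sum>j<Suc s. if i = int j then ecoef s j else 0)"
    unfolding fls_nth_sum by (intro sum.cong) (auto simp: fls_X_power_times_conv_shift)
  also have "\<dots> = (\<Sum>j<Suc s. if 0 \<le> i \<and> j = nat i then ecoef s j else 0)"
    by (intro sum.cong) auto
  also have "\<dots> = fls_nth (fps_to_fls (Eser s)) i"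
    by (cases "i \<ge> 0") (auto simp: ecoef_def[symmetric] ecoef_eq simp del: sum.lessThan_Suc)
  finally show "fls_nth (fps_to_fls (Eser s)) i = fls_nth (\<Sum>j<Suc s. fls_const (ecoef s j) * fls_X ^ j) i" ..
qed

section \<open>The factor in \<open>B\<^bsub>r-1\<^esub>\<close>\<close>

definition Sfls :: "nat \<Rightarrow> int \<Rightarrow> epoly fls" where
  "Sfls s n = fls_of_zinv (sigma_hseq s n)"

lemma fls_nth_Sfls: "fls_nth (Sfls s n) i = (if i \<le> 0 then hseq s (n + i) else 0)"
proof -
  have "coeff (sigma_hseq s n) t = hseq s (n - int t)" for t
  proof -
    have "coeff (sigma_hseq s n) t = (\<Sum>j\<in>{0..n}. if j = int t then hseq s (n - j) else 0)"
      unfolding sigma_hseq_def coeff_sum by (intro sum.cong) auto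
    then show ?thesis
      by (auto simp: hseq_neg)
  qed
  then show ?thesis
    by (simp add: Sfls_def fls_nth_fls_of_zinv)
qed

text \<open>Equivalent to the recursion S_(n+1) = h_(n+1) + S_n / z.\<close>

lemma Sfls_step: "Sfls s n - fls_X * Sfls s (n + 1) = - (fls_X * fls_const (hseq s (n + 1)))"
proof (rule fls_eqI)
  fix i :: int
  consider "i \<le> 0" | "i = 1" | "i > 1"
    by linarith
  then show "fls_nth (Sfls s n - fls_X * Sfls s (n + 1)) i = fls_nth (- (fls_X * fls_const (hseq s (n + 1)))) i"
    by cases (simp_all add: fls_nth_Sfls fls_X_times_conv_shift)
qed

text \<open>
  The generating function of the \<open>S\<^sub>n\<close> is \<open>1 / (E(w) (1 - w / z))\<close>.
\<close>

lemma Sfls_sum: "(\<Sum>t<Suc s. fls_const (ecoef s t) * Sfls s (int k - int t)) = fls_X_inv ^ k"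
proof (rule fls_eqI)
  fix i
  have "fls_nth (\<Sum>t<Suc s. fls_const (ecoef s t) * Sfls s (int k - int t)) i =
      (if i \<le> 0 then \<Sum>t\<le>s. ecoef s t * hseq s (int k + i - int t) else 0)"
    unfolding fls_nth_sum lessThan_Suc_atMost by (auto simp: fls_nth_Sfls algebra_simps intro!: sum.cong)
  also have "\<dots> = (if i \<le> 0 then if int k + i = 0 then 1 else 0 else 0)"
    by (simp only: hseq_recurrence)
  finally show "fls_nth (\<Sum>t<Suc s. fls_const (ecoef s t) * Sfls s (int k - int t)) i = fls_nth (fls_X_inv ^ k) i"
    by auto
qed

lemma contr_list_eq_sum:
  "contr_list \<alpha> ms = (\<Sum>j<length ms. (- 1) ^ j * of_int (\<alpha> (ms ! j)) * wedge (take j ms @ drop (Suc j) ms))"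
proof (induction ms)
  case (Cons m ms)
  have "ext_incl m * ((- 1) ^ j * of_int n * x) = (- 1) ^ j * of_int n * (ext_incl m * x)" for j n x
    using ext_incl_mult_of_int[of m "(- 1) ^ j * n" x] by simp
  then show ?case
    by (simp add: Cons.IH sum.lessThan_Suc_shift sum_distrib_left del: sum.lessThan_Suc wedge_simps(3))
      (simp add: sum_negf)
qed simp

lemma psi_contr_basis_wedge:
  assumes "length ks = Suc s"
  shows "psi s (contr_basis k (basis_wedge ks)) =
    (\<Sum>j<Suc s. if ks ! j = k then (- 1) ^ j * psi s (basis_wedge (take j ks @ drop (Suc j) ks)) else 0)"
proof -
  have "psi s ((- 1) ^ j * x) = (- 1) ^ j * psi s x" for j x
    using additive_of_int_mult[OF additive_psi, of s "(- 1) ^ j" x] by simp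
  then show ?thesis
    using assms
    by (auto simp: contr_wedge[OF additive_lookup] contr_list_eq_sum psi_sum take_map drop_map
        simp del: sum.lessThan_Suc wedge_simps(3) intro!: sum.cong)
qed

text \<open>A column operation of determinant E_s(z) turns the first column into the powers z^(-k)
  and the others into -z times columns of h's. Laplace expansion along the first column then
  produces the minors, which are values of \<open>psi s\<close>.\<close>

lemma first_factor_det:
  assumes "length ks = Suc s"
  shows "fps_to_fls (Eser s) * rdet (map (\<lambda>k i. Sfls s (int k - int i)) ks) =
    (\<Sum>j<Suc s. (- 1) ^ j * fls_X_inv ^ (ks ! j) * ((- fls_X) ^ s *
       fls_const (psi s (basis_wedge (take j ks @ drop (Suc j) ks)))))"
proof -
  define row where "row k i = (if i = 0 then fls_X_inv ^ k else - (fls_X * fls_const (hseq s (int k - int (i - 1)))))" for k i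
  \<comment> \<open>The size s + 1 is exactly the number of coefficients of E_s, so the factor of
    \<open>rdet_column_step\<close> is E_s(z) itself.\<close>
  have "fps_to_fls (Eser s) * rdet (map (\<lambda>k i. Sfls s (int k - int i)) ks) =
      rdet (map (\<lambda>v i. if i = 0 then \<Sum>j<Suc s. fls_const (ecoef s j) * v j else v i - fls_X * v (i - 1))
        (map (\<lambda>k i. Sfls s (int k - int i)) ks))"
    by (subst rdet_column_step[of _ "Suc s"]) (simp_all add: assms Eser_fls del: sum.lessThan_Suc)
  also have "\<dots> = rdet (map row ks)"
  proof -
    have "(if i = 0 then \<Sum>j<Suc s. fls_const (ecoef s j) * Sfls s (int k - int j)
        else Sfls s (int k - int i) - fls_X * Sfls s (int k - int (i - 1))) = row k i" for k i
      using Sfls_step[of s "int k - int i"]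
      by (cases i) (simp_all add: row_def Sfls_sum of_nat_diff algebra_simps del: sum.lessThan_Suc)
    then show ?thesis
      by (intro rdet_cong) (simp_all del: sum.lessThan_Suc)
  qed
  also have "\<dots> = (\<Sum>j<Suc s. (- 1) ^ j * row (ks ! j) 0 *
     rdet (map (\<lambda>c i. c (Suc i)) (take j (map row ks) @ drop (Suc j) (map row ks))))"
    using assms by (subst rdet_laplace_column) (auto intro!: sum.cong)
  also have "\<dots> = (\<Sum>j<Suc s. (- 1) ^ j * fls_X_inv ^ (ks ! j) * ((- fls_X) ^ s *
       fls_const (psi s (basis_wedge (take j ks @ drop (Suc j) ks)))))"
  proof (intro sum.cong refl arg_cong2[of _ _ _ _ "(*)"])
    fix j assume j: "j \<in> {..<Suc s}"
    define js where "js = take j ks @ drop (Suc j) ks"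
    have len: "length js = s"
      using j assms by (simp add: js_def)
    have "rdet (map (\<lambda>c i. c (Suc i)) (take j (map row ks) @ drop (Suc j) (map row ks))) =
        rdet (map (\<lambda>c i. - fls_X * c i) (map (\<lambda>c i. fls_const (c i)) (map (hvec s) (map frag_of js))))"
      by (intro arg_cong[of _ _ rdet]) (simp add: take_map drop_map row_def js_def)
    also have "\<dots> = (- fls_X) ^ s * rdet (map (\<lambda>c i. fls_const (c i)) (map (hvec s) (map frag_of js)))"
      using rdet_scale_rows[of "[]" "- fls_X :: epoly fls"
          "map (\<lambda>c i. fls_const (c i)) (map (hvec s) (map frag_of js))"] len by simp
    also have "\<dots> = (- fls_X) ^ s * fls_const (psi s (basis_wedge js))"
      unfolding rdet_hom[OF comm_ring_hom_fls_const] using len by (simp add: psi_wedge)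
    finally show "rdet (map (\<lambda>c i. c (Suc i)) (take j (map row ks) @ drop (Suc j) (map row ks))) =
        (- fls_X) ^ s * fls_const (psi s (basis_wedge (take j ks @ drop (Suc j) ks)))"
      by (simp only: js_def)
  qed (simp add: row_def)
  finally show ?thesis .
qed

lemma fls_nth_first_factor:
  "fls_nth (fps_to_fls (Eser s) * fls_of_zinv (schur (Suc s) l (sigma_hseq s))) i =
    (if i \<le> int s then (- 1) ^ s * psi s (contr_basis (nat (int s - i)) (bwedge (Suc s) l)) else 0)"
proof -
  define ks where "ks = map (\<lambda>k. k + l (Suc s - 1 - k)) [0..<Suc s]"
  have len: "length ks = Suc s"
    by (simp add: ks_def)
  let ?p = "\<lambda>j. psi s (basis_wedge (take j ks @ drop (Suc j) ks))"
  have schur: "fls_of_zinv (schur (Suc s) l (sigma_hseq s)) = rdet (map (\<lambda>k i. Sfls s (int k - int i)) ks)"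
    unfolding schur_eq_rdet rdet_hom[OF comm_ring_hom_fls_of_zinv, symmetric]
    by (simp add: ks_def Sfls_def comp_def del: upt_Suc)
  have "fls_nth ((- 1) ^ j * fls_X_inv ^ k * ((- fls_X) ^ s * fls_const c)) i =
      (if int k = int s - i then (- 1) ^ s * ((- 1) ^ j * c) else 0)" for j k and c :: epoly
  proof -
    have "(- 1) ^ j * fls_X_inv ^ k * ((- fls_X) ^ s * fls_const c) =
        fls_X_inv ^ k * (fls_X ^ s * fls_const ((- 1) ^ s * ((- 1) ^ j * c)))"
    proof -
      have "fls_const ((- 1) ^ n :: epoly) = (- 1) ^ n" for n
        by (induction n) (simp_all flip: fls_const_mult_const)
      then show ?thesis
        by (simp add: power_minus[of "fls_X :: epoly fls"] mult_ac flip: fls_const_mult_const)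
    qed
    then show ?thesis
      by (auto simp: fls_X_inv_power_times_conv_shift fls_X_power_times_conv_shift)
  qed
  then have "fls_nth (fps_to_fls (Eser s) * fls_of_zinv (schur (Suc s) l (sigma_hseq s))) i =
      (\<Sum>j<Suc s. if int (ks ! j) = int s - i then (- 1) ^ s * ((- 1) ^ j * ?p j) else 0)"
    unfolding schur first_factor_det[OF len] fls_nth_sum by (simp only:)
  also have "\<dots> = (if i \<le> int s then (- 1) ^ s * psi s (contr_basis (nat (int s - i)) (basis_wedge ks)) else 0)"
    unfolding psi_contr_basis_wedge[OF len] sum_distrib_left
    by (auto simp del: sum.lessThan_Suc intro!: sum.cong sum.neutral)
  finally show ?thesis
    by (simp add: bwedge_eq ks_def del: upt_Suc)
qed

section \<open>The factor in \<open>B\<^bsub>r+1\<^esub>\<close>\<close>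

lemma sigma_bar_spec:
  "alg_hom sigma_bar"
  "j \<ge> 0 \<Longrightarrow> sigma_bar (ext_incl (bvec j)) =
     fps_const (ext_incl (bvec j)) - fps_const (ext_incl (bvec (j - 1))) * fps_X"
  using theI'[OF sigma_bar_ex1, folded sigma_bar_def] by auto

lemma sigma_bar_basis_wedge:
  "sigma_bar (basis_wedge ks) = pair_prod (map (\<lambda>k. (frag_of k, - bvec (int k - 1))) ks)"
proof (induction ks)
  case Nil
  then show ?case
    using sigma_bar_spec(1) by (simp add: alg_hom_def)
next
  case (Cons k ks)
  have "sigma_bar (basis_wedge (k # ks)) = sigma_bar (ext_incl (bvec (int k))) * sigma_bar (basis_wedge ks)"
    using sigma_bar_spec(1) by (simp add: alg_hom_def)
  also have "sigma_bar (ext_incl (bvec (int k))) =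
      fps_const (ext_incl (frag_of k)) + fps_const (ext_incl (- bvec (int k - 1))) * fps_X"
    using sigma_bar_spec(2)[of "int k"]
    by (simp add: additive.minus[OF additive_ext_incl] fps_const_neg[symmetric] del: fps_const_neg)
  finally show ?case
    by (simp add: Cons.IH pair_prod_def)
qed

lemma sigma_bar_B_schur:
  assumes "bwedge r l = basis_wedge ks" "length ks = r"
  shows "fls_of_zinv (sigma_bar_B r (schur r l (hseq r))) =
    rdet (map (\<lambda>k i. fls_const (hseq r (int k - int i)) - fls_X_inv * fls_const (hseq r (int k - 1 - int i))) ks)"
proof -
  let ?ps = "map (\<lambda>k. (frag_of k, - bvec (int k - 1))) ks"
  let ?f = "\<lambda>n. psi r (fps_nth (pair_prod ?ps) n)"
  have len: "length ?ps = r"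
    using assms by simp
  have "sigma_bar_B r (schur r l (hseq r)) = Abs_poly ?f"
    unfolding sigma_bar_B_def phi_schur assms(1) sigma_bar_basis_wedge
    using pair_prod_ext_pow[of ?ps] len by (simp add: inv_phi)
  \<comment> \<open>\<open>Abs_poly\<close> is meaningful here because a product of r linear factors
    has no coefficients beyond r.\<close>
  moreover have "coeff (Abs_poly ?f) = ?f"
    by (rule coeff_Abs_poly[of r]) (simp add: pair_prod_nth_eq_0 assms(2))
  ultimately have coeff: "coeff (sigma_bar_B r (schur r l (hseq r))) n = ?f n" for n
    by simp
  have "fls_of_zinv (sigma_bar_B r (schur r l (hseq r))) = (\<Sum>n\<le>r. fls_const (?f n) * fls_X_inv ^ n)"
  proof (rule fls_eqI)
    fix i
    have "fls_nth (\<Sum>n\<le>r. fls_const (?f n) * fls_X_inv ^ n) i = (\<Sum>n\<le>r. if i \<le> 0 \<and> n = nat (- i) then ?f n else 0)"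
      unfolding fls_nth_sum by (intro sum.cong) auto
    also have "\<dots> = (if i \<le> 0 then ?f (nat (- i)) else 0)"
      by (cases "i \<le> 0") (auto simp: pair_prod_nth_eq_0 assms(2))
    finally show "fls_nth (fls_of_zinv (sigma_bar_B r (schur r l (hseq r)))) i =
        fls_nth (\<Sum>n\<le>r. fls_const (?f n) * fls_X_inv ^ n) i"
      by (simp add: fls_nth_fls_of_zinv coeff)
  qed
  also have "\<dots> = rdet (map (\<lambda>(x, y) i. fls_const (hvec r x i) + fls_X_inv * fls_const (hvec r y i)) ?ps)"
    using psi_pair_prod[OF comm_ring_hom_fls_const, of "[]" ?ps r fls_X_inv] len by simp
  also have "\<dots> = rdet (map (\<lambda>k i. fls_const (hseq r (int k - int i)) - fls_X_inv * fls_const (hseq r (int k - 1 - int i))) ks)"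
  proof (rule rdet_cong)
    fix j i
    \<comment> \<open>For k = 0 both sides are 0: the basis vector has index -1, and so do all the
      h's have negative index.\<close>
    have "hvec r (- bvec (int k - 1)) i = - hseq r (int k - 1 - int i)" for k
      by (cases k) (simp_all add: hvec_def bvec_def additive.minus[OF additive_frag_eval] hseq_neg)
    then show "j < length (map (\<lambda>(x, y) i. fls_const (hvec r x i) + fls_X_inv * fls_const (hvec r y i)) ?ps) \<Longrightarrow>
      (map (\<lambda>(x, y) i. fls_const (hvec r x i) + fls_X_inv * fls_const (hvec r y i)) ?ps ! j) i =
      (map (\<lambda>k i. fls_const (hseq r (int k - int i)) - fls_X_inv * fls_const (hseq r (int k - 1 - int i))) ks ! j) i"
      by simp
  qed simp
  finally show ?thesis .
qed

text \<open>The first row is the generating series of the rows (h_n, h_(n-1), ...), since its i-th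
  entry is z^i / E. By linearity in that row the coefficient of z^n replaces the series by its n-th
  term.\<close>

lemma fls_nth_generating_det:
  assumes "length ks = r"
  shows "fls_nth (rdet ((\<lambda>i. fps_to_fls (fps_X ^ i * Eser_inv (Suc r))) #
      map (\<lambda>k i. fls_const (hseq (Suc r) (int k - int i))) ks)) n =
    (if n \<ge> 0 then psi (Suc r) (basis_wedge (nat n # ks)) else 0)"
proof -
  let ?h = "map (\<lambda>k i. hseq (Suc r) (int k - int i)) ks" and ?e = "\<lambda>j i. if i = j then 1 else 0"
  let ?V = "\<lambda>i. fps_to_fls (fps_X ^ i * Eser_inv (Suc r))"
  have const: "rdet (?e j # map (\<lambda>k i. fls_const (hseq (Suc r) (int k - int i))) ks) = fls_const (rdet (?e j # ?h))" for j
    unfolding rdet_hom[OF comm_ring_hom_fls_const, symmetric] by (intro arg_cong[of _ _ rdet]) (auto simp: fun_eq_iff)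
  have expand: "fls_nth (rdet (?V # map (\<lambda>k i. fls_const (hseq (Suc r) (int k - int i))) ks)) n =
      (\<Sum>j<Suc r. fls_nth (?V j) n * rdet (?e j # ?h))"
    using rdet_row_expand[of "[]" ?V] assms by (simp add: const fls_nth_sum del: sum.lessThan_Suc)
  show ?thesis
  proof (cases "n \<ge> 0")
    case True
    have "(\<Sum>j<Suc r. fls_nth (?V j) n * rdet (?e j # ?h)) =
        (\<Sum>j<Suc r. hseq (Suc r) (n - int j) * rdet (?e j # ?h))"
      using True by (intro sum.cong refl) (auto simp: fps_X_power_mult_nth hseq_def nat_diff_distrib)
    also have "\<dots> = rdet ((\<lambda>i. hseq (Suc r) (n - int i)) # ?h)"
      using rdet_row_expand[of "[]" "\<lambda>i. hseq (Suc r) (n - int i)" ?h] assms by (simp del: sum.lessThan_Suc)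
    also have "\<dots> = psi (Suc r) (basis_wedge (nat n # ks))"
      using assms True by (subst psi_wedge) (simp_all add: comp_def)
    finally show ?thesis
      unfolding expand using True by (simp del: sum.lessThan_Suc)
  qed (simp add: expand)
qed

text \<open>Apply 1 - z C to the rows V and v_k, where V is the generating series. The images are
  v_0 and -z (v_(k+1) - v_k / z), that is, up to (-z)^r, the rows of the determinant for
  \<open>sigma_bar_B\<close>. The determinant of 1 - z C is E, which cancels 1/E.\<close>

lemma fls_nth_second_factor:
  assumes l: "l \<in> parts r"
  shows "fls_nth (fps_to_fls (Eser_inv (Suc r)) *
      fls_of_zinv (sigma_bar_B (Suc r) (schur (Suc r) l (hseq (Suc r))))) (n - int r) =
    (if n \<ge> 0 then (- 1) ^ r * psi (Suc r) (ext_incl (frag_of (nat n)) * bwedge r l) else 0)"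
proof -
  define ks where "ks = map (\<lambda>k. k + l (r - 1 - k)) [0..<r]"
  define R where "R = Suc r"
  have len: "length ks = r"
    by (simp add: ks_def)
  \<comment> \<open>In length r + 1 the partition gains a last part 0, so the lowest index is 0 and
    all others move up by one.\<close>
  have "l r = 0"
    using l by (simp add: parts_def)
  then have "map (\<lambda>k. k + l (Suc r - 1 - k)) [0..<Suc r] = 0 # map Suc ks"
    by (intro nth_equalityI) (auto simp: ks_def nth_Cons simp del: upt_Suc split: nat.split)
  then have bw: "bwedge R l = basis_wedge (0 # map Suc ks)"
    by (simp only: bwedge_eq R_def)
  let ?H = "fps_to_fls (Eser_inv R)" and ?E = "fps_to_fls (Eser R)"
  let ?Q = "fls_of_zinv (sigma_bar_B R (schur R l (hseq R)))"
  let ?c = "fls_const :: epoly \<Rightarrow> epoly fls"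
  define V where "V i = fps_to_fls (fps_X ^ i * Eser_inv R)" for i
  define v where "v k i = ?c (hseq R (int k - int i))" for k i
  have EH: "?E * ?H = 1"
    using Eser_mult_Eser_inv[of R] by (simp flip: fls_times_fps_to_fls)
  have E: "?E = (\<Sum>t\<le>R. ?c (ecoef R t) * fls_X ^ t)"
    by (simp add: Eser_fls lessThan_Suc_atMost)
  have V: "V i = fls_X ^ i * ?H" for i
    by (simp add: V_def fls_times_fps_to_fls fps_to_fls_power)
  have step_V: "companion_step R (\<lambda>t. ?c (ecoef R t)) fls_X V i = v 0 i" for i
  proof (cases i)
    case 0
    have "?E = 1 + (\<Sum>j<R. ?c (ecoef R (Suc j)) * fls_X ^ Suc j)"
      unfolding E lessThan_Suc_atMost[symmetric] by (subst sum.lessThan_Suc_shift) simp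
    then have "1 = ?H + (\<Sum>j<R. ?c (ecoef R (Suc j)) * fls_X ^ Suc j) * ?H"
      using EH by (simp add: distrib_right)
    then show ?thesis
      using 0 by (simp add: companion_step_def V v_def sum_distrib_left sum_distrib_right mult_ac)
  next
    case (Suc i')
    then show ?thesis
      by (simp add: companion_step_def V v_def hseq_neg mult.assoc)
  qed
  have step_v: "companion_step R (\<lambda>t. ?c (ecoef R t)) fls_X (v k) i =
      - fls_X * (v (Suc k) i - fls_X_inv * v k i)" for k i
  proof -
    have "fls_X * fls_X_inv * v k i = v k i"
      by (simp add: fls_X_times_conv_shift)
    then have "fls_X * (fls_X_inv * v k i) = v k i"
      by (simp only: mult.assoc)
    then show ?thesis
      using companion_step_hseq[OF comm_ring_hom_fls_const, of R fls_X k i]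
      by (simp add: v_def[abs_def] right_diff_distrib)
  qed
  \<comment> \<open>\<open>V\<close> is the generating function \<open>\<Sum>\<^sub>k z\<^sup>k v\<^sub>k\<close>, hence \<open>(1 - z C) V = v\<^sub>0\<close>.\<close>
  have "?E * rdet (V # map v ks) = rdet (map (companion_step R (\<lambda>t. ?c (ecoef R t)) fls_X) (V # map v ks))"
    unfolding E by (rule rdet_companion_step[symmetric]) (simp_all add: len R_def)
  also have "\<dots> = rdet ([v 0] @ map (\<lambda>c i. - fls_X * c i) (map (\<lambda>k i. v (Suc k) i - fls_X_inv * v k i) ks))"
    by (intro arg_cong[of _ _ rdet]) (auto simp: step_V step_v fun_eq_iff)
  also have "\<dots> = (- fls_X) ^ r * rdet (v 0 # map (\<lambda>k i. v (Suc k) i - fls_X_inv * v k i) ks)"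
    using rdet_scale_rows[of "[v 0]" "- fls_X" "map (\<lambda>k i. v (Suc k) i - fls_X_inv * v k i) ks"] len
    by simp
  \<comment> \<open>The first row in \<open>sigma_bar_B_schur\<close> has the correction term
    h_(-1-i) = 0 and is therefore v_0.\<close>
  also have "rdet (v 0 # map (\<lambda>k i. v (Suc k) i - fls_X_inv * v k i) ks) = ?Q"
    unfolding sigma_bar_B_schur[OF bw, unfolded R_def, simplified len length_Cons length_map, OF refl, folded R_def]
    by (intro arg_cong[of _ _ rdet]) (auto simp: v_def hseq_neg fun_eq_iff)
  finally have EV: "?E * rdet (V # map v ks) = (- fls_X) ^ r * ?Q" .
  have "rdet (V # map v ks) = ?H * (?E * rdet (V # map v ks))"
    using EH by (simp add: mult.commute flip: mult.assoc)
  also have "\<dots> = (- 1) ^ r * (fls_X ^ r * (?H * ?Q))"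
    by (simp add: EV power_minus[of "fls_X :: epoly fls"] mult_ac)
  finally have "fls_X ^ r * (?H * ?Q) = (- 1) ^ r * rdet (V # map v ks)"
    by (simp flip: mult.assoc power_mult_distrib)
  then have "fls_nth (?H * ?Q) (n - int r) = fls_nth ((- 1) ^ r * rdet (V # map v ks)) n"
    by (metis fls_X_power_times_conv_shift(1) fls_shift_nth uminus_add_conv_diff add.commute)
  also have "\<dots> = (- 1) ^ r * fls_nth (rdet (V # map v ks)) n"
    by (cases "even r") simp_all
  also have "fls_nth (rdet (V # map v ks)) n = (if n \<ge> 0 then psi R (basis_wedge (nat n # ks)) else 0)"
    using fls_nth_generating_det[OF len, of n] by (simp add: V_def[abs_def] v_def[abs_def] R_def)
  finally show ?thesis
    by (simp add: bwedge_eq ks_def R_def)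
qed

section \<open>The residue\<close>

text \<open>The range in \<open>fls_tensor\<close> depends on subdegrees. It may be exchanged for
  any finite set containing all indices where both factors are nonzero, by passing through the
  union.\<close>

lemma tensor_apply_fls_tensor:
  assumes \<eta>: "\<eta> 0 = 0"
    and I: "finite I" "\<And>i. i \<notin> I \<Longrightarrow> fls_nth f i = 0 \<or> fls_nth g (k - i) = 0"
  shows "tensor_apply \<eta> (fls_nth (fls_tensor f g) k) =
    (\<Sum>i\<in>I. of_int (\<eta> (fls_nth f i)) * fls_nth g (k - i))"
proof -
  let ?J = "{fls_subdegree f..k - fls_subdegree g}"
  let ?t = "\<lambda>i. of_int (\<eta> (fls_nth f i)) * fls_nth g (k - i)"
  have "tensor_apply \<eta> (fls_nth (fls_tensor f g) k) = (\<Sum>i\<in>?J. ?t i)"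
    unfolding fls_nth_fls_tensor tensor_apply_def additive.sum[OF additive_frag_eval] by simp
  also have "\<dots> = (\<Sum>i\<in>?J \<union> I. ?t i)"
    using I(1) by (intro sum.mono_neutral_left) (auto simp: I(2) \<eta> dest!: I(2))
  also have "\<dots> = (\<Sum>i\<in>I. ?t i)"
  proof (intro sum.mono_neutral_right ballI)
    fix i assume "i \<in> ?J \<union> I - I"
    then show "?t i = 0"
      using I(2)[of i] \<eta> by auto
  qed (use I(1) in auto)
  finally show ?thesis .
qed

lemma eventually_contr_basis_eq_0: "\<forall>\<^sub>F k in sequentially. contr_basis k x = 0"
proof (induction x rule: exterior_induct)
  case (wedge ms)
  have "\<forall>\<^sub>F k in sequentially. contr_list (\<lambda>m. Poly_Mapping.lookup m k) ms = 0"
  proof (induction ms)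
    case (Cons m ms)
    obtain N where "\<And>k. k \<in> Poly_Mapping.keys m \<Longrightarrow> k < N"
      using finite_nat_set_iff_bounded[of "Poly_Mapping.keys m"] by auto
    then have "\<forall>\<^sub>F k in sequentially. Poly_Mapping.lookup m k = 0"
      unfolding eventually_sequentially by (metis in_keys_iff not_le)
    with Cons show ?case
      by eventually_elim simp
  qed simp
  then show ?case
    by (simp add: contr_wedge[OF additive_lookup])
next
  case (diff x y)
  then show ?case
    by eventually_elim (simp add: additive.diff[OF additive_contr[OF additive_lookup]])
qed

section \<open>The residue as a formal sum, and its functionals\<close>

definition factor1 :: "nat \<Rightarrow> (nat \<Rightarrow> nat) \<Rightarrow> epoly fls" where
  "factor1 s l = fps_to_fls (Eser s) * fls_of_zinv (schur (Suc s) l (sigma_hseq s))"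

definition factor2 :: "nat \<Rightarrow> (nat \<Rightarrow> nat) \<Rightarrow> epoly fls" where
  "factor2 r l = fps_to_fls (Eser_inv (Suc r)) *
     fls_of_zinv (sigma_bar_B (Suc r) (schur (Suc r) l (hseq (Suc r))))"

definition plucker_residue :: "nat \<Rightarrow> ((nat \<Rightarrow> nat) \<Rightarrow>\<^sub>0 int) \<Rightarrow> (epoly \<times> epoly \<Rightarrow>\<^sub>0 int)" where
  "plucker_residue s a = fls_residue (\<Sum>l\<in>Poly_Mapping.keys a. \<Sum>m\<in>Poly_Mapping.keys a.
     fls_tensor (of_int (Poly_Mapping.lookup a l * Poly_Mapping.lookup a m) * factor1 s l) (factor2 (Suc s) m))"

lemma additive_fls_nth: "additive (\<lambda>f. fls_nth f i)"
  by (simp add: additive_def)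

lemma fls_nth_of_int_mult: "fls_nth (of_int n * f) i = of_int n * fls_nth (f :: 'a::ring_1 fls) i"
  by (rule additive_of_int_mult[OF additive_fls_nth])

lemma fls_nth_factor1:
  "fls_nth (factor1 s l) i =
    (if i \<le> int s then psi s (of_int ((- 1) ^ s) * contr_basis (nat (int s - i)) (bwedge (Suc s) l)) else 0)"
  unfolding factor1_def fls_nth_first_factor additive_of_int_mult[OF additive_psi] by simp

lemma fls_nth_factor2:
  assumes "l \<in> parts r"
  shows "fls_nth (factor2 r l) i =
    (if i \<ge> - int r then psi (Suc r) (of_int ((- 1) ^ r) * (ext_incl (frag_of (nat (i + int r))) * bwedge r l)) else 0)"
  using fls_nth_second_factor[OF assms, of "i + int r"]
  unfolding factor2_def additive_of_int_mult[OF additive_psi] by simp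

lemma keys_plucker_residue:
  assumes "Poly_Mapping.keys a \<subseteq> parts (Suc s)"
  shows "Poly_Mapping.keys (plucker_residue s a) \<subseteq> Bring s \<times> Bring (Suc (Suc s))"
proof -
  have keys_sum: "Poly_Mapping.keys (sum f S) \<subseteq> T"
    if "\<And>i. i \<in> S \<Longrightarrow> Poly_Mapping.keys (f i) \<subseteq> T" for f :: "'i \<Rightarrow> epoly \<times> epoly \<Rightarrow>\<^sub>0 int" and S T
    using that
  proof (induction S rule: infinite_finite_induct)
    case (insert i S)
    then show ?case
      using keys_add[of "f i" "sum f S"] by auto
  qed simp_all
  have "fls_nth (of_int n * factor1 s l) i \<in> Bring s" for n l i
    by (simp add: fls_nth_of_int_mult fls_nth_factor1 Bring_mult Bring_of_int psi_Bring)
  moreover have "fls_nth (factor2 (Suc s) m) i \<in> Bring (Suc (Suc s))" if "m \<in> Poly_Mapping.keys a" for m i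
    using assms that by (auto simp: fls_nth_factor2 psi_Bring)
  ultimately show ?thesis
    unfolding plucker_residue_def fls_residue_def fls_nth_sum fls_nth_fls_tensor
    by (intro keys_sum) (simp del: of_int_mult)
qed

lemma ext_incl_covec_mult:
  assumes \<eta>: "additive \<eta>" and N: "\<And>k. k \<ge> N \<Longrightarrow> contr_basis k x = 0"
  shows "ext_incl (covec \<eta> x) * y = (\<Sum>k<N. of_int (\<eta> (contr_basis k x)) * (ext_incl (frag_of k) * y))"
proof -
  have lookup: "Poly_Mapping.lookup (covec \<eta> x) k = \<eta> (contr_basis k x)" for k
    using covec_pairing[OF additive_lookup \<eta>] by simp
  have "Poly_Mapping.keys (covec \<eta> x) \<subseteq> {..<N}"
    using N additive.zero[OF \<eta>] by (metis in_keys_iff lessThan_iff lookup not_le subsetI)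
  then show ?thesis
    by (simp add: ext_incl_eq_sum lookup sum_distrib_right mult.assoc)
qed

text \<open>In the coefficient of z^(-1), contraction with the k-th coordinate meets multiplication
  by b_k for the same k. The signs (-1)^s and (-1)^(s+1) of the two factors combine to -1.\<close>

lemma tensor_apply_plucker_residue:
  assumes a: "Poly_Mapping.keys a \<subseteq> parts (Suc s)"
    and \<eta>: "\<forall>x\<in>Bring s. \<forall>y\<in>Bring s. \<eta> (x + y) = \<eta> x + \<eta> y"
  defines "x \<equiv> frag_eval (bwedge (Suc s)) a"
  shows "tensor_apply \<eta> (plucker_residue s a) =
    - psi (Suc (Suc s)) (ext_incl (covec (\<lambda>y. \<eta> (psi s y)) x) * x)"
proof -
  define K where "K = Poly_Mapping.keys a"
  define \<theta> where "\<theta> y = \<eta> (psi s y)" for y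
  define \<psi> where "\<psi> k m = psi (Suc (Suc s)) (ext_incl (frag_of k) * bwedge (Suc s) m)" for k m
  let ?a = "Poly_Mapping.lookup a" and ?b = "bwedge (Suc s)"
  have \<theta>: "additive \<theta>"
    using \<eta> by (simp add: additive_def \<theta>_def psi_add psi_Bring)
  have \<eta>0: "\<eta> 0 = 0"
    using additive.zero[OF \<theta>] by (simp add: \<theta>_def)
  have "\<forall>\<^sub>F k in sequentially. contr_basis k x = 0 \<and> (\<forall>l\<in>K. contr_basis k (?b l) = 0)"
    by (intro eventually_conj eventually_ball_finite eventually_contr_basis_eq_0 ballI) (simp add: K_def)
  then obtain N where N: "\<And>k. k \<ge> N \<Longrightarrow> contr_basis k x = 0" "\<And>k l. k \<ge> N \<Longrightarrow> l \<in> K \<Longrightarrow> contr_basis k (?b l) = 0"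
    unfolding eventually_sequentially by blast
  have summand: "tensor_apply \<eta> (fls_nth (fls_tensor (of_int (?a l * ?a m) * factor1 s l) (factor2 (Suc s) m)) (- 1)) =
      - (\<Sum>k<N. of_int (?a l * \<theta> (contr_basis k (?b l))) * (of_int (?a m) * \<psi> k m))"
    if l: "l \<in> K" and m: "m \<in> K" for l m
  proof -
    let ?f = "of_int (?a l * ?a m) * factor1 s l" and ?g = "factor2 (Suc s) m"
    have f: "fls_nth ?f i = (if i \<le> int s then psi s (of_int (?a l * ?a m) *
        (of_int ((- 1) ^ s) * contr_basis (nat (int s - i)) (?b l))) else 0)" for i
      unfolding fls_nth_of_int_mult fls_nth_factor1 additive_of_int_mult[OF additive_psi]
      by (simp only: mult_zero_right split: if_split) simp
    have m': "m \<in> parts (Suc s)"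
      using a m by (auto simp: K_def)
    \<comment> \<open>The substitution i = s - k: this power belongs to the k-th contraction, and
      its partner -1 - i = k - (s + 1) to b_k.\<close>
    let ?I = "(\<lambda>k. int s - int k) ` {..<N}"
    have "tensor_apply \<eta> (fls_nth (fls_tensor ?f ?g) (- 1)) =
        (\<Sum>i\<in>?I. of_int (\<eta> (fls_nth ?f i)) * fls_nth ?g (- 1 - i))"
    proof (rule tensor_apply_fls_tensor[where \<eta> = \<eta>, OF \<eta>0])
      fix i assume i: "i \<notin> ?I"
      show "fls_nth ?f i = 0 \<or> fls_nth ?g (- 1 - i) = 0"
      proof (cases "i \<le> int s")
        case True
        then have "i = int s - int (nat (int s - i))"
          by simp
        then have "nat (int s - i) \<ge> N"
          using i by (metis imageI lessThan_iff not_le)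
        then show ?thesis
          using N(2) l by (simp add: fls_nth_factor1 del: of_int_mult)
      qed (simp add: fls_nth_factor1 del: of_int_mult)
    qed simp
    also have "\<dots> = (\<Sum>k<N. of_int (\<eta> (fls_nth ?f (int s - int k))) * fls_nth ?g (int k - int (Suc s)))"
      by (subst sum.reindex) (auto simp: inj_on_def algebra_simps)
    also have "\<dots> = (\<Sum>k<N. - (of_int (?a l * \<theta> (contr_basis k (?b l))) * (of_int (?a m) * \<psi> k m)))"
    proof (rule sum.cong[OF refl])
      fix k
      have "\<eta> (fls_nth ?f (int s - int k)) = ?a l * ?a m * ((- 1) ^ s * \<theta> (contr_basis k (?b l)))"
        unfolding f \<theta>_def[symmetric] additive_of_int_mult[OF \<theta>]
        by (simp add: additive_of_int_mult[OF \<theta>, unfolded \<theta>_def] \<theta>_def del: of_int_mult of_int_power)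
      moreover have "fls_nth ?g (int k - int (Suc s)) = of_int ((- 1) ^ Suc s) * \<psi> k m"
        unfolding fls_nth_factor2[OF m'] additive_of_int_mult[OF additive_psi] by (simp add: \<psi>_def)
      ultimately show "of_int (\<eta> (fls_nth ?f (int s - int k))) * fls_nth ?g (int k - int (Suc s)) =
          - (of_int (?a l * \<theta> (contr_basis k (?b l))) * (of_int (?a m) * \<psi> k m))"
        by (cases "even s") (simp_all add: mult_ac)
    qed
    finally show ?thesis
      by (simp add: sum_negf)
  qed
  have "tensor_apply \<eta> (plucker_residue s a) = (\<Sum>l\<in>K. \<Sum>m\<in>K. tensor_apply \<eta>
      (fls_nth (fls_tensor (of_int (?a l * ?a m) * factor1 s l) (factor2 (Suc s) m)) (- 1)))"
    unfolding plucker_residue_def fls_residue_def fls_nth_sum tensor_apply_def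
      additive.sum[OF additive_frag_eval] K_def ..
  also have "\<dots> = (\<Sum>l\<in>K. \<Sum>m\<in>K. - (\<Sum>k<N. of_int (?a l * \<theta> (contr_basis k (?b l))) * (of_int (?a m) * \<psi> k m)))"
    by (intro sum.cong refl summand)
  \<comment> \<open>For each k the double sum over l and m is a product of two sums, each of which
    assembles x by additivity.\<close>
  also have "\<dots> = - (\<Sum>k<N. (\<Sum>l\<in>K. of_int (?a l * \<theta> (contr_basis k (?b l)))) * (\<Sum>m\<in>K. of_int (?a m) * \<psi> k m))"
    unfolding sum_product sum_negf
    by (subst sum.swap[of _ "{..<N}"], subst sum.swap[of _ "{..<N}" K]) simp
  also have "\<dots> = - (\<Sum>k<N. of_int (\<theta> (contr_basis k x)) * psi (Suc (Suc s)) (ext_incl (frag_of k) * x))"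
  proof -
    have "\<theta> (contr_basis k x) = (\<Sum>l\<in>K. ?a l * \<theta> (contr_basis k (?b l)))" for k
      unfolding x_def K_def
      by (simp add: additive_frag_eval_commute[OF additive_compose[OF \<theta> additive_contr[OF additive_lookup]]]
          frag_eval_def[of "\<lambda>l. \<theta> (contr_basis k (?b l))"])
    moreover have "psi (Suc (Suc s)) (ext_incl (frag_of k) * x) = (\<Sum>m\<in>K. of_int (?a m) * \<psi> k m)" for k
    proof -
      have "additive (\<lambda>y. psi (Suc (Suc s)) (ext_incl (frag_of k) * y))"
        by (simp add: additive_def distrib_left psi_add)
      from additive_frag_eval_commute[OF this] show ?thesis
        by (simp add: x_def K_def \<psi>_def frag_eval_def)
    qed
    ultimately show ?thesis
      by simp
  qed
  also have "\<dots> = - psi (Suc (Suc s)) (ext_incl (covec \<theta> x) * x)"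
    by (simp add: ext_incl_covec_mult[OF \<theta> N(1)] psi_sum additive_of_int_mult[OF additive_psi])
  finally show ?thesis
    by (simp add: \<theta>_def[abs_def])
qed

text \<open>Functionals on B_s and on the exterior algebra are exchanged by composing with
  \<open>psi s\<close> and \<open>phi s\<close>. Vanishing of the wedge may be tested after
  \<open>psi\<close>, which is injective in its degree.\<close>

lemma plucker_iff_residue:
  assumes a: "Poly_Mapping.keys a \<subseteq> parts (Suc s)"
  shows "plucker (frag_eval (bwedge (Suc s)) a) \<longleftrightarrow>
    tensor_eq (Bring s) (Bring (Suc (Suc s))) (plucker_residue s a) 0"
proof -
  define x where "x = frag_eval (bwedge (Suc s)) a"
  have x: "x \<in> ext_pow (Suc s)"
    unfolding x_def frag_eval_def by (intro ext_pow_sum ext_pow_of_int_mult bwedge_ext_pow)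
  have apply_eq: "tensor_apply \<eta> (plucker_residue s a) = 0 \<longleftrightarrow> ext_incl (covec (\<lambda>y. \<eta> (psi s y)) x) * x = 0"
    if "\<forall>x\<in>Bring s. \<forall>y\<in>Bring s. \<eta> (x + y) = \<eta> x + \<eta> y" for \<eta>
    unfolding tensor_apply_plucker_residue[OF a that] x_def[symmetric]
    using psi_eq_0_imp[OF ext_incl_mult_ext_pow[OF x]] by auto
  have "plucker x \<longleftrightarrow> (\<forall>\<eta>. (\<forall>x\<in>Bring s. \<forall>y\<in>Bring s. \<eta> (x + y) = \<eta> x + \<eta> y) \<longrightarrow>
      tensor_apply \<eta> (plucker_residue s a) = 0)"
  proof (intro iffI allI impI)
    fix \<eta> :: "epoly \<Rightarrow> int"
    assume "plucker x" and \<eta>: "\<forall>x\<in>Bring s. \<forall>y\<in>Bring s. \<eta> (x + y) = \<eta> x + \<eta> y"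
    moreover have "additive (\<lambda>y. \<eta> (psi s y))"
      using \<eta> by (simp add: additive_def psi_add psi_Bring)
    ultimately show "tensor_apply \<eta> (plucker_residue s a) = 0"
      by (simp add: apply_eq plucker_def)
  next
    assume *: "\<forall>\<eta>. (\<forall>x\<in>Bring s. \<forall>y\<in>Bring s. \<eta> (x + y) = \<eta> x + \<eta> y) \<longrightarrow>
      tensor_apply \<eta> (plucker_residue s a) = 0"
    show "plucker x"
      unfolding plucker_def
    proof (intro allI impI)
      fix \<eta> :: "M0 exterior \<Rightarrow> int"
      assume \<eta>: "additive \<eta>"
      let ?\<theta> = "\<lambda>p. \<eta> (phi s p)"
      have \<theta>: "\<forall>x\<in>Bring s. \<forall>y\<in>Bring s. ?\<theta> (x + y) = ?\<theta> x + ?\<theta> y"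
        by (simp add: phi_add additive.add[OF \<eta>])
      then have \<theta>': "additive (\<lambda>y. ?\<theta> (psi s y))"
        by (simp add: additive_def psi_add psi_Bring)
      \<comment> \<open>The coordinates of a covector are values of the functional at contractions
        of x; these have degree s, where \<open>phi s\<close> inverts \<open>psi s\<close>.\<close>
      have "covec (\<lambda>y. ?\<theta> (psi s y)) x = covec \<eta> x"
      proof (rule poly_mapping_eqI)
        show "Poly_Mapping.lookup (covec (\<lambda>y. ?\<theta> (psi s y)) x) k = Poly_Mapping.lookup (covec \<eta> x) k" for k
          using covec_pairing[OF additive_lookup \<theta>'] covec_pairing[OF additive_lookup \<eta>]
            phi_psi[OF contr_ext_pow[OF additive_lookup x]] by simp
      qed
      then show "ext_incl (covec \<eta> x) * x = 0"
        using apply_eq[OF \<theta>] * \<theta> by simp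
    qed
  qed
  then show ?thesis
    unfolding tensor_eq_zero_iff[OF keys_plucker_residue[OF a]] x_def .
qed

theorem theorem0p2:
  fixes r :: nat and a :: "(nat \<Rightarrow> nat) \<Rightarrow>\<^sub>0 int"
  assumes "r \<ge> 1" and "Poly_Mapping.keys a \<subseteq> parts r"
  shows "(\<Sum>l\<in>Poly_Mapping.keys a. of_int (Poly_Mapping.lookup a l) * bwedge r l) \<in> grassmann_cone r \<longleftrightarrow>
    tensor_eq (Bring (r - 1)) (Bring (r + 1))
      (fls_residue (\<Sum>l\<in>Poly_Mapping.keys a. \<Sum>m\<in>Poly_Mapping.keys a.
         fls_tensor
           (of_int (Poly_Mapping.lookup a l * Poly_Mapping.lookup a m) * fps_to_fls (Eser (r - 1)) *
              fls_of_zinv (schur r l (sigma_hseq (r - 1))))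
           (fps_to_fls (Eser_inv (r + 1)) *
              fls_of_zinv (sigma_bar_B (r + 1) (schur (r + 1) m (hseq (r + 1)))))))
      0"
proof -
  obtain s where r: "r = Suc s"
    using assms(1) by (cases r) auto
  have x: "frag_eval (bwedge r) a \<in> ext_pow r"
    unfolding frag_eval_def by (intro ext_pow_sum ext_pow_of_int_mult bwedge_ext_pow)
  show ?thesis
    using grassmann_cone_iff_plucker[OF assms(1) x] plucker_iff_residue[of a s] assms(2)
    by (simp add: r frag_eval_def plucker_residue_def factor1_def factor2_def mult.assoc)
qed

end
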